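(* Suppose Assumptions A, B and C of the context hold and that $\rho=1-1/G$ is fixed and close to $1$. Then the value $\sigma_{\mathrm{opt}}$ of $\sigma$ that minimizes the computing time $$\mathrm{CT}(\sigma,\rho)=\frac{\mathrm{IF}(\sigma,\rho)}{\sigma^{1/\varpi}}$$ is $\sigma_{\mathrm{opt}}\approx 2.16/\sqrt{1-\rho^2}$ if $\varpi=1/2$, and $\sigma_{\mathrm{opt}}\approx 0.82/\sqrt{1-\rho^2}$ if $\varpi=3/2-\epsilon$ for any arbitrarily small $\epsilon>0$. The unconditional acceptance rates of the sampler at these optimal values of $\sigma$ are approximately $0.28$ (case $\varpi=1/2$) and $0.68$ (case $\varpi=3/2-\epsilon$), respectively.
   Context: Setting. The likelihood factorises as $L(\theta)=\prod_{k=1}^G L_{(k)}(\theta)$, $\theta\in\Theta$. Each $L_{(k)}(\theta)$ is estimated unbiasedly by $\widehat L_{(k)}(\theta,u_{(k)})$, where the $u_{(k)}$ are independent with densities $p_{U_{(k)}}$; $N_{(k)}$ is the number of samples used. Put $\widehat L(\theta,u)=\prod_k\widehat L_{(k)}(\theta,u_{(k)})$, $u=u_{(1:G)}$. With prior density $p_\Theta$, $\pi(\theta)\propto p_\Theta(\theta)L(\theta)$ is the posterior and, with $\bar L=\int p_\Theta L$, the extended target is $\bar\pi(\theta,u_{(1:G)})=p_\Theta(\theta)\widehat L(\theta,u_{(1:G)})\prod_j p_{U_{(j)}}(u_{(j)})/\bar L$. Put $z_{(k)}(\theta,u_{(k)})=\log\widehat L_{(k)}(\theta,u_{(k)})-\log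 L_{(k)}(\theta)$; $z(\theta,\cdot)$ of any sub-collection of blocks is the sum of the corresponding $z_{(j)}$. $\mathbb V$ denotes variance and $\mathcal N(z;a,b^2)$ the normal density with mean $a$ and variance $b^2$. Assumption A. Let $u_{(1)},\dots,u_{(G)}$ be independent with $u_{(k)}\sim p_{U_{(k)}}$. (i) For each $k$ there are $\gamma^2_{(k)}(\theta)>0$, $N_{(k)}>0$ and $\varpi>0$ with $\mathbb V(z_{(k)}(\theta,u_{(k)}))=\gamma_{(k)}^2(\theta)/N_{(k)}^{2\varpi}$. (ii) For a given $\sigma^2>0$, $N_{(k)}=[G\gamma^2_{(k)}(\theta)/\sigma^2]^{1/(2\varpi)}$, so that $\mathbb V(z_{(k)})=\sigma^2/G$ and $\sigma^2=\mathbb V(z(\theta,u_{(1:G)}))$. (iii) Both $z(\theta,u_{(1:G)})$ and $z(\theta,u_{(1:k-1)},u_{(k+1:G)})$ are normally distributed for each $k$. Assumption B. If $u_{(k)}\sim p_{U_{(k)}}$ and $(u'_{(1:k-1)},u'_{(k+1:G)})\sim\bar\pi(\cdot\mid\theta)$ are independent, then $z_{(k)}(\theta,u_{(k)})+z(\theta,u'_{(1:k-1)},u'_{(k+1:G)})$ is normally distributed for a given $\theta$. Assumption C (perfect proposal). $q_\Theta(\theta\mid\theta')=\pi(\theta)$. The sampler. The block pseudo-marginal sampler is studied as the Metropolis–Hastings scheme on $(\theta,z)$ with target $\bar\pi(\theta,z)=\exp(z)g_Z(z\mid\theta)\pi(\theta)$, where $g_Z(z\mid\theta)=\mathcal N(z;-\sigma^2/2,\sigma^2)$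 is the density of $z(\theta,u_{(1:G)})$ when $u_{(k)}\sim p_{U_{(k)}}$ independently, so that $\bar\pi(z\mid\theta)=\mathcal N(z;\sigma^2/2,\sigma^2)$. From $(\theta',z')$ it proposes independently $\theta\sim\pi$ and $z\sim\mathcal N\left(-\frac{\sigma^2}{2G}+\rho z',\ \sigma^2(1-\rho^2)\right)$, $\rho=1-1/G$, and accepts with probability $\min\{1,\exp(z-z')\}$. Inefficiency. For a scalar function $\varphi$ of $\theta$ (with $0<\mathbb V_\pi(\varphi)<\infty$) and draws $(\theta^{[j]},z^{[j]})$, $j=1,\dots,M$, of the sampler in stationarity, let $\widehat\pi(\varphi)=\frac1M\sum_{j=1}^M\varphi(\theta^{[j]})$ and $\mathrm{IF}(\varphi,\sigma,\rho)=\lim_{M\to\infty}M\,\mathbb V_{\mathrm{PM}}(\widehat\pi(\varphi))/\mathbb V_\pi(\varphi)$, where $\mathbb V_{\mathrm{PM}}$ is the variance under the sampler and $\mathbb V_\pi$ the variance under $\theta\sim\pi$. Under Assumptions A–C this does not depend on $\varphi$ and is denoted $\mathrm{IF}(\sigma,\rho)$. The unconditional acceptance rate is the expected acceptance probability in stationarity, $\mathrm P(\mathrm{accept}\mid\rho,\sigma)=\mathbb E[\min\{1,\exp(z-z')\}]$ with $z'\sim\mathcal N(\sigma^2/2,\sigma^2)$ and $z$ drawn from the proposal given $z'$; it equals $2\left(1-\Phi\left(\sigma\sqrt{1-\rho}/\sqrt2\right)\right)$, with $\Phi$ the standard normal CDF. The approximate equalities are to be understood as: for $\rho$ close to $1$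 (i.e. in the limit $\rho\to1$) and, in the second case, $\epsilon$ close to $0$, the constants $\sigma_{\mathrm{opt}}\sqrt{1-\rho^2}$ and the acceptance rates take the stated values to two decimal places. *)

theory Defs
  imports "HOL-Probability.Probability"
begin

text \<open>
  A likelihood factorised into blocks 1, ..., G, a family of unbiased block estimators, and a
  proposal density for the parameter. All densities on the parameter space are taken with respect
  to the reference measure Theta, and the density of the random numbers of a block with respect
  to the reference measure in Ublk. The first argument of Ublk, pU, lhat and nsmp is the tuning
  value \<sigma>: changing \<sigma> changes the number nsmp of samples used by each block estimator, hence
  possibly the random numbers and the estimator itself, whereas the likelihood, the prior and
  the constants gam2 of the variance rates do not depend on \<sigma>. In qprop the current
  parameter comes first: qprop m \<theta>' \<theta> is q(\<theta> | \<theta>').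
\<close>

record ('t, 'u) block_model =
  nblk :: nat
  Theta :: "'t measure"
  prior :: "'t \<Rightarrow> real"
  lik :: "nat \<Rightarrow> 't \<Rightarrow> real"
  Ublk :: "real \<Rightarrow> nat \<Rightarrow> 'u measure"
  pU :: "real \<Rightarrow> nat \<Rightarrow> 'u \<Rightarrow> real"
  lhat :: "real \<Rightarrow> nat \<Rightarrow> 't \<Rightarrow> 'u \<Rightarrow> real"
  gam2 :: "nat \<Rightarrow> 't \<Rightarrow> real"
  nsmp :: "real \<Rightarrow> nat \<Rightarrow> 't \<Rightarrow> real"
  qprop :: "'t \<Rightarrow> 't \<Rightarrow> real"

definition blocks :: "('t, 'u) block_model \<Rightarrow> nat set" where
  "blocks m = {1..nblk m}"

definition likelihood :: "('t, 'u) block_model \<Rightarrow> 't \<Rightarrow> real" where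
  "likelihood m \<theta> = (\<Prod>k\<in>blocks m. lik m k \<theta>)"

definition Lbar :: "('t, 'u) block_model \<Rightarrow> real" where
  "Lbar m = (\<integral>\<theta>. prior m \<theta> * likelihood m \<theta> \<partial>Theta m)"

definition post :: "('t, 'u) block_model \<Rightarrow> 't \<Rightarrow> real" where
  "post m \<theta> = prior m \<theta> * likelihood m \<theta> / Lbar m"

definition posterior :: "('t, 'u) block_model \<Rightarrow> 't measure" where
  "posterior m = density (Theta m) (post m)"

definition block_law :: "('t, 'u) block_model \<Rightarrow> real \<Rightarrow> nat \<Rightarrow> 'u measure" where
  "block_law m \<sigma> k = density (Ublk m \<sigma> k) (pU m \<sigma> k)"

definition blocks_law :: "('t, 'u) block_model \<Rightarrow> real \<Rightarrow> (nat \<Rightarrow> 'u) measure" where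
  "blocks_law m \<sigma> = (\<Pi>\<^sub>M k\<in>blocks m. block_law m \<sigma> k)"

text \<open>
  The estimators are required to be positive because their logarithm is taken. Integrability of
  prior times likelihood says that the posterior is proper.
\<close>

definition block_model :: "('t, 'u) block_model \<Rightarrow> bool" where
  "block_model m \<longleftrightarrow>
     sigma_finite_measure (Theta m) \<and>
     prior m \<in> borel_measurable (Theta m) \<and>
     (\<forall>\<theta>\<in>space (Theta m). 0 \<le> prior m \<theta>) \<and>
     prob_space (density (Theta m) (prior m)) \<and>
     (\<forall>k\<in>blocks m. lik m k \<in> borel_measurable (Theta m) \<and>
        (\<forall>\<theta>\<in>space (Theta m). 0 < lik m k \<theta>)) \<and>
     integrable (Theta m) (\<lambda>\<theta>. prior m \<theta> * likelihood m \<theta>) \<and>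
     (\<forall>\<sigma>>0. \<forall>k\<in>blocks m.
        sigma_finite_measure (Ublk m \<sigma> k) \<and>
        pU m \<sigma> k \<in> borel_measurable (Ublk m \<sigma> k) \<and>
        (\<forall>u\<in>space (Ublk m \<sigma> k). 0 \<le> pU m \<sigma> k u) \<and>
        prob_space (block_law m \<sigma> k) \<and>
        (\<lambda>(\<theta>, u). lhat m \<sigma> k \<theta> u) \<in> borel_measurable (Theta m \<Otimes>\<^sub>M Ublk m \<sigma> k) \<and>
        (\<forall>\<theta>\<in>space (Theta m).
           (\<forall>u\<in>space (Ublk m \<sigma> k). 0 < lhat m \<sigma> k \<theta> u) \<and>
           (\<integral>u. lhat m \<sigma> k \<theta> u \<partial>block_law m \<sigma> k) = lik m k \<theta>))"

definition zblk :: "('t, 'u) block_model \<Rightarrow> real \<Rightarrow> nat \<Rightarrow> 't \<Rightarrow> 'u \<Rightarrow> real" where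
  "zblk m \<sigma> k \<theta> u = ln (lhat m \<sigma> k \<theta> u) - ln (lik m k \<theta>)"

definition zsum :: "('t, 'u) block_model \<Rightarrow> real \<Rightarrow> nat set \<Rightarrow> 't \<Rightarrow> (nat \<Rightarrow> 'u) \<Rightarrow> real" where
  "zsum m \<sigma> J \<theta> u = (\<Sum>j\<in>J. zblk m \<sigma> j \<theta> (u j))"

definition ext_target :: "('t, 'u) block_model \<Rightarrow> real \<Rightarrow> 't \<Rightarrow> (nat \<Rightarrow> 'u) \<Rightarrow> real" where
  "ext_target m \<sigma> \<theta> u =
     prior m \<theta> * (\<Prod>k\<in>blocks m. lhat m \<sigma> k \<theta> (u k)) * (\<Prod>k\<in>blocks m. pU m \<sigma> k (u k)) / Lbar m"

definition cond_target :: "('t, 'u) block_model \<Rightarrow> real \<Rightarrow> 't \<Rightarrow> (nat \<Rightarrow> 'u) measure" where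
  "cond_target m \<sigma> \<theta> =
     density (\<Pi>\<^sub>M k\<in>blocks m. Ublk m \<sigma> k)
       (\<lambda>u. ext_target m \<sigma> \<theta> u /
             (\<integral>u'. ext_target m \<sigma> \<theta> u' \<partial>(\<Pi>\<^sub>M k\<in>blocks m. Ublk m \<sigma> k)))"

definition normally_distributed :: "'a measure \<Rightarrow> ('a \<Rightarrow> real) \<Rightarrow> bool" where
  "normally_distributed M X \<longleftrightarrow> (\<exists>\<mu> s. 0 < s \<and> distributed M lborel X (normal_density \<mu> s))"

text \<open>
  The assumptions are imposed for every \<sigma> > 0, as \<sigma> is the variable of the optimisation. Parts
  (i) and (ii) together give variance \<sigma>^2 / G for each block, hence \<sigma>^2 for the sum over all
  independent blocks.
\<close>

definition assumption_A :: "('t, 'u) block_model \<Rightarrow> real \<Rightarrow> bool" where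
  "assumption_A m \<omega> \<longleftrightarrow> 0 < \<omega> \<and>
     (\<forall>\<sigma>>0. \<forall>\<theta>\<in>space (Theta m). \<forall>k\<in>blocks m.
        0 < gam2 m k \<theta> \<and> 0 < nsmp m \<sigma> k \<theta> \<and>
        prob_space.variance (block_law m \<sigma> k) (zblk m \<sigma> k \<theta>)
          = gam2 m k \<theta> / nsmp m \<sigma> k \<theta> powr (2 * \<omega>) \<and>
        nsmp m \<sigma> k \<theta> = (real (nblk m) * gam2 m k \<theta> / \<sigma>\<^sup>2) powr (1 / (2 * \<omega>)) \<and>
        normally_distributed (blocks_law m \<sigma>) (zsum m \<sigma> (blocks m) \<theta>) \<and>
        normally_distributed (blocks_law m \<sigma>) (zsum m \<sigma> (blocks m - {k}) \<theta>))"

text \<open>The conditional target given \<theta> exists only where the posterior density is positive.\<close>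

definition assumption_B :: "('t, 'u) block_model \<Rightarrow> bool" where
  "assumption_B m \<longleftrightarrow>
     (\<forall>\<sigma>>0. \<forall>\<theta>\<in>space (Theta m). 0 < post m \<theta> \<longrightarrow> (\<forall>k\<in>blocks m.
        normally_distributed (block_law m \<sigma> k \<Otimes>\<^sub>M cond_target m \<sigma> \<theta>)
          (\<lambda>(v, u'). zblk m \<sigma> k \<theta> v + zsum m \<sigma> (blocks m - {k}) \<theta> u')))"

definition assumption_C :: "('t, 'u) block_model \<Rightarrow> bool" where
  "assumption_C m \<longleftrightarrow>
     (\<forall>\<theta>'\<in>space (Theta m). \<forall>\<theta>\<in>space (Theta m). qprop m \<theta>' \<theta> = post m \<theta>)"

definition rho :: "nat \<Rightarrow> real" where
  "rho G = 1 - 1 / real G"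

text \<open>The second argument of the normal density is the standard deviation.\<close>

definition gZ :: "real \<Rightarrow> real \<Rightarrow> real" where
  "gZ \<sigma> z = normal_density (- \<sigma>\<^sup>2 / 2) \<sigma> z"

definition z_proposal :: "nat \<Rightarrow> real \<Rightarrow> real \<Rightarrow> real measure" where
  "z_proposal G \<sigma> z' =
     density lborel (normal_density (- \<sigma>\<^sup>2 / (2 * real G) + rho G * z') (\<sigma> * sqrt (1 - (rho G)\<^sup>2)))"

definition accept_prob :: "real \<Rightarrow> real \<Rightarrow> real" where
  "accept_prob z' z = min 1 (exp (z - z'))"

definition state_space :: "('t, 'u) block_model \<Rightarrow> ('t \<times> real) measure" where
  "state_space m = Theta m \<Otimes>\<^sub>M lborel"

definition pm_target :: "('t, 'u) block_model \<Rightarrow> real \<Rightarrow> ('t \<times> real) measure" where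
  "pm_target m \<sigma> = density (state_space m) (\<lambda>(\<theta>, z). exp z * gZ \<sigma> z * post m \<theta>)"

text \<open>
  One transition of the sampler. The acceptance probability is the Metropolis-Hastings one for
  the target above when qprop is the posterior density, which is the only case considered: the
  proposal for z is reversible with respect to gZ, so that only the factor exp z of the target
  remains in the ratio.
\<close>

definition pm_kernel :: "('t, 'u) block_model \<Rightarrow> real \<Rightarrow> 't \<times> real \<Rightarrow> ('t \<times> real) measure" where
  "pm_kernel m \<sigma> = (\<lambda>(\<theta>', z').
     (density (Theta m) (qprop m \<theta>') \<Otimes>\<^sub>M z_proposal (nblk m) \<sigma> z') \<bind>
       (\<lambda>(\<theta>, z). distr (measure_pmf (bernoulli_pmf (accept_prob z' z))) (state_space m)
          (\<lambda>b. if b then (\<theta>, z) else (\<theta>', z'))))"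

text \<open>
  The joint law of the first n draws, indexed by 0, ..., n - 1, of the stationary chain.
\<close>

definition pm_step :: "('t, 'u) block_model \<Rightarrow> real \<Rightarrow> nat \<Rightarrow> (nat \<Rightarrow> 't \<times> real) \<Rightarrow> ('t \<times> real) measure"
  where
  "pm_step m \<sigma> i x = (case i of 0 \<Rightarrow> pm_target m \<sigma> | Suc j \<Rightarrow> pm_kernel m \<sigma> (x j))"

definition pm_draws :: "('t, 'u) block_model \<Rightarrow> real \<Rightarrow> nat \<Rightarrow> (nat \<Rightarrow> 't \<times> real) measure" where
  "pm_draws m \<sigma> n =
     Ionescu_Tulcea.C (pm_step m \<sigma>) (\<lambda>_. state_space m) 0 n (\<lambda>_. undefined)"

definition test_function :: "('t, 'u) block_model \<Rightarrow> ('t \<Rightarrow> real) \<Rightarrow> bool" where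
  "test_function m \<phi> \<longleftrightarrow>
     \<phi> \<in> borel_measurable (Theta m) \<and>
     integrable (posterior m) (\<lambda>\<theta>. (\<phi> \<theta>)\<^sup>2) \<and>
     0 < prob_space.variance (posterior m) \<phi>"

definition IF_seq :: "('t, 'u) block_model \<Rightarrow> ('t \<Rightarrow> real) \<Rightarrow> real \<Rightarrow> nat \<Rightarrow> real" where
  "IF_seq m \<phi> \<sigma> n =
     real n * prob_space.variance (pm_draws m \<sigma> n) (\<lambda>x. (\<Sum>j<n. \<phi> (fst (x j))) / real n)
       / prob_space.variance (posterior m) \<phi>"

definition IF :: "('t, 'u) block_model \<Rightarrow> ('t \<Rightarrow> real) \<Rightarrow> real \<Rightarrow> real" where
  "IF m \<phi> \<sigma> = lim (IF_seq m \<phi> \<sigma>)"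

definition CT :: "('t, 'u) block_model \<Rightarrow> ('t \<Rightarrow> real) \<Rightarrow> real \<Rightarrow> real \<Rightarrow> real" where
  "CT m \<phi> \<omega> \<sigma> = IF m \<phi> \<sigma> / \<sigma> powr (1 / \<omega>)"

definition sigma_opt :: "('t, 'u) block_model \<Rightarrow> ('t \<Rightarrow> real) \<Rightarrow> real \<Rightarrow> real \<Rightarrow> bool" where
  "sigma_opt m \<phi> \<omega> \<sigma> \<longleftrightarrow> is_arg_min (CT m \<phi> \<omega>) (\<lambda>s. 0 < s) \<sigma>"

definition accept_rate :: "nat \<Rightarrow> real \<Rightarrow> real" where
  "accept_rate G \<sigma> =
     (\<integral>z'. (\<integral>z. accept_prob z' z \<partial>z_proposal G \<sigma> z')
        \<partial>density lborel (normal_density (\<sigma>\<^sup>2 / 2) \<sigma>))"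

end

theory Submission
  imports Defs
begin

text \<open>
  The parameter is proposed from the posterior whatever the current state, so a centred function
  \<open>\<phi>\<close> of it keeps its value as long as the proposals are rejected and is averaged to zero by the
  first acceptance. While proposals are rejected \<open>z\<close> does not move either, hence the
  autocorrelation at lag \<open>k\<close> is the mean of \<open>r(z)\<^sup>k\<close>, with \<open>r(z)\<close> the rejection probability at \<open>z\<close>,
  and the inefficiency is the mean of \<open>(1 + r) / (1 - r) = 2 / p - 1\<close>, where \<open>p = 1 - r\<close>.

  Write \<open>x = \<sigma> \<surd>(1 - \<rho>) / \<surd>2\<close>. The mean of \<open>p\<close> is \<open>2 \<Phi>(-x)\<close>, so by Jensen's inequality the
  inefficiency is at least \<open>F(x) = 1 / \<Phi>(-x) - 1\<close>, for all \<open>G \<ge> 3\<close> and \<open>\<sigma>\<close>; for fixed \<open>x\<close> it tends to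
  \<open>F(x)\<close> as \<open>G\<close> grows. These two facts replace uniform convergence: once the inefficiency at the
  minimiser of \<open>F(x) / x powr \<alpha>\<close>, \<open>\<alpha> = 1 / \<omega>\<close>, is close to its limit, the lower bound excludes all
  \<open>x\<close> outside a small window. The derivative of \<open>ln F\<close> with respect to \<open>ln x\<close> is increasing, by
  Mills' ratio, so the minimiser is located by evaluating it at the two ends of the window.
\<close>

section \<open>Integrals with respect to a kernel and second moments of a stationary chain\<close>

text \<open>What separates finite \<open>G\<close> from the limit is the dependence of
  \<open>p\<close> on \<open>z\<close>. With \<open>w\<close> the standardised current state, the
  log-ratio of a proposal is normal with mean \<open>-(a + b * w)\<close> and standard deviation
  \<open>t\<close>, where \<open>a = (1 - \<rho>) * \<sigma>^2\<close>,
  \<open>b = (1 - \<rho>) * \<sigma>\<close> and \<open>t = \<sigma> * sqrt (1 - \<rho>^2)\<close>.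
  For fixed \<open>x\<close>, \<open>a = 2 * x^2\<close>, \<open>t\<close> tends to
  \<open>2 * x\<close> and \<open>b\<close> to 0, so \<open>p\<close> becomes constant and Jensen's
  inequality sharp. Passing to this limit under the integral needs a majorant of
  \<open>1 / p\<close>. It is of the form \<open>exp (w^2 / 4)\<close> times a constant once
  \<open>\<bar>b\<bar> \<le> t / 2\<close>, that is \<open>\<rho> \<ge> 3/5\<close>; hence
  \<open>G \<ge> 3\<close>. The inefficiency involves only \<open>G\<close> and
  \<open>\<sigma>\<close>, so one threshold for \<open>G\<close> serves all models and test
  functions. Since \<open>\<sigma> * sqrt (1 - \<rho>^2) = x * sqrt 2 * sqrt (1 + \<rho>)\<close>
  tends to \<open>2 * x\<close>, the constants 2.16 and 0.82 are twice the minimisers of the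
  limiting cost for \<open>\<alpha> = 2\<close> and \<open>\<alpha> = 2/3\<close>. In the second
  case the exponent moves with \<open>\<epsilon>\<close>, so the argument is carried out for all
  pairs of a large \<open>G\<close> and an exponent near \<open>2/3\<close>.\<close>

text \<open>Positive and negative part of \<open>f\<close> have finite total integral, so their
  inner integrals are finite for almost every \<open>x\<close> and may be subtracted there.
  Integrability instead of boundedness is essential because test functions are unbounded.\<close>

lemma integral_bind_integrable:
  fixes f :: "'b \<Rightarrow> real"
  assumes K: "K \<in> M \<rightarrow>\<^sub>M subprob_algebra N" and ne: "space M \<noteq> {}"
    and int: "integrable (M \<bind> K) f"
  shows "(\<integral>y. f y \<partial>(M \<bind> K)) = (\<integral>x. \<integral>y. f y \<partial>K x \<partial>M)"
proof -
  have sb: "sets (M \<bind> K) = sets N"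
    by (rule sets_bind[OF sets_kernel[OF K] ne])
  have f: "f \<in> borel_measurable N"
    using borel_measurable_integrable[OF int] by (simp cong: measurable_cong_sets add: sb)
  define P where "P x = (\<integral>\<^sup>+y. ennreal (f y) \<partial>K x)" for x
  define Q where "Q x = (\<integral>\<^sup>+y. ennreal (- f y) \<partial>K x)" for x
  have fP: "(\<lambda>y. ennreal (f y)) \<in> borel_measurable N" and fQ: "(\<lambda>y. ennreal (- f y)) \<in> borel_measurable N"
    using f by simp_all
  have Pm: "P \<in> borel_measurable M" and Qm: "Q \<in> borel_measurable M"
    unfolding P_def Q_def
    by (rule measurable_compose[OF K nn_integral_measurable_subprob_algebra], fact)+
  have P: "(\<integral>\<^sup>+y. ennreal (f y) \<partial>(M \<bind> K)) = (\<integral>\<^sup>+x. P x \<partial>M)"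
    and Q: "(\<integral>\<^sup>+y. ennreal (- f y) \<partial>(M \<bind> K)) = (\<integral>\<^sup>+x. Q x \<partial>M)"
    unfolding P_def Q_def by (rule nn_integral_bind[OF _ K], fact)+
  have finP: "(\<integral>\<^sup>+x. P x \<partial>M) \<noteq> \<infinity>" and finQ: "(\<integral>\<^sup>+x. Q x \<partial>M) \<noteq> \<infinity>"
    using int unfolding P[symmetric] Q[symmetric] real_integrable_def by auto
  have aeP: "AE x in M. P x \<noteq> \<infinity>" and aeQ: "AE x in M. Q x \<noteq> \<infinity>"
    by (rule nn_integral_PInf_AE[OF Pm finP], rule nn_integral_PInf_AE[OF Qm finQ])
  have eq: "AE x in M. (\<integral>y. f y \<partial>K x) = enn2real (P x) - enn2real (Q x)"
    using aeP aeQ AE_space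
  proof eventually_elim
    case (elim x)
    have "f \<in> borel_measurable (K x)"
      using f sets_kernel[OF K elim(3)] by (simp cong: measurable_cong_sets)
    then have "integrable (K x) f"
      using elim unfolding real_integrable_def P_def Q_def by auto
    then show ?case by (simp add: real_lebesgue_integral_def P_def Q_def)
  qed
  have PI: "(\<integral>\<^sup>+x. ennreal (enn2real (P x)) \<partial>M) = (\<integral>\<^sup>+x. P x \<partial>M)"
    using aeP by (intro nn_integral_cong_AE) (auto simp: less_top)
  have QI: "(\<integral>\<^sup>+x. ennreal (enn2real (Q x)) \<partial>M) = (\<integral>\<^sup>+x. Q x \<partial>M)"
    using aeQ by (intro nn_integral_cong_AE) (auto simp: less_top)
  have iP: "integrable M (\<lambda>x. enn2real (P x))"
    by (rule integrableI_nonneg) (use PI finP Pm in \<open>auto simp: less_top\<close>)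
  have iQ: "integrable M (\<lambda>x. enn2real (Q x))"
    by (rule integrableI_nonneg) (use QI finQ Qm in \<open>auto simp: less_top\<close>)
  have m: "(\<lambda>x. \<integral>y. f y \<partial>K x) \<in> borel_measurable M"
    by (rule measurable_compose[OF K integral_measurable_subprob_algebra[OF f]])
  have m': "(\<lambda>x. enn2real (P x) - enn2real (Q x)) \<in> borel_measurable M"
    using Pm Qm by simp
  have "(\<integral>x. \<integral>y. f y \<partial>K x \<partial>M) = (\<integral>x. enn2real (P x) - enn2real (Q x) \<partial>M)"
    by (rule integral_cong_AE[OF m m' eq])
  also have "\<dots> = (\<integral>x. enn2real (P x) \<partial>M) - (\<integral>x. enn2real (Q x) \<partial>M)"
    by (rule Bochner_Integration.integral_diff[OF iP iQ])
  also have "\<dots> = enn2real (\<integral>\<^sup>+x. P x \<partial>M) - enn2real (\<integral>\<^sup>+x. Q x \<partial>M)"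
    using Pm Qm PI QI by (simp add: integral_eq_nn_integral)
  also have "\<dots> = (\<integral>y. f y \<partial>(M \<bind> K))"
    using int by (simp add: real_lebesgue_integral_def P Q)
  finally show "(\<integral>y. f y \<partial>(M \<bind> K)) = (\<integral>x. \<integral>y. f y \<partial>K x \<partial>M)" ..
qed

lemma cesaro_mean_tendsto:
  fixes c :: "nat \<Rightarrow> real"
  assumes "c \<longlonglongrightarrow> L"
  shows "(\<lambda>n. (\<Sum>i<n. c i) / real n) \<longlonglongrightarrow> L"
proof (rule LIMSEQ_I)
  fix e :: real assume e: "0 < e"
  obtain N where N: "\<And>i. i \<ge> N \<Longrightarrow> \<bar>c i - L\<bar> < e / 2"
    using LIMSEQ_D[OF assms, of "e / 2"] e by auto
  define D where "D = (\<Sum>i<N. \<bar>c i - L\<bar>)"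
  have D0: "0 \<le> D" unfolding D_def by (intro sum_nonneg) auto
  \<comment> \<open>Beyond \<open>M\<close> the fixed head \<open>D\<close> contributes less than
    \<open>e / 2\<close> to the mean.\<close>
  obtain M :: nat where M: "2 * D / e < real M"
    using reals_Archimedean2 by blast
  have "\<bar>(\<Sum>i<n. c i) / real n - L\<bar> < e" if n: "n \<ge> max (Suc N) M" for n
  proof -
    have n0: "real n > 0" using n by simp
    have "(\<Sum>i<n. c i) / real n - L = (\<Sum>i<n. c i - L) / real n"
      using n0 by (simp add: sum_subtractf field_simps)
    also have "\<bar>\<dots>\<bar> \<le> (\<Sum>i<n. \<bar>c i - L\<bar>) / real n"
      using n0 by (simp add: divide_right_mono)
    also have "(\<Sum>i<n. \<bar>c i - L\<bar>) = D + (\<Sum>i\<in>{N..<n}. \<bar>c i - L\<bar>)"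
      unfolding D_def lessThan_atLeast0 using n by (simp add: sum.atLeastLessThan_concat)
    also have "(\<Sum>i\<in>{N..<n}. \<bar>c i - L\<bar>) \<le> (\<Sum>i\<in>{N..<n}. e / 2)"
      by (intro sum_mono) (use N in \<open>auto intro: less_imp_le\<close>)
    also have "\<dots> \<le> real n * (e / 2)" using e n by (auto simp: of_nat_diff intro!: mult_right_mono)
    finally have "\<bar>(\<Sum>i<n. c i) / real n - L\<bar> \<le> (D + real n * (e / 2)) / real n"
      using n0 by (simp add: divide_right_mono)
    also have "\<dots> < e"
    proof -
      have "2 * D / e < real n" using M n by linarith
      then show ?thesis using n0 e by (simp add: field_simps)
    qed
    finally show ?thesis .
  qed
  then show "\<exists>no. \<forall>n\<ge>no. norm ((\<Sum>i<n. c i) / real n - L) < e"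
    by (intro exI[of _ "max (Suc N) M"]) auto
qed

lemma integrable_mult_square:
  fixes f g :: "'a \<Rightarrow> real"
  assumes [measurable]: "f \<in> borel_measurable M" "g \<in> borel_measurable M"
    and f: "integrable M (\<lambda>x. (f x)\<^sup>2)" and g: "integrable M (\<lambda>x. (g x)\<^sup>2)"
  shows "integrable M (\<lambda>x. f x * g x)"
proof (rule Bochner_Integration.integrable_bound)
  show "integrable M (\<lambda>x. (f x)\<^sup>2 + (g x)\<^sup>2)" using f g by simp
  have "\<bar>a * b\<bar> \<le> a\<^sup>2 + b\<^sup>2" for a b :: real
    using sum_squares_bound[of a b] sum_squares_bound[of a "-b"]
      zero_le_power2[of a] zero_le_power2[of b] by (auto simp: abs_if)
  then show "AE x in M. norm (f x * g x) \<le> norm ((f x)\<^sup>2 + (g x)\<^sup>2)" by auto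
qed simp

text \<open>Invariance is stated for functions with values in \<open>ennreal\<close>: it can then be
  proved by Tonelli's theorem without integrability, and it applies in turn to functions obtained by
  integrating against \<open>K\<close>.\<close>

locale stationary_chain =
  fixes S :: "'s measure" and P :: "'s measure" and K :: "'s \<Rightarrow> 's measure"
  assumes kernel: "K \<in> S \<rightarrow>\<^sub>M prob_algebra S"
    and initial: "P \<in> space (prob_algebra S)"
    and stationary: "\<And>f. f \<in> borel_measurable S \<Longrightarrow> (\<integral>\<^sup>+x. \<integral>\<^sup>+y. f y \<partial>K x \<partial>P) = (\<integral>\<^sup>+x. f x \<partial>P)"
begin

text \<open>Shaped like \<open>pm_step\<close>, so that \<open>law\<close> becomes
  \<open>pm_draws\<close> once the target is written as a product measure.\<close>

definition step :: "nat \<Rightarrow> (nat \<Rightarrow> 's) \<Rightarrow> 's measure" where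
  "step i \<omega> = (case i of 0 \<Rightarrow> P | Suc j \<Rightarrow> K (\<omega> j))"

lemma step_measurable: "step i \<in> PiM {0..<i} (\<lambda>_. S) \<rightarrow>\<^sub>M prob_algebra S"
proof (cases i)
  case 0
  have "(\<lambda>\<omega>. P) \<in> PiM {0..<i} (\<lambda>_. S) \<rightarrow>\<^sub>M prob_algebra S"
    by (rule measurable_const[OF initial])
  then show ?thesis using 0 by (simp add: step_def[abs_def])
next
  case (Suc j)
  have "(\<lambda>\<omega>. K (\<omega> j)) \<in> PiM {0..<i} (\<lambda>_. S) \<rightarrow>\<^sub>M prob_algebra S"
    by (rule measurable_compose[OF _ kernel]) (use Suc in simp)
  then show ?thesis using Suc by (simp add: step_def[abs_def])
qed

lemma step_prob: "x \<in> space (PiM {0..<i} (\<lambda>_. S)) \<Longrightarrow> prob_space (step i x)"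
  using measurable_space[OF step_measurable] by (simp add: space_prob_algebra)

sublocale IT: Ionescu_Tulcea step "\<lambda>_. S"
  by (rule Ionescu_Tulcea.intro) (simp_all add: measurable_prob_algebraD[OF step_measurable] step_prob)

lemma step_0: "step 0 \<omega> = P" and step_Suc: "step (Suc j) \<omega> = K (\<omega> j)"
  by (simp_all add: step_def)

definition law :: "nat \<Rightarrow> (nat \<Rightarrow> 's) measure" where
  "law n = IT.C 0 n (\<lambda>_. undefined)"

lemma start: "(\<lambda>_. undefined) \<in> space (PiM {0..<0::nat} (\<lambda>_. S))"
  by (simp add: space_PiM_empty)

lemma sets_P: "sets P = sets S"
  using initial by (simp add: space_prob_algebra)

lemma sets_law: "sets (law n) = sets (PiM {0..<n} (\<lambda>_. S))"
  using IT.sets_C[OF start, of n] by (simp add: law_def)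

lemma space_law: "space (law n) = space (PiM {0..<n} (\<lambda>_. S))"
  using sets_law by (rule sets_eq_imp_space_eq)

lemma prob_law: "prob_space (law n)"
  unfolding law_def by (rule IT.prob_space_C[OF start])

lemma law_in_space: "\<omega> \<in> space (law n) \<Longrightarrow> j < n \<Longrightarrow> \<omega> j \<in> space S"
  by (auto simp: space_law space_PiM PiE_iff)

lemma measurable_law:
  "f \<in> borel_measurable S \<Longrightarrow> j < n \<Longrightarrow> (\<lambda>\<omega>. f (\<omega> j)) \<in> borel_measurable (law n)"
  unfolding measurable_cong_sets[OF sets_law refl]
  by (rule measurable_compose[OF measurable_component_singleton]) auto

lemma eP_law: "IT.eP n \<in> law n \<rightarrow>\<^sub>M subprob_algebra (PiM {0..<Suc n} (\<lambda>_. S))"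
  unfolding measurable_cong_sets[OF sets_law refl] by (rule IT.measurable_eP)

lemma law_Suc: "law (Suc n) = law n \<bind> IT.eP n"
  by (simp add: law_def)

lemma nn_integral_law_Suc:
  assumes f: "f \<in> borel_measurable (PiM {0..<Suc n} (\<lambda>_. S))"
  shows "(\<integral>\<^sup>+\<omega>. f \<omega> \<partial>law (Suc n)) = (\<integral>\<^sup>+\<omega>. \<integral>\<^sup>+y. f (fun_upd \<omega> n y) \<partial>step n \<omega> \<partial>law n)"
  unfolding law_Suc nn_integral_bind[OF f eP_law]
  by (intro nn_integral_cong IT.nn_integral_eP f) (simp add: space_law)

lemma integral_law_Suc:
  fixes f :: "(nat \<Rightarrow> 's) \<Rightarrow> real"
  assumes f: "integrable (law (Suc n)) f"
  shows "(\<integral>\<omega>. f \<omega> \<partial>law (Suc n)) = (\<integral>\<omega>. \<integral>y. f (fun_upd \<omega> n y) \<partial>step n \<omega> \<partial>law n)"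
proof -
  have ne: "space (law n) \<noteq> {}" by (rule prob_space.not_empty[OF prob_law])
  have fm: "f \<in> borel_measurable (PiM {0..<Suc n} (\<lambda>_. S))"
    using borel_measurable_integrable[OF f] unfolding measurable_cong_sets[OF sets_law refl] .
  have "(\<integral>\<omega>. f \<omega> \<partial>law (Suc n)) = (\<integral>\<omega>. \<integral>y. f y \<partial>IT.eP n \<omega> \<partial>law n)"
    using f unfolding law_Suc by (intro integral_bind_integrable[OF eP_law ne])
  also have "\<dots> = (\<integral>\<omega>. \<integral>y. f (fun_upd \<omega> n y) \<partial>step n \<omega> \<partial>law n)"
  proof (rule Bochner_Integration.integral_cong[OF refl])
    fix \<omega> assume w: "\<omega> \<in> space (law n)"
    then have w': "\<omega> \<in> space (PiM {0..<n} (\<lambda>_. S))" by (simp add: space_law)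
    have "fun_upd \<omega> n \<in> step n \<omega> \<rightarrow>\<^sub>M PiM {0..<Suc n} (\<lambda>_. S)"
      unfolding measurable_cong_sets[OF IT.sets_P[OF w'] refl]
      by (rule measurable_fun_upd[where J="{0..<n}"]) (use w' in auto)
    then show "(\<integral>y. f y \<partial>IT.eP n \<omega>) = (\<integral>y. f (fun_upd \<omega> n y) \<partial>step n \<omega>)"
      unfolding IT.eP_def by (rule integral_distr) (rule fm)
  qed
  finally show ?thesis .
qed

text \<open>Induction on the number of draws, with \<open>f\<close> arbitrary: integrating out the
  last draw replaces \<open>f\<close> at coordinate \<open>n\<close> by its \<open>K\<close>-average
  at coordinate \<open>n - 1\<close>, and stationarity removes that average again.\<close>

lemma nn_integral_law_component:
  "f \<in> borel_measurable S \<Longrightarrow> j < n \<Longrightarrow> (\<integral>\<^sup>+\<omega>. f (\<omega> j) \<partial>law n) = (\<integral>\<^sup>+x. f x \<partial>P)"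
proof (induction n arbitrary: f j)
  case (Suc n)
  have "(\<lambda>\<omega>. f (\<omega> j)) \<in> borel_measurable (PiM {0..<Suc n} (\<lambda>_. S))"
    by (rule measurable_compose[OF measurable_component_singleton[of j "{0..<Suc n}" "\<lambda>_. S"] Suc.prems(1)])
      (use Suc.prems in auto)
  then have *: "(\<integral>\<^sup>+\<omega>. f (\<omega> j) \<partial>law (Suc n)) =
      (\<integral>\<^sup>+\<omega>. \<integral>\<^sup>+y. f ((fun_upd \<omega> n y) j) \<partial>step n \<omega> \<partial>law n)"
    by (rule nn_integral_law_Suc)
  show ?case
  proof (cases "j = n")
    case False
    then have j: "j < n" using Suc.prems by simp
    have "(\<integral>\<^sup>+\<omega>. \<integral>\<^sup>+y. f ((fun_upd \<omega> n y) j) \<partial>step n \<omega> \<partial>law n) = (\<integral>\<^sup>+\<omega>. f (\<omega> j) \<partial>law n)"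
    proof (rule nn_integral_cong)
      fix \<omega> assume "\<omega> \<in> space (law n)"
      then have "prob_space (step n \<omega>)" by (intro IT.prob_space_P) (simp add: space_law)
      then show "(\<integral>\<^sup>+y. f ((fun_upd \<omega> n y) j) \<partial>step n \<omega>) = f (\<omega> j)"
        using j by (simp add: prob_space.emeasure_space_1)
    qed
    then show ?thesis using * Suc.IH[OF Suc.prems(1) j] by simp
  next
    case True
    show ?thesis
    proof (cases n)
      case 0
      then show ?thesis using * True prob_space.emeasure_space_1[OF prob_law[of 0]]
        by (simp add: step_0 step_Suc)
    next
      case (Suc k)
      have m: "(\<lambda>x. \<integral>\<^sup>+y. f y \<partial>K x) \<in> borel_measurable S"
        by (rule measurable_compose[OF measurable_prob_algebraD[OF kernel]
              nn_integral_measurable_subprob_algebra[OF Suc.prems(1)]])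
      have "(\<integral>\<^sup>+\<omega>. \<integral>\<^sup>+y. f ((fun_upd \<omega> n y) j) \<partial>step n \<omega> \<partial>law n) = (\<integral>\<^sup>+\<omega>. (\<integral>\<^sup>+y. f y \<partial>K (\<omega> k)) \<partial>law n)"
        using True Suc by (simp add: step_0 step_Suc)
      also have "\<dots> = (\<integral>\<^sup>+x. \<integral>\<^sup>+y. f y \<partial>K x \<partial>P)"
        by (rule Suc.IH[OF m]) (use Suc in simp)
      also have "\<dots> = (\<integral>\<^sup>+x. f x \<partial>P)" by (rule stationary[OF Suc.prems(1)])
      finally show ?thesis using * by simp
    qed
  qed
qed simp

lemma distr_law_component: "j < n \<Longrightarrow> distr (law n) S (\<lambda>\<omega>. \<omega> j) = P"
proof (rule measure_eqI)
  assume j: "j < n"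
  have m: "(\<lambda>\<omega>. \<omega> j) \<in> law n \<rightarrow>\<^sub>M S"
    unfolding measurable_cong_sets[OF sets_law refl] by (rule measurable_component_singleton) (use j in auto)
  fix A assume "A \<in> sets (distr (law n) S (\<lambda>\<omega>. \<omega> j))"
  then have A: "A \<in> sets S" by simp
  have "emeasure (distr (law n) S (\<lambda>\<omega>. \<omega> j)) A = (\<integral>\<^sup>+x. indicator A x \<partial>distr (law n) S (\<lambda>\<omega>. \<omega> j))"
    using A by simp
  also have "\<dots> = (\<integral>\<^sup>+\<omega>. indicator A (\<omega> j) \<partial>law n)"
    using A m by (subst nn_integral_distr) auto
  also have "\<dots> = (\<integral>\<^sup>+x. indicator A x \<partial>P)"
    using A j by (intro nn_integral_law_component) auto
  also have "\<dots> = emeasure P A" using A sets_P by simp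
  finally show "emeasure (distr (law n) S (\<lambda>\<omega>. \<omega> j)) A = emeasure P A" .
qed (simp add: sets_P)

lemma
  fixes f :: "'s \<Rightarrow> real"
  assumes f: "f \<in> borel_measurable S" and j: "j < n"
  shows integrable_law_component: "integrable (law n) (\<lambda>\<omega>. f (\<omega> j)) \<longleftrightarrow> integrable P f"
    and integral_law_component: "(\<integral>\<omega>. f (\<omega> j) \<partial>law n) = (\<integral>x. f x \<partial>P)"
proof -
  have m: "(\<lambda>\<omega>. \<omega> j) \<in> law n \<rightarrow>\<^sub>M S"
    unfolding measurable_cong_sets[OF sets_law refl] by (rule measurable_component_singleton) (use j in auto)
  show "integrable (law n) (\<lambda>\<omega>. f (\<omega> j)) \<longleftrightarrow> integrable P f"
    using integrable_distr_eq[OF m f] distr_law_component[OF j] by simp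
  show "(\<integral>\<omega>. f (\<omega> j) \<partial>law n) = (\<integral>x. f x \<partial>P)"
    using integral_distr[OF m f] distr_law_component[OF j] by simp
qed

end

text \<open>Abstracts the renewal structure: \<open>\<phi>\<close> is the centred function and
  \<open>r\<close> the rejection probability, both as functions of the whole state. The weights
  \<open>r y ^ k\<close> in \<open>renewal\<close> make the family of functions
  \<open>r ^ k * \<phi>\<close> closed under the kernel, so the identity can be iterated;
  \<open>square\<close> controls the resulting geometric series.\<close>

locale thinned_chain = stationary_chain +
  fixes \<phi> r :: "'a \<Rightarrow> real"
  assumes \<phi>[measurable]: "\<phi> \<in> borel_measurable S" and r[measurable]: "r \<in> borel_measurable S"
    and r0: "\<And>x. x \<in> space S \<Longrightarrow> 0 \<le> r x" and r1: "\<And>x. x \<in> space S \<Longrightarrow> r x < 1"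
    and square: "integrable P (\<lambda>x. (\<phi> x)\<^sup>2 / (1 - r x))"
    and renewal: "\<And>x k. x \<in> space S \<Longrightarrow> (\<integral>y. r y ^ k * \<phi> y \<partial>K x) = r x ^ Suc k * \<phi> x"
begin

lemma space_P: "space P = space S"
  using sets_P by (rule sets_eq_imp_space_eq)

declare sets_P[measurable_cong]

lemma square_k: "integrable P (\<lambda>x. (\<phi> x)\<^sup>2 * r x ^ k)"
proof (rule Bochner_Integration.integrable_bound[OF square])
  show "AE x in P. norm ((\<phi> x)\<^sup>2 * r x ^ k) \<le> norm ((\<phi> x)\<^sup>2 / (1 - r x))"
  proof (rule AE_I2)
    fix x assume "x \<in> space P"
    then have x: "0 \<le> r x" "r x < 1" using r0 r1 space_P by auto
    have "r x ^ k \<le> 1" using x by (simp add: power_le_one)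
    also have "1 \<le> 1 / (1 - r x)" using x by simp
    finally have "(\<phi> x)\<^sup>2 * r x ^ k \<le> (\<phi> x)\<^sup>2 * (1 / (1 - r x))" by (rule mult_left_mono) simp
    then show "norm ((\<phi> x)\<^sup>2 * r x ^ k) \<le> norm ((\<phi> x)\<^sup>2 / (1 - r x))" using x by simp
  qed
qed measurable

text \<open>This is the autocovariance of \<open>\<phi>\<close> at lag \<open>k\<close>: each step
  back in time produces one factor \<open>r\<close>.\<close>

definition lag_moment :: "nat \<Rightarrow> real" where "lag_moment k = (\<integral>x. (\<phi> x)\<^sup>2 * r x ^ k \<partial>P)"

lemma pair_integrable:
  assumes "i < n" "j < n"
  shows "integrable (law n) (\<lambda>\<omega>. \<phi> (\<omega> i) * (r (\<omega> j) ^ k * \<phi> (\<omega> j)))"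
proof (rule integrable_mult_square)
  show "integrable (law n) (\<lambda>\<omega>. (\<phi> (\<omega> i))\<^sup>2)"
    using assms square_k[of 0] by (subst integrable_law_component[where f="\<lambda>x. (\<phi> x)\<^sup>2"]) auto
  have "(\<lambda>x. (r x ^ k * \<phi> x)\<^sup>2) = (\<lambda>x. (\<phi> x)\<^sup>2 * r x ^ (2 * k))"
    by (simp add: power_mult_distrib power_mult[symmetric] mult.commute)
  then show "integrable (law n) (\<lambda>\<omega>. (r (\<omega> j) ^ k * \<phi> (\<omega> j))\<^sup>2)"
    using assms square_k[of "2 * k"]
    by (subst integrable_law_component[where f="\<lambda>x. (r x ^ k * \<phi> x)\<^sup>2"]) auto
next
  show "(\<lambda>\<omega>. \<phi> (\<omega> i)) \<in> borel_measurable (law n)"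
    by (rule measurable_law[OF \<phi> assms(1)])
  show "(\<lambda>\<omega>. r (\<omega> j) ^ k * \<phi> (\<omega> j)) \<in> borel_measurable (law n)"
    by (rule measurable_law[where f="\<lambda>x. r x ^ k * \<phi> x", OF _ assms(2)]) measurable
qed

lemma sum_upd: "(\<Sum>j<n::nat. \<phi> ((fun_upd \<omega> n y) j)) = (\<Sum>j<n. \<phi> (\<omega> j))"
  by (intro sum.cong) auto

text \<open>The sum does not involve the last draw. Integrating that draw out by
  \<open>renewal\<close> moves the weight one step back and raises the power of \<open>r\<close> by
  one.\<close>

lemma cross_moment_Suc:
  "(\<integral>\<omega>. (\<Sum>j<Suc n. \<phi> (\<omega> j)) * (r (\<omega> (Suc n)) ^ k * \<phi> (\<omega> (Suc n))) \<partial>law (Suc (Suc n))) =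
   (\<integral>\<omega>. (\<Sum>j<Suc n. \<phi> (\<omega> j)) * (r (\<omega> n) ^ Suc k * \<phi> (\<omega> n)) \<partial>law (Suc n))"
proof -
  have "integrable (law (Suc (Suc n))) (\<lambda>\<omega>. (\<Sum>j<Suc n. \<phi> (\<omega> j)) * (r (\<omega> (Suc n)) ^ k * \<phi> (\<omega> (Suc n))))"
    unfolding sum_distrib_right by (intro Bochner_Integration.integrable_sum pair_integrable) auto
  note integral_law_Suc[OF this]
  also have "(\<integral>\<omega>. \<integral>y. (\<Sum>j<Suc n. \<phi> ((fun_upd \<omega> (Suc n) y) j)) *
      (r ((fun_upd \<omega> (Suc n) y) (Suc n)) ^ k * \<phi> ((fun_upd \<omega> (Suc n) y) (Suc n))) \<partial>step (Suc n) \<omega> \<partial>law (Suc n)) =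
      (\<integral>\<omega>. (\<Sum>j<Suc n. \<phi> (\<omega> j)) * (r (\<omega> n) ^ Suc k * \<phi> (\<omega> n)) \<partial>law (Suc n))"
  proof (rule Bochner_Integration.integral_cong[OF refl])
    fix \<omega> assume "\<omega> \<in> space (law (Suc n))"
    then have "\<omega> n \<in> space S" by (rule law_in_space) simp
    then show "(\<integral>y. (\<Sum>j<Suc n. \<phi> ((fun_upd \<omega> (Suc n) y) j)) *
      (r ((fun_upd \<omega> (Suc n) y) (Suc n)) ^ k * \<phi> ((fun_upd \<omega> (Suc n) y) (Suc n))) \<partial>step (Suc n) \<omega>) =
      (\<Sum>j<Suc n. \<phi> (\<omega> j)) * (r (\<omega> n) ^ Suc k * \<phi> (\<omega> n))"
      unfolding sum_upd using renewal[of "\<omega> n" k] by (simp add: step_Suc del: power_Suc)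
  qed
  finally show ?thesis .
qed

text \<open>The power \<open>k\<close> is there for the induction, since each use of
  \<open>cross_moment_Suc\<close> increases it. The variance needs the case
  \<open>k = 0\<close>.\<close>

lemma cross_moment:
  "(\<integral>\<omega>. (\<Sum>j<Suc n. \<phi> (\<omega> j)) * (r (\<omega> n) ^ k * \<phi> (\<omega> n)) \<partial>law (Suc n)) = (\<Sum>j\<le>n. lag_moment (k + j))"
proof (induction n arbitrary: k)
  case 0
  have "(\<integral>\<omega>. (\<Sum>j<Suc 0. \<phi> (\<omega> j)) * (r (\<omega> 0) ^ k * \<phi> (\<omega> 0)) \<partial>law (Suc 0)) =
      (\<integral>\<omega>. (\<phi> (\<omega> 0))\<^sup>2 * r (\<omega> 0) ^ k \<partial>law (Suc 0))"
    by (intro Bochner_Integration.integral_cong) (auto simp: power2_eq_square)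
  also have "\<dots> = lag_moment k"
    unfolding lag_moment_def by (rule integral_law_component) auto
  finally show ?case by simp
next
  case (Suc n)
  have "(\<integral>\<omega>. (\<Sum>j<Suc (Suc n). \<phi> (\<omega> j)) * (r (\<omega> (Suc n)) ^ k * \<phi> (\<omega> (Suc n))) \<partial>law (Suc (Suc n))) =
     (\<integral>\<omega>. (\<Sum>j<Suc n. \<phi> (\<omega> j)) * (r (\<omega> (Suc n)) ^ k * \<phi> (\<omega> (Suc n)))
        + (\<phi> (\<omega> (Suc n)))\<^sup>2 * r (\<omega> (Suc n)) ^ k \<partial>law (Suc (Suc n)))"
    by (intro Bochner_Integration.integral_cong) (auto simp: power2_eq_square algebra_simps)
  also have "\<dots> = (\<integral>\<omega>. (\<Sum>j<Suc n. \<phi> (\<omega> j)) * (r (\<omega> (Suc n)) ^ k * \<phi> (\<omega> (Suc n))) \<partial>law (Suc (Suc n)))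
        + (\<integral>\<omega>. (\<phi> (\<omega> (Suc n)))\<^sup>2 * r (\<omega> (Suc n)) ^ k \<partial>law (Suc (Suc n)))"
  proof (rule Bochner_Integration.integral_add)
    show "integrable (law (Suc (Suc n))) (\<lambda>\<omega>. (\<Sum>j<Suc n. \<phi> (\<omega> j)) * (r (\<omega> (Suc n)) ^ k * \<phi> (\<omega> (Suc n))))"
      unfolding sum_distrib_right by (intro Bochner_Integration.integrable_sum pair_integrable) auto
    show "integrable (law (Suc (Suc n))) (\<lambda>\<omega>. (\<phi> (\<omega> (Suc n)))\<^sup>2 * r (\<omega> (Suc n)) ^ k)"
      using square_k[of k] by (subst integrable_law_component[where f="\<lambda>x. (\<phi> x)\<^sup>2 * r x ^ k"]) auto
  qed
  also have "(\<integral>\<omega>. (\<phi> (\<omega> (Suc n)))\<^sup>2 * r (\<omega> (Suc n)) ^ k \<partial>law (Suc (Suc n))) = lag_moment k"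
    unfolding lag_moment_def by (rule integral_law_component[where f="\<lambda>x. (\<phi> x)\<^sup>2 * r x ^ k"]) auto
  also have "(\<integral>\<omega>. (\<Sum>j<Suc n. \<phi> (\<omega> j)) * (r (\<omega> (Suc n)) ^ k * \<phi> (\<omega> (Suc n))) \<partial>law (Suc (Suc n))) =
      (\<Sum>j\<le>n. lag_moment (Suc k + j))"
    unfolding cross_moment_Suc by (rule Suc.IH)
  also have "(\<Sum>j\<le>n. lag_moment (Suc k + j)) + lag_moment k = (\<Sum>j\<le>Suc n. lag_moment (k + j))"
    by (subst sum.atMost_Suc_shift) simp
  finally show ?case .
qed

text \<open>With \<open>S\<close> the partial sums,
  \<open>S (n+1)^2 = S n^2 + 2 * S (n+1) * \<phi> - \<phi>^2\<close>, where \<open>\<phi>\<close> is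
  taken at the last draw. The cross term contains the full sum so that \<open>cross_moment\<close>
  applies to it; the diagonal is then counted twice and subtracted once.\<close>

lemma second_moment_Suc:
  "(\<integral>\<omega>. (\<Sum>j<Suc n. \<phi> (\<omega> j))\<^sup>2 \<partial>law (Suc n)) =
   (\<integral>\<omega>. (\<Sum>j<n. \<phi> (\<omega> j))\<^sup>2 \<partial>law n) + (2 * (\<Sum>j<Suc n. lag_moment j) - lag_moment 0)"
proof -
  let ?s = "\<lambda>n \<omega>. \<Sum>j<n. \<phi> (\<omega> j)"
  have i1: "integrable (law (Suc n)) (\<lambda>\<omega>. (?s n \<omega>)\<^sup>2)"
    unfolding power2_eq_square sum_product
    by (intro Bochner_Integration.integrable_sum) (use pair_integrable[where k=0] in force)
  have i2: "integrable (law (Suc n)) (\<lambda>\<omega>. ?s (Suc n) \<omega> * (r (\<omega> n) ^ 0 * \<phi> (\<omega> n)))"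
    unfolding sum_distrib_right by (intro Bochner_Integration.integrable_sum pair_integrable) auto
  have i3: "integrable (law (Suc n)) (\<lambda>\<omega>. (\<phi> (\<omega> n))\<^sup>2)"
    using square_k[of 0] by (subst integrable_law_component[where f="\<lambda>x. (\<phi> x)\<^sup>2"]) auto
  have B0: "(\<integral>\<omega>. (\<phi> (\<omega> n))\<^sup>2 \<partial>law (Suc n)) = lag_moment 0"
    using integral_law_component[where f="\<lambda>x. (\<phi> x)\<^sup>2" and j=n and n="Suc n"] by (simp add: lag_moment_def)
  have "(\<integral>\<omega>. (?s (Suc n) \<omega>)\<^sup>2 \<partial>law (Suc n)) =
      (\<integral>\<omega>. (?s n \<omega>)\<^sup>2 + 2 * (?s (Suc n) \<omega> * (r (\<omega> n) ^ 0 * \<phi> (\<omega> n))) - (\<phi> (\<omega> n))\<^sup>2 \<partial>law (Suc n))"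
    by (intro Bochner_Integration.integral_cong) (auto simp: power2_eq_square algebra_simps)
  also have "\<dots> = (\<integral>\<omega>. (?s n \<omega>)\<^sup>2 \<partial>law (Suc n)) +
      2 * (\<integral>\<omega>. ?s (Suc n) \<omega> * (r (\<omega> n) ^ 0 * \<phi> (\<omega> n)) \<partial>law (Suc n)) - (\<integral>\<omega>. (\<phi> (\<omega> n))\<^sup>2 \<partial>law (Suc n))"
    using i1 i2 i3 by (simp del: sum.lessThan_Suc)
  also have "(\<integral>\<omega>. ?s (Suc n) \<omega> * (r (\<omega> n) ^ 0 * \<phi> (\<omega> n)) \<partial>law (Suc n)) = (\<Sum>j<Suc n. lag_moment j)"
    unfolding cross_moment by (simp add: lessThan_Suc_atMost)
  also have "(\<integral>\<omega>. (?s n \<omega>)\<^sup>2 \<partial>law (Suc n)) = (\<integral>\<omega>. (?s n \<omega>)\<^sup>2 \<partial>law n)"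
    unfolding integral_law_Suc[OF i1] sum_upd
  proof (rule Bochner_Integration.integral_cong[OF refl])
    fix \<omega> assume "\<omega> \<in> space (law n)"
    then have "prob_space (step n \<omega>)" by (intro IT.prob_space_P) (simp add: space_law)
    then show "(\<integral>y. (?s n \<omega>)\<^sup>2 \<partial>step n \<omega>) = (?s n \<omega>)\<^sup>2"
      by (simp add: prob_space.prob_space)
  qed
  finally show ?thesis using B0 by simp
qed

lemma second_moment:
  "(\<integral>\<omega>. (\<Sum>j<n. \<phi> (\<omega> j))\<^sup>2 \<partial>law n) = (\<Sum>i<n. 2 * (\<Sum>j<Suc i. lag_moment j) - lag_moment 0)"
proof (induction n)
  case (Suc n)
  show ?case unfolding second_moment_Suc Suc.IH by simp
qed simp

text \<open>Geometric series under the integral, with its own limit as the dominating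
  function.\<close>

lemma lag_moment_sums: "lag_moment sums (\<integral>x. (\<phi> x)\<^sup>2 / (1 - r x) \<partial>P)"
  unfolding sums_def
proof -
  have "(\<lambda>n. \<integral>x. (\<Sum>k<n. (\<phi> x)\<^sup>2 * r x ^ k) \<partial>P) \<longlonglongrightarrow> (\<integral>x. (\<phi> x)\<^sup>2 / (1 - r x) \<partial>P)"
  proof (rule integral_dominated_convergence[where w="\<lambda>x. (\<phi> x)\<^sup>2 / (1 - r x)"])
    show "AE x in P. (\<lambda>n. \<Sum>k<n. (\<phi> x)\<^sup>2 * r x ^ k) \<longlonglongrightarrow> (\<phi> x)\<^sup>2 / (1 - r x)"
    proof (rule AE_I2)
      fix x assume "x \<in> space P"
      then have "norm (r x) < 1" using r0 r1 space_P by auto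
      from sums_mult[OF geometric_sums[OF this], of "(\<phi> x)\<^sup>2"]
      show "(\<lambda>n. \<Sum>k<n. (\<phi> x)\<^sup>2 * r x ^ k) \<longlonglongrightarrow> (\<phi> x)\<^sup>2 / (1 - r x)" by (simp add: sums_def)
    qed
    show "AE x in P. norm (\<Sum>k<n. (\<phi> x)\<^sup>2 * r x ^ k) \<le> (\<phi> x)\<^sup>2 / (1 - r x)" for n
    proof (rule AE_I2)
      fix x assume "x \<in> space P"
      then have x: "0 \<le> r x" "r x < 1" using r0 r1 space_P by auto
      have "(\<Sum>k<n. r x ^ k) \<le> (\<Sum>k. r x ^ k)"
        by (rule sum_le_suminf) (use x in auto)
      also have "\<dots> = 1 / (1 - r x)" using x by (simp add: suminf_geometric)
      finally have "(\<phi> x)\<^sup>2 * (\<Sum>k<n. r x ^ k) \<le> (\<phi> x)\<^sup>2 * (1 / (1 - r x))" by (rule mult_left_mono) simp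
      then show "norm (\<Sum>k<n. (\<phi> x)\<^sup>2 * r x ^ k) \<le> (\<phi> x)\<^sup>2 / (1 - r x)"
        using x by (simp add: sum_distrib_left sum_nonneg)
    qed
  qed (use square in measurable)
  moreover have "(\<integral>x. (\<Sum>k<n. (\<phi> x)\<^sup>2 * r x ^ k) \<partial>P) = (\<Sum>k<n. lag_moment k)" for n
    unfolding lag_moment_def by (rule Bochner_Integration.integral_sum) (rule square_k)
  ultimately show "(\<lambda>n. sum lag_moment {..<n}) \<longlonglongrightarrow> (\<integral>x. (\<phi> x)\<^sup>2 / (1 - r x) \<partial>P)" by simp
qed

text \<open>The increments of the second moment converge by \<open>lag_moment_sums\<close>, and the
  quotient by \<open>n\<close> is their Cesaro mean.\<close>

theorem second_moment_limit:
  "(\<lambda>n. (\<integral>\<omega>. (\<Sum>j<n. \<phi> (\<omega> j))\<^sup>2 \<partial>law n) / real n) \<longlonglongrightarrow>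
     2 * (\<integral>x. (\<phi> x)\<^sup>2 / (1 - r x) \<partial>P) - (\<integral>x. (\<phi> x)\<^sup>2 \<partial>P)"
proof -
  have "(\<lambda>i. \<Sum>j<Suc i. lag_moment j) \<longlonglongrightarrow> (\<integral>x. (\<phi> x)\<^sup>2 / (1 - r x) \<partial>P)"
    using lag_moment_sums unfolding sums_def by (rule LIMSEQ_Suc)
  then have "(\<lambda>i. 2 * (\<Sum>j<Suc i. lag_moment j) - lag_moment 0) \<longlonglongrightarrow> 2 * (\<integral>x. (\<phi> x)\<^sup>2 / (1 - r x) \<partial>P) - lag_moment 0"
    by (intro tendsto_intros)
  from cesaro_mean_tendsto[OF this] show ?thesis
    unfolding second_moment by (simp add: lag_moment_def)
qed

end

section \<open>Metropolis-Hastings with independent parameter proposals\<close>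

lemma measurable_bernoulli_pmf:
  assumes g: "g \<in> borel_measurable M" and 0: "\<And>x. x \<in> space M \<Longrightarrow> 0 \<le> g x" and 1: "\<And>x. x \<in> space M \<Longrightarrow> g x \<le> 1"
  shows "(\<lambda>x. measure_pmf (bernoulli_pmf (g x))) \<in> M \<rightarrow>\<^sub>M prob_algebra (count_space UNIV)"
proof (rule measurable_prob_algebraI)
  show "(\<lambda>x. measure_pmf (bernoulli_pmf (g x))) \<in> M \<rightarrow>\<^sub>M subprob_algebra (count_space UNIV)"
  proof (rule measurable_subprob_algebra)
    fix A :: "bool set"
    have "emeasure (measure_pmf (bernoulli_pmf (g x))) A =
        indicator A True * ennreal (g x) + indicator A False * ennreal (1 - g x)" if "x \<in> space M" for x
    proof -
      have "emeasure (measure_pmf (bernoulli_pmf (g x))) A = (\<integral>\<^sup>+b. indicator A b \<partial>bernoulli_pmf (g x))"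
        by simp
      also have "\<dots> = indicator A True * ennreal (g x) + indicator A False * ennreal (1 - g x)"
        using 0[OF that] 1[OF that] by (subst nn_integral_bernoulli_pmf) auto
      finally show ?thesis .
    qed
    moreover have "(\<lambda>x. indicator A True * ennreal (g x) + indicator A False * ennreal (1 - g x)) \<in> borel_measurable M"
      using g by simp
    ultimately show "(\<lambda>x. emeasure (measure_pmf (bernoulli_pmf (g x))) A) \<in> borel_measurable M"
      by (subst measurable_cong) auto
  qed (auto intro: prob_space_imp_subprob_space prob_space_measure_pmf)
qed (rule prob_space_measure_pmf)

text \<open>\<open>Q\<close> is the law of the parameter, \<open>\<nu>\<close> the stationary law of
  \<open>z\<close>, \<open>q\<close> its proposal and \<open>a\<close> the acceptance probability.
  \<open>reversible\<close> says that accepted moves enter and leave each set of values of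
  \<open>z\<close> equally often. This marginal form of detailed balance is enough because the
  proposed parameter is a fresh draw from \<open>Q\<close>.\<close>

locale independent_mh =
  fixes Q :: "'t measure" and \<nu> :: "real measure" and q :: "real \<Rightarrow> real measure" and a :: "real \<Rightarrow> real \<Rightarrow> real"
    and S :: "('t \<times> real) measure" and K :: "'t \<times> real \<Rightarrow> ('t \<times> real) measure"
  assumes Q: "prob_space Q" and \<nu>: "prob_space \<nu>" and sets_\<nu>: "sets \<nu> = sets borel"
    and q: "q \<in> borel \<rightarrow>\<^sub>M prob_algebra borel"
    and a[measurable]: "(\<lambda>(z', z). a z' z) \<in> borel_measurable (borel \<Otimes>\<^sub>M borel)"
    and a0: "\<And>z' z. 0 \<le> a z' z" and a1: "\<And>z' z. a z' z \<le> 1"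
    and reversible: "\<And>f. f \<in> borel_measurable borel \<Longrightarrow>
      (\<integral>\<^sup>+z'. \<integral>\<^sup>+z. f z * ennreal (a z' z) \<partial>q z' \<partial>\<nu>) = (\<integral>\<^sup>+z'. \<integral>\<^sup>+z. f z' * ennreal (a z' z) \<partial>q z' \<partial>\<nu>)"
    and sets_S: "sets S = sets (Q \<Otimes>\<^sub>M borel)"
    and K: "\<And>\<theta>' z'. \<theta>' \<in> space Q \<Longrightarrow> K (\<theta>', z') = (Q \<Otimes>\<^sub>M q z') \<bind> (\<lambda>(\<theta>, z).
       distr (measure_pmf (bernoulli_pmf (a z' z))) S (\<lambda>b. if b then (\<theta>, z) else (\<theta>', z')))"
begin

declare sets_\<nu>[measurable_cong] sets_S[measurable_cong]

lemma prob_q: "prob_space (q z')" and sets_q[measurable_cong]: "sets (q z') = sets borel"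
  using measurable_space[OF q, of z'] by (auto simp: space_prob_algebra)

lemma q_subprob[measurable]: "q \<in> borel \<rightarrow>\<^sub>M subprob_algebra borel"
  by (rule measurable_prob_algebraD[OF q])

lemma space_S: "space S = space Q \<times> UNIV"
  using sets_eq_imp_space_eq[OF sets_S] by (simp add: space_pair_measure)

lemma sets_pair: "sets (Q \<Otimes>\<^sub>M q z') = sets S" and sets_target: "sets (Q \<Otimes>\<^sub>M \<nu>) = sets S"
  unfolding sets_S by (intro sets_pair_measure_cong; simp add: sets_q sets_\<nu>)+

lemma measurable_a[measurable (raw)]:
  "f \<in> borel_measurable M \<Longrightarrow> g \<in> borel_measurable M \<Longrightarrow> (\<lambda>x. a (f x) (g x)) \<in> borel_measurable M"
  using measurable_compose[OF measurable_Pair a, of f M g] by simp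

definition move :: "'t \<times> real \<Rightarrow> 't \<times> real \<Rightarrow> ('t \<times> real) measure" where
  "move x y = distr (measure_pmf (bernoulli_pmf (a (snd x) (snd y)))) S (\<lambda>b. if b then y else x)"

lemma K_move: "x \<in> space S \<Longrightarrow> K x = (Q \<Otimes>\<^sub>M q (snd x)) \<bind> move x"
proof -
  assume "x \<in> space S"
  moreover obtain \<theta>' z' where x: "x = (\<theta>', z')" by (cases x)
  ultimately have "\<theta>' \<in> space Q" by (simp add: space_S)
  moreover have "(\<lambda>(\<theta>, z). distr (measure_pmf (bernoulli_pmf (a z' z))) S (\<lambda>b. if b then (\<theta>, z) else (\<theta>', z'))) = move x"
    by (auto simp: x move_def fun_eq_iff)
  ultimately show ?thesis using K[of \<theta>' z'] by (simp add: x)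
qed

lemma measurable_move: "(\<lambda>(x, y). move x y) \<in> S \<Otimes>\<^sub>M S \<rightarrow>\<^sub>M prob_algebra S"
  unfolding move_def case_prod_beta
proof (rule measurable_distr_prob_space2)
  show "(\<lambda>p. measure_pmf (bernoulli_pmf (a (snd (fst p)) (snd (snd p))))) \<in> S \<Otimes>\<^sub>M S \<rightarrow>\<^sub>M prob_algebra (count_space UNIV)"
    by (rule measurable_bernoulli_pmf) (simp_all add: a0 a1)
  show "(\<lambda>(p, b). if b then snd p else fst p) \<in> (S \<Otimes>\<^sub>M S) \<Otimes>\<^sub>M count_space UNIV \<rightarrow>\<^sub>M S"
    by measurable
qed

lemma proposal_measurable: "(\<lambda>x. Q \<Otimes>\<^sub>M q (snd x)) \<in> S \<rightarrow>\<^sub>M prob_algebra S"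
proof -
  have "(\<lambda>x. Q) \<in> S \<rightarrow>\<^sub>M prob_algebra Q"
    by (rule measurable_const) (simp add: space_prob_algebra Q)
  moreover have "(\<lambda>x. q (snd x)) \<in> S \<rightarrow>\<^sub>M prob_algebra borel"
    by (rule measurable_compose[OF _ q]) simp
  ultimately have "(\<lambda>x. Q \<Otimes>\<^sub>M q (snd x)) \<in> S \<rightarrow>\<^sub>M prob_algebra (Q \<Otimes>\<^sub>M borel)"
    by (rule measurable_pair_prob)
  also have "prob_algebra (Q \<Otimes>\<^sub>M borel) = prob_algebra S"
    unfolding prob_algebra_def using subprob_algebra_cong[OF sets_S] by simp
  finally show ?thesis .
qed

lemma kernel: "K \<in> S \<rightarrow>\<^sub>M prob_algebra S"
proof -
  have "(\<lambda>x. (Q \<Otimes>\<^sub>M q (snd x)) \<bind> move x) \<in> S \<rightarrow>\<^sub>M prob_algebra S"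
    by (rule measurable_bind_prob_space2[OF proposal_measurable measurable_move])
  then show ?thesis by (subst measurable_cong[OF K_move])
qed

lemma move_subprob: "x \<in> space S \<Longrightarrow> move x \<in> (Q \<Otimes>\<^sub>M q (snd x)) \<rightarrow>\<^sub>M subprob_algebra S"
  unfolding measurable_cong_sets[OF sets_pair refl]
  by (rule measurable_prob_algebraD) (rule measurable_Pair2[OF measurable_move, simplified])

lemma nn_integral_move:
  assumes f: "f \<in> borel_measurable S" and "x \<in> space S" "y \<in> space S"
  shows "(\<integral>\<^sup>+w. f w \<partial>move x y) = f y * ennreal (a (snd x) (snd y)) + f x * ennreal (1 - a (snd x) (snd y))"
  unfolding move_def using assms a0 a1
  by (subst nn_integral_distr) (auto simp: nn_integral_bernoulli_pmf)

lemma integral_move: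
  fixes f :: "'t \<times> real \<Rightarrow> real"
  assumes f: "f \<in> borel_measurable S" and "x \<in> space S" "y \<in> space S"
  shows "(\<integral>w. f w \<partial>move x y) = f y * a (snd x) (snd y) + f x * (1 - a (snd x) (snd y))"
  unfolding move_def using assms a0 a1
  by (subst integral_distr) auto

lemma nn_integral_K:
  assumes f: "f \<in> borel_measurable S" and x: "x \<in> space S"
  shows "(\<integral>\<^sup>+w. f w \<partial>K x) = (\<integral>\<^sup>+\<theta>. \<integral>\<^sup>+z. f (\<theta>, z) * ennreal (a (snd x) z) \<partial>q (snd x) \<partial>Q)
     + f x * (\<integral>\<^sup>+z. ennreal (1 - a (snd x) z) \<partial>q (snd x))"
proof -
  interpret q: prob_space "q (snd x)" by (rule prob_q)
  interpret Q: prob_space Q by (rule Q)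
  have fm[measurable]: "f \<in> borel_measurable (Q \<Otimes>\<^sub>M borel)"
    using f by (simp cong: measurable_cong_sets add: sets_S)
  have "(\<integral>\<^sup>+w. f w \<partial>K x) = (\<integral>\<^sup>+y. \<integral>\<^sup>+w. f w \<partial>move x y \<partial>(Q \<Otimes>\<^sub>M q (snd x)))"
    unfolding K_move[OF x] by (rule nn_integral_bind[OF f move_subprob[OF x]])
  also have "\<dots> = (\<integral>\<^sup>+y. f y * ennreal (a (snd x) (snd y)) + f x * ennreal (1 - a (snd x) (snd y)) \<partial>(Q \<Otimes>\<^sub>M q (snd x)))"
    by (intro nn_integral_cong nn_integral_move f x) (use sets_eq_imp_space_eq[OF sets_pair] in auto)
  also have "\<dots> = (\<integral>\<^sup>+y. f y * ennreal (a (snd x) (snd y)) \<partial>(Q \<Otimes>\<^sub>M q (snd x))) +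
      (\<integral>\<^sup>+y. f x * ennreal (1 - a (snd x) (snd y)) \<partial>(Q \<Otimes>\<^sub>M q (snd x)))"
    by (rule nn_integral_add) measurable
  also have "(\<integral>\<^sup>+y. f x * ennreal (1 - a (snd x) (snd y)) \<partial>(Q \<Otimes>\<^sub>M q (snd x))) =
      (\<integral>\<^sup>+\<theta>. \<integral>\<^sup>+z. f x * ennreal (1 - a (snd x) z) \<partial>q (snd x) \<partial>Q)"
    by (subst q.nn_integral_fst[symmetric]) auto
  also have "\<dots> = f x * (\<integral>\<^sup>+z. ennreal (1 - a (snd x) z) \<partial>q (snd x))"
    by (simp add: nn_integral_cmult Q.emeasure_space_1)
  also have "(\<integral>\<^sup>+y. f y * ennreal (a (snd x) (snd y)) \<partial>(Q \<Otimes>\<^sub>M q (snd x))) =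
     (\<integral>\<^sup>+\<theta>. \<integral>\<^sup>+z. f (\<theta>, z) * ennreal (a (snd x) z) \<partial>q (snd x) \<partial>Q)"
    by (subst q.nn_integral_fst[symmetric]) auto
  finally show ?thesis .
qed

text \<open>The next state is either accepted, with a parameter independent of the old one, or the
  old state. In the accepted part the old parameter integrates out, and for each fixed new parameter
  \<open>reversible\<close> turns it into \<open>f\<close> times the acceptance probability
  \<open>\<alpha>\<close>. Together with the rejection probability \<open>\<beta>\<close> this
  restores \<open>f\<close>.\<close>

lemma stationary:
  assumes f: "f \<in> borel_measurable S"
  shows "(\<integral>\<^sup>+x. \<integral>\<^sup>+y. f y \<partial>K x \<partial>(Q \<Otimes>\<^sub>M \<nu>)) = (\<integral>\<^sup>+x. f x \<partial>(Q \<Otimes>\<^sub>M \<nu>))"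
proof -
  interpret nu: prob_space \<nu> by (rule \<nu>)
  interpret Q: prob_space Q by (rule Q)
  interpret pair_sigma_finite Q \<nu> ..
  have fm[measurable]: "f \<in> borel_measurable (Q \<Otimes>\<^sub>M borel)"
    using f by (simp cong: measurable_cong_sets add: sets_S)
  define h where "h p = (\<integral>\<^sup>+z. f (fst p, z) * ennreal (a (snd p) z) \<partial>q (snd p))" for p
  define \<alpha> where "\<alpha> z' = (\<integral>\<^sup>+z. ennreal (a z' z) \<partial>q z')" for z'
  define \<beta> where "\<beta> z' = (\<integral>\<^sup>+z. ennreal (1 - a z' z) \<partial>q z')" for z'
  have h[measurable]: "h \<in> borel_measurable (Q \<Otimes>\<^sub>M borel)"
    unfolding h_def
    by (rule nn_integral_measurable_subprob_algebra2[where N=borel]) measurable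
  have \<alpha>[measurable]: "\<alpha> \<in> borel_measurable borel" and \<beta>[measurable]: "\<beta> \<in> borel_measurable borel"
    unfolding \<alpha>_def \<beta>_def
    by (rule nn_integral_measurable_subprob_algebra2[where N=borel], measurable)+
  have \<alpha>\<beta>: "\<alpha> z + \<beta> z = 1" for z
  proof -
    interpret q: prob_space "q z" by (rule prob_q)
    have "\<alpha> z + \<beta> z = (\<integral>\<^sup>+w. ennreal (a z w) + ennreal (1 - a z w) \<partial>q z)"
      unfolding \<alpha>_def \<beta>_def by (rule nn_integral_add[symmetric]) measurable
    also have "\<dots> = (\<integral>\<^sup>+w. 1 \<partial>q z)"
      using a0 a1 by (intro nn_integral_cong) (simp flip: ennreal_plus)
    finally show ?thesis by (simp add: q.emeasure_space_1)
  qed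
  have "(\<integral>\<^sup>+x. \<integral>\<^sup>+y. f y \<partial>K x \<partial>(Q \<Otimes>\<^sub>M \<nu>)) =
      (\<integral>\<^sup>+x. (\<integral>\<^sup>+\<theta>. h (\<theta>, snd x) \<partial>Q) + f x * \<beta> (snd x) \<partial>(Q \<Otimes>\<^sub>M \<nu>))"
    unfolding h_def \<beta>_def fst_conv snd_conv
    by (intro nn_integral_cong nn_integral_K f) (use sets_eq_imp_space_eq[OF sets_target] in auto)
  also have "\<dots> = (\<integral>\<^sup>+x. (\<integral>\<^sup>+\<theta>. h (\<theta>, snd x) \<partial>Q) \<partial>(Q \<Otimes>\<^sub>M \<nu>)) + (\<integral>\<^sup>+x. f x * \<beta> (snd x) \<partial>(Q \<Otimes>\<^sub>M \<nu>))"
    by (rule nn_integral_add) measurable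
  also have "(\<integral>\<^sup>+x. (\<integral>\<^sup>+\<theta>. h (\<theta>, snd x) \<partial>Q) \<partial>(Q \<Otimes>\<^sub>M \<nu>)) = (\<integral>\<^sup>+\<theta>'. \<integral>\<^sup>+z'. \<integral>\<^sup>+\<theta>. h (\<theta>, z') \<partial>Q \<partial>\<nu> \<partial>Q)"
    by (subst nu.nn_integral_fst[symmetric]) auto
  also have "\<dots> = (\<integral>\<^sup>+z'. \<integral>\<^sup>+\<theta>. h (\<theta>, z') \<partial>Q \<partial>\<nu>)"
    by (simp add: Q.emeasure_space_1)
  also have "\<dots> = (\<integral>\<^sup>+\<theta>. \<integral>\<^sup>+z'. h (\<theta>, z') \<partial>\<nu> \<partial>Q)"
    by (rule Fubini') measurable
  also have "\<dots> = (\<integral>\<^sup>+\<theta>. \<integral>\<^sup>+z'. f (\<theta>, z') * \<alpha> z' \<partial>\<nu> \<partial>Q)"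
  proof (rule nn_integral_cong)
    fix \<theta> assume [simp]: "\<theta> \<in> space Q"
    have "(\<lambda>z. f (\<theta>, z)) \<in> borel_measurable borel" by measurable
    from reversible[OF this] show "(\<integral>\<^sup>+z'. h (\<theta>, z') \<partial>\<nu>) = (\<integral>\<^sup>+z'. f (\<theta>, z') * \<alpha> z' \<partial>\<nu>)"
      unfolding h_def \<alpha>_def by (simp add: nn_integral_cmult)
  qed
  also have "\<dots> = (\<integral>\<^sup>+x. f x * \<alpha> (snd x) \<partial>(Q \<Otimes>\<^sub>M \<nu>))"
    by (subst nu.nn_integral_fst[symmetric]) auto
  also have "\<dots> + (\<integral>\<^sup>+x. f x * \<beta> (snd x) \<partial>(Q \<Otimes>\<^sub>M \<nu>)) = (\<integral>\<^sup>+x. f x * \<alpha> (snd x) + f x * \<beta> (snd x) \<partial>(Q \<Otimes>\<^sub>M \<nu>))"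
    by (rule nn_integral_add[symmetric]) measurable
  also have "\<dots> = (\<integral>\<^sup>+x. f x \<partial>(Q \<Otimes>\<^sub>M \<nu>))"
    by (simp add: distrib_left[symmetric] \<alpha>\<beta>)
  finally show ?thesis .
qed

sublocale stationary_chain S "Q \<Otimes>\<^sub>M \<nu>" K
  by (rule stationary_chain.intro)
    (auto simp: kernel stationary space_prob_algebra sets_target Q \<nu> intro!: prob_space_pair)

definition reject :: "real \<Rightarrow> real" where "reject z' = 1 - (\<integral>z. a z' z \<partial>q z')"

lemma integrable_a: "integrable (q z') (a z')"
proof -
  interpret q: prob_space "q z'" by (rule prob_q)
  show ?thesis by (rule q.integrable_const_bound[where B=1]) (auto simp: a0 a1)
qed

lemma reject_bounds: "0 \<le> reject z'" "reject z' \<le> 1"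
proof -
  interpret q: prob_space "q z'" by (rule prob_q)
  have "(\<integral>z. a z' z \<partial>q z') \<le> (\<integral>z. 1 \<partial>q z')"
    by (intro integral_mono integrable_a) (auto simp: a1)
  then show "0 \<le> reject z'" by (simp add: reject_def q.prob_space)
  show "reject z' \<le> 1" by (simp add: reject_def a0)
qed

lemma measurable_reject[measurable]: "reject \<in> borel_measurable borel"
proof -
  \<comment> \<open>Integrand and measure both depend on \<open>z'\<close>. Pushing the measure to
    the pair \<open>(z', z)\<close> leaves a fixed integrand against a varying measure.\<close>
  have 1: "(\<lambda>z'. distr (q z') (borel \<Otimes>\<^sub>M borel) (\<lambda>z. (z', z))) \<in> borel \<rightarrow>\<^sub>M subprob_algebra (borel \<Otimes>\<^sub>M borel)"
    by (rule measurable_distr2[OF _ q_subprob]) measurable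
  have 2: "(\<integral>z. a z' z \<partial>q z') = (\<integral>p. a (fst p) (snd p) \<partial>distr (q z') (borel \<Otimes>\<^sub>M borel) (\<lambda>z. (z', z)))" for z'
    by (subst integral_distr) auto
  have "(\<lambda>z'. \<integral>p. a (fst p) (snd p) \<partial>distr (q z') (borel \<Otimes>\<^sub>M borel) (\<lambda>z. (z', z))) \<in> borel_measurable borel"
    by (rule measurable_compose[OF 1 integral_measurable_subprob_algebra]) measurable
  then show ?thesis unfolding reject_def[abs_def] 2 by simp
qed

text \<open>The proposed parameter is independent of the proposed \<open>z\<close>, so the accepted
  part factorises and contains the mean of \<open>\<phi>\<close>, which is 0. The rejected part is
  the old value times the rejection probability. Signed integrals are unavoidable here, whence the
  integrability checks.\<close>

lemma renewal:
  fixes \<phi> :: "'t \<Rightarrow> real"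
  assumes \<phi>: "integrable Q \<phi>" and mean: "(\<integral>\<theta>. \<phi> \<theta> \<partial>Q) = 0" and x: "x \<in> space S"
  shows "(\<integral>y. reject (snd y) ^ k * \<phi> (fst y) \<partial>K x) = reject (snd x) ^ Suc k * \<phi> (fst x)"
proof -
  interpret q: prob_space "q (snd x)" by (rule prob_q)
  interpret Q: prob_space Q by (rule Q)
  interpret pair_sigma_finite Q "q (snd x)" ..
  note \<phi>m[measurable] = borel_measurable_integrable[OF \<phi>]
  let ?f = "\<lambda>y. reject (snd y) ^ k * \<phi> (fst y)"
  let ?M = "Q \<Otimes>\<^sub>M q (snd x)"
  have f[measurable]: "?f \<in> borel_measurable S" by measurable
  have fst_int: "integrable ?M (\<lambda>y. \<phi> (fst y))"
    using \<phi> q.distr_pair_fst[of Q] by (subst integrable_distr_eq[symmetric]) (auto simp: \<phi>m)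
  have space_M: "space ?M = space S"
    by (rule sets_eq_imp_space_eq[OF sets_pair])
  have rej_a: "\<bar>reject z ^ k * a w z\<bar> \<le> 1" for z w
    using reject_bounds[of z] a0[of w z] a1[of w z] by (simp add: abs_mult power_le_one mult_le_one)
  have f_le: "\<bar>?f y\<bar> \<le> \<bar>\<phi> (fst y)\<bar>" for y
    using reject_bounds[of "snd y"] by (simp add: abs_mult mult_left_le_one_le power_le_one)
  \<comment> \<open>The nonnegative formula \<open>nn_integral_K\<close>, applied to the norm,
    supplies the integrability needed for the signed one.\<close>
  have fin: "(\<integral>\<^sup>+w. ennreal (norm (?f w)) \<partial>K x) < \<infinity>"
  proof -
    have "(\<integral>\<^sup>+w. ennreal (norm (?f w)) \<partial>K x) = (\<integral>\<^sup>+\<theta>. \<integral>\<^sup>+z. ennreal (norm (?f (\<theta>, z))) * ennreal (a (snd x) z) \<partial>q (snd x) \<partial>Q)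
     + ennreal (norm (?f x)) * (\<integral>\<^sup>+z. ennreal (1 - a (snd x) z) \<partial>q (snd x))"
      by (rule nn_integral_K[OF _ x]) measurable
    also have "\<dots> \<le> (\<integral>\<^sup>+\<theta>. \<integral>\<^sup>+z. ennreal \<bar>\<phi> \<theta>\<bar> * 1 \<partial>q (snd x) \<partial>Q) + ennreal (norm (?f x)) * (\<integral>\<^sup>+z. 1 \<partial>q (snd x))"
      using f_le a0 a1
      by (intro add_mono nn_integral_mono mult_mono) (auto intro!: ennreal_leI simp: ennreal_le_1)
    also have "\<dots> = (\<integral>\<^sup>+\<theta>. ennreal (norm (\<phi> \<theta>)) \<partial>Q) + ennreal (norm (?f x))"
      by (simp add: q.emeasure_space_1)
    also have "\<dots> < \<infinity>"
      using \<phi> by (simp add: integrable_iff_bounded)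
    finally show ?thesis .
  qed
  have Kx: "sets (K x) = sets S"
    by (rule sets_kernel[OF measurable_prob_algebraD[OF kernel] x])
  have "?f \<in> borel_measurable (K x)"
    unfolding measurable_cong_sets[OF Kx refl] by (rule f)
  then have int: "integrable (K x) ?f"
    using fin by (simp add: integrable_iff_bounded)
  have i1: "integrable ?M (\<lambda>y. ?f y * a (snd x) (snd y))"
  proof (rule Bochner_Integration.integrable_bound[OF fst_int])
    show "AE y in ?M. norm (?f y * a (snd x) (snd y)) \<le> norm (\<phi> (fst y))"
      using rej_a by (auto simp: abs_mult mult.assoc mult.left_commute intro!: AE_I2 mult_left_le)
  qed measurable
  have i2: "integrable ?M (\<lambda>y. ?f x * (1 - a (snd x) (snd y)))"
    by (rule finite_measure.integrable_const_bound[OF _ AE_I2, of _ _ "\<bar>?f x\<bar>"])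
      (use a0 a1 prob_space_pair[OF Q prob_q] in \<open>auto simp: abs_mult prob_space_def intro!: mult_left_le\<close>)
  have "(\<integral>y. ?f y \<partial>K x) = (\<integral>y. \<integral>w. ?f w \<partial>move x y \<partial>?M)"
    using int x unfolding K_move[OF x]
    by (intro integral_bind_integrable[OF move_subprob[OF x]]) (auto simp: space_M)
  also have "\<dots> = (\<integral>y. ?f y * a (snd x) (snd y) + ?f x * (1 - a (snd x) (snd y)) \<partial>?M)"
    by (intro Bochner_Integration.integral_cong refl integral_move f x) (simp add: space_M)
  also have "\<dots> = (\<integral>y. ?f y * a (snd x) (snd y) \<partial>?M) + (\<integral>y. ?f x * (1 - a (snd x) (snd y)) \<partial>?M)"
    by (rule Bochner_Integration.integral_add[OF i1 i2])
  also have "(\<integral>y. ?f y * a (snd x) (snd y) \<partial>?M) = (\<integral>\<theta>. \<integral>z. ?f (\<theta>, z) * a (snd x) z \<partial>q (snd x) \<partial>Q)"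
    using integral_fst'[OF i1] by simp
  also have "\<dots> = (\<integral>\<theta>. \<phi> \<theta> * (\<integral>z. reject z ^ k * a (snd x) z \<partial>q (snd x)) \<partial>Q)"
  proof (rule Bochner_Integration.integral_cong[OF refl])
    fix \<theta>
    have "(\<lambda>z. ?f (\<theta>, z) * a (snd x) z) = (\<lambda>z. \<phi> \<theta> * (reject z ^ k * a (snd x) z))"
      by (simp add: mult_ac)
    then show "(\<integral>z. ?f (\<theta>, z) * a (snd x) z \<partial>q (snd x)) = \<phi> \<theta> * (\<integral>z. reject z ^ k * a (snd x) z \<partial>q (snd x))"
      by simp
  qed
  also have "\<dots> = 0"
    by (simp add: mean)
  also have "(\<integral>y. ?f x * (1 - a (snd x) (snd y)) \<partial>?M) = (\<integral>\<theta>. \<integral>z. ?f x * (1 - a (snd x) z) \<partial>q (snd x) \<partial>Q)"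
    using integral_fst'[OF i2] by (simp only: fst_conv snd_conv)
  also have "\<dots> = ?f x * reject (snd x)"
    using integrable_a[of "snd x"] by (simp add: reject_def q.prob_space Q.prob_space)
  finally show ?thesis by simp
qed

text \<open>Under the target the parameter and \<open>z\<close> are independent, so the integral of
  \<open>\<phi>^2 / (1 - r)\<close> is a product. The factor depending on \<open>\<phi>\<close> is
  its second moment, which cancels in the inefficiency.\<close>

lemma second_moment_rejection:
  fixes \<phi> :: "'t \<Rightarrow> real"
  assumes \<phi>[measurable]: "\<phi> \<in> borel_measurable Q" and sq: "integrable Q (\<lambda>\<theta>. (\<phi> \<theta>)\<^sup>2)"
    and mean: "(\<integral>\<theta>. \<phi> \<theta> \<partial>Q) = 0"
    and lt1: "\<And>z. reject z < 1" and int: "integrable \<nu> (\<lambda>z. 1 / (1 - reject z))"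
  shows "(\<lambda>n. (\<integral>\<omega>. (\<Sum>j<n. \<phi> (fst (\<omega> j)))\<^sup>2 \<partial>law n) / real n) \<longlonglongrightarrow>
    (\<integral>\<theta>. (\<phi> \<theta>)\<^sup>2 \<partial>Q) * (\<integral>z. 2 / (1 - reject z) - 1 \<partial>\<nu>)"
proof -
  interpret nu: prob_space \<nu> by (rule \<nu>)
  interpret Q: prob_space Q by (rule Q)
  interpret pair_sigma_finite Q \<nu> ..
  have \<phi>1: "integrable Q \<phi>"
    using Q.square_integrable_imp_integrable[OF \<phi> sq] .
  let ?g = "\<lambda>x. (\<phi> (fst x))\<^sup>2 / (1 - reject (snd x))"
  have prod: "integrable (Q \<Otimes>\<^sub>M \<nu>) ?g"
    and prod_eq: "(\<integral>x. ?g x \<partial>(Q \<Otimes>\<^sub>M \<nu>)) = (\<integral>\<theta>. (\<phi> \<theta>)\<^sup>2 \<partial>Q) * (\<integral>z. 1 / (1 - reject z) \<partial>\<nu>)"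
  proof -
    show *: "integrable (Q \<Otimes>\<^sub>M \<nu>) ?g"
      using lt1 integrable_mult_right[OF int] integrable_mult_left[OF sq]
      by (intro Fubini_integrable) (auto simp: abs_mult less_imp_le divide_inverse)
    show "(\<integral>x. ?g x \<partial>(Q \<Otimes>\<^sub>M \<nu>)) = (\<integral>\<theta>. (\<phi> \<theta>)\<^sup>2 \<partial>Q) * (\<integral>z. 1 / (1 - reject z) \<partial>\<nu>)"
      using integral_fst'[OF *] by (simp add: divide_inverse)
  qed
  have sq_eq: "(\<integral>x. (\<phi> (fst x))\<^sup>2 \<partial>(Q \<Otimes>\<^sub>M \<nu>)) = (\<integral>\<theta>. (\<phi> \<theta>)\<^sup>2 \<partial>Q)"
    using integral_distr[of fst "Q \<Otimes>\<^sub>M \<nu>" Q "\<lambda>\<theta>. (\<phi> \<theta>)\<^sup>2"] nu.distr_pair_fst[of Q] by simp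
  interpret thinned_chain S "Q \<Otimes>\<^sub>M \<nu>" K "\<lambda>x. \<phi> (fst x)" "\<lambda>x. reject (snd x)"
    by unfold_locales (use reject_bounds lt1 prod renewal[OF \<phi>1 mean] in auto)
  have eq: "(\<integral>z. 2 / (1 - reject z) - 1 \<partial>\<nu>) = 2 * (\<integral>z. 1 / (1 - reject z) \<partial>\<nu>) - 1"
  proof -
    have "(\<integral>z. 2 / (1 - reject z) - 1 \<partial>\<nu>) = (\<integral>z. 2 * (1 / (1 - reject z)) - 1 \<partial>\<nu>)" by simp
    also have "\<dots> = (\<integral>z. 2 * (1 / (1 - reject z)) \<partial>\<nu>) - (\<integral>z. 1 \<partial>\<nu>)"
      by (rule Bochner_Integration.integral_diff[OF integrable_mult_right[OF int] nu.integrable_const])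
    also have "\<dots> = 2 * (\<integral>z. 1 / (1 - reject z) \<partial>\<nu>) - 1"
      by (simp only: integral_mult_right_zero) (simp add: nu.prob_space)
    finally show ?thesis .
  qed
  have "(\<integral>\<theta>. (\<phi> \<theta>)\<^sup>2 \<partial>Q) * (\<integral>z. 2 / (1 - reject z) - 1 \<partial>\<nu>) =
      2 * ((\<integral>\<theta>. (\<phi> \<theta>)\<^sup>2 \<partial>Q) * (\<integral>z. 1 / (1 - reject z) \<partial>\<nu>)) - (\<integral>\<theta>. (\<phi> \<theta>)\<^sup>2 \<partial>Q)"
    unfolding eq by (simp add: algebra_simps)
  then show ?thesis
    using second_moment_limit unfolding prod_eq sq_eq by (simp only:)
qed

end

section \<open>The block pseudo-marginal sampler\<close>

definition gauss :: "real \<Rightarrow> real \<Rightarrow> real measure" where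
  "gauss \<mu> s = density lborel (normal_density \<mu> s)"

lemma sets_gauss[measurable_cong, simp]: "sets (gauss \<mu> s) = sets borel"
  by (simp add: gauss_def)

lemma space_gauss[simp]: "space (gauss \<mu> s) = UNIV"
  by (simp add: gauss_def)

lemma prob_gauss: "0 < s \<Longrightarrow> prob_space (gauss \<mu> s)"
  unfolding gauss_def by (rule prob_space_normal_density)

lemma gauss_affine:
  assumes "0 < s" "\<alpha> \<noteq> 0"
  shows "gauss (\<beta> + \<alpha> * \<mu>) (\<bar>\<alpha>\<bar> * s) = distr (gauss \<mu> s) borel (\<lambda>x. \<beta> + \<alpha> * x)"
proof -
  interpret prob_space "gauss \<mu> s" by (rule prob_gauss) fact
  have "distributed (gauss \<mu> s) lborel (\<lambda>x. x) (normal_density \<mu> s)"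
    by (auto simp: distributed_def gauss_def distr_id2 intro!: measure_eqI)
  from normal_density_affine[OF this assms, of \<beta>]
  have "distr (gauss \<mu> s) lborel (\<lambda>x. \<beta> + \<alpha> * x) = gauss (\<beta> + \<alpha> * \<mu>) (\<bar>\<alpha>\<bar> * s)"
    by (simp add: distributed_def gauss_def)
  then show ?thesis by (simp cong: distr_cong)
qed

lemma gauss_std: "0 < s \<Longrightarrow> gauss \<mu> s = distr (gauss 0 1) borel (\<lambda>x. \<mu> + s * x)"
  using gauss_affine[of 1 s \<mu> 0] by simp

lemma gauss_kernel:
  assumes [measurable]: "f \<in> borel_measurable borel" and s: "0 < s"
  shows "(\<lambda>x. gauss (f x) s) \<in> borel \<rightarrow>\<^sub>M prob_algebra borel"
  unfolding gauss_std[OF s]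
proof (rule measurable_distr_prob_space2)
  show "(\<lambda>x. gauss 0 1) \<in> borel \<rightarrow>\<^sub>M prob_algebra borel"
    by (rule measurable_const) (simp add: space_prob_algebra prob_gauss)
qed measurable

text \<open>
  With \<open>x = z' - \<mu>\<close> and \<open>y = z - \<mu>\<close> the exponent of the joint density of two successive states of a
  stationary Gaussian autoregression is \<open>-(x\<^sup>2 + y\<^sup>2 - 2 \<rho> x y) / (2 \<sigma>\<^sup>2 (1 - \<rho>\<^sup>2))\<close>.
\<close>

lemma autoregression_symmetric:
  assumes \<sigma>: "0 < \<sigma>" and \<rho>: "\<rho>\<^sup>2 < 1"
  shows "normal_density \<mu> \<sigma> x * normal_density (\<mu> * (1 - \<rho>) + \<rho> * x) (\<sigma> * sqrt (1 - \<rho>\<^sup>2)) y =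
    normal_density \<mu> \<sigma> y * normal_density (\<mu> * (1 - \<rho>) + \<rho> * y) (\<sigma> * sqrt (1 - \<rho>\<^sup>2)) x"
proof -
  define c where "c = 1 - \<rho>\<^sup>2"
  have c: "c > 0" "\<rho>\<^sup>2 = 1 - c" using \<rho> by (auto simp: c_def)
  have s: "(\<sigma> * sqrt c)\<^sup>2 = \<sigma>\<^sup>2 * c" using c by (simp add: power_mult_distrib)
  have e: "-(x - \<mu>)\<^sup>2 / (2 * \<sigma>\<^sup>2) + -(y - (\<mu> * (1 - \<rho>) + \<rho> * x))\<^sup>2 / (2 * (\<sigma>\<^sup>2 * c)) =
     -((x - \<mu>)\<^sup>2 + (y - \<mu>)\<^sup>2 - 2 * \<rho> * (x - \<mu>) * (y - \<mu>)) / (2 * (\<sigma>\<^sup>2 * c))" for x y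
  proof -
    have 1: "-(x - \<mu>)\<^sup>2 / (2 * \<sigma>\<^sup>2) = (-c * (x - \<mu>)\<^sup>2) / (2 * (\<sigma>\<^sup>2 * c))"
      using c \<sigma> by (simp add: field_simps)
    have 2: "(y - (\<mu> * (1 - \<rho>) + \<rho> * x))\<^sup>2 = (y - \<mu>)\<^sup>2 - 2 * \<rho> * (x - \<mu>) * (y - \<mu>) + (1 - c) * (x - \<mu>)\<^sup>2"
      unfolding c(2)[symmetric] by (simp add: power2_eq_square algebra_simps)
    show ?thesis
      unfolding 1 2 add_divide_distrib[symmetric]
      by (rule arg_cong[where f="\<lambda>t. t / (2 * (\<sigma>\<^sup>2 * c))"]) (simp add: algebra_simps)
  qed
  have "normal_density \<mu> \<sigma> x * normal_density (\<mu> * (1 - \<rho>) + \<rho> * x) (\<sigma> * sqrt c) y =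
      1 / sqrt (2 * pi * \<sigma>\<^sup>2) * (1 / sqrt (2 * pi * (\<sigma>\<^sup>2 * c))) *
      exp (-((x - \<mu>)\<^sup>2 + (y - \<mu>)\<^sup>2 - 2 * \<rho> * (x - \<mu>) * (y - \<mu>)) / (2 * (\<sigma>\<^sup>2 * c)))" for x y
    unfolding normal_density_def s e[symmetric] exp_add by (simp add: mult_ac)
  then show ?thesis
    unfolding c_def[symmetric] by (simp only: add.commute[of "(x - \<mu>)\<^sup>2"] mult.commute[of "x - \<mu>"] mult.assoc)
qed

definition accept_at :: "nat \<Rightarrow> real \<Rightarrow> real \<Rightarrow> real" where
  "accept_at G \<sigma> z' = (\<integral>z. accept_prob z' z \<partial>z_proposal G \<sigma> z')"

text \<open>The value of \<open>IF\<close>, in a form free of the model and of the test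
  function.\<close>

definition inefficiency :: "nat \<Rightarrow> real \<Rightarrow> real" where
  "inefficiency G \<sigma> = (\<integral>z. 2 / accept_at G \<sigma> z - 1 \<partial>gauss (\<sigma>\<^sup>2 / 2) \<sigma>)"

lemma rho_bounds: "2 \<le> G \<Longrightarrow> 1/2 \<le> rho G" "2 \<le> G \<Longrightarrow> rho G < 1"
  by (auto simp: rho_def field_simps)

lemma rho_sq: "2 \<le> G \<Longrightarrow> (rho G)\<^sup>2 < 1"
  using rho_bounds[of G] by (simp add: power_less_one_iff abs_square_less_1)

text \<open>Since \<open>1 - rho G = 1 / G\<close>, the proposal is an autoregression with
  stationary mean \<open>-\<sigma>^2 / 2\<close>, hence reversible for \<open>gZ\<close>.\<close>

lemma z_proposal_gauss:
  "2 \<le> G \<Longrightarrow> z_proposal G \<sigma> z' = gauss ((-\<sigma>\<^sup>2/2) * (1 - rho G) + rho G * z') (\<sigma> * sqrt (1 - (rho G)\<^sup>2))"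
  by (simp add: z_proposal_def gauss_def rho_def field_simps)

lemma normal_density_exp_tilt: "0 < \<sigma> \<Longrightarrow> exp z * normal_density (-\<sigma>\<^sup>2/2) \<sigma> z = normal_density (\<sigma>\<^sup>2/2) \<sigma> z"
proof -
  assume "0 < \<sigma>"
  then have "z + -(z - (-\<sigma>\<^sup>2/2))\<^sup>2 / (2 * \<sigma>\<^sup>2) = -(z - \<sigma>\<^sup>2/2)\<^sup>2 / (2 * \<sigma>\<^sup>2)"
    by (simp add: power2_eq_square field_simps)
  then show ?thesis
    unfolding normal_density_def by (simp add: exp_add[symmetric] mult.left_commute)
qed

text \<open>Both sides are integrals against the joint density \<open>w\<close> of an accepted move,
  which is symmetric: the target is \<open>gZ\<close> tilted by \<open>exp z\<close>, the proposal
  is reversible for \<open>gZ\<close>, and what remains is symmetric by the Metropolis rule.\<close>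

lemma proposal_reversible:
  assumes G: "2 \<le> G" and \<sigma>: "0 < \<sigma>" and [measurable]: "f \<in> borel_measurable borel"
  shows "(\<integral>\<^sup>+z'. \<integral>\<^sup>+z. f z * ennreal (accept_prob z' z) \<partial>z_proposal G \<sigma> z' \<partial>gauss (\<sigma>\<^sup>2/2) \<sigma>) =
    (\<integral>\<^sup>+z'. \<integral>\<^sup>+z. f z' * ennreal (accept_prob z' z) \<partial>z_proposal G \<sigma> z' \<partial>gauss (\<sigma>\<^sup>2/2) \<sigma>)"
proof -
  define c where "c z' = (-\<sigma>\<^sup>2/2) * (1 - rho G) + rho G * z'" for z'
  define s where "s = \<sigma> * sqrt (1 - (rho G)\<^sup>2)"
  define w where "w z' z = normal_density (\<sigma>\<^sup>2/2) \<sigma> z' * (normal_density (c z') s z * accept_prob z' z)" for z' z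
  have wm[measurable]: "(\<lambda>(z', z). w z' z) \<in> borel_measurable (borel \<Otimes>\<^sub>M borel)"
    unfolding w_def c_def accept_prob_def normal_density_def by measurable
  have [measurable]: "(\<lambda>(z', z). accept_prob z' z) \<in> borel_measurable (borel \<Otimes>\<^sub>M borel)"
    unfolding accept_prob_def by measurable
  have a0: "0 \<le> accept_prob z' z" for z' z by (simp add: accept_prob_def)
  have sym: "w z' z = w z z'" for z z'
  proof -
    have "w z' z = (normal_density (-\<sigma>\<^sup>2/2) \<sigma> z' * normal_density (c z') s z) * (exp z' * accept_prob z' z)"
      unfolding w_def normal_density_exp_tilt[OF \<sigma>, symmetric] by (simp add: mult_ac)
    also have "normal_density (-\<sigma>\<^sup>2/2) \<sigma> z' * normal_density (c z') s z =
        normal_density (-\<sigma>\<^sup>2/2) \<sigma> z * normal_density (c z) s z'"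
      unfolding c_def s_def by (rule autoregression_symmetric[OF \<sigma> rho_sq[OF G]])
    \<comment> \<open>Both sides are \<open>min (exp z') (exp z)\<close>.\<close>
    also have "exp z' * accept_prob z' z = exp z * accept_prob z z'"
      by (auto simp: accept_prob_def min_def exp_add[symmetric] mult_exp_exp)
    finally show ?thesis
      unfolding w_def normal_density_exp_tilt[OF \<sigma>, symmetric] by (simp add: mult_ac)
  qed
  have main: "(\<integral>\<^sup>+z'. \<integral>\<^sup>+z. h z' z * ennreal (accept_prob z' z) \<partial>z_proposal G \<sigma> z' \<partial>gauss (\<sigma>\<^sup>2/2) \<sigma>) =
     (\<integral>\<^sup>+z'. \<integral>\<^sup>+z. h z' z * ennreal (w z' z) \<partial>lborel \<partial>lborel)"
    if [measurable]: "(\<lambda>(z', z). h z' z) \<in> borel_measurable (borel \<Otimes>\<^sub>M borel)" for h :: "real \<Rightarrow> real \<Rightarrow> ennreal"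
  proof -
    have 1: "(\<integral>\<^sup>+z. h z' z * ennreal (accept_prob z' z) \<partial>z_proposal G \<sigma> z') =
      (\<integral>\<^sup>+z. ennreal (normal_density (c z') s z) * (h z' z * ennreal (accept_prob z' z)) \<partial>lborel)" for z'
      unfolding z_proposal_gauss[OF G] gauss_def c_def[symmetric] s_def[symmetric]
      by (rule nn_integral_density) measurable
    have 2: "(\<lambda>z'. \<integral>\<^sup>+z. ennreal (normal_density (c z') s z) * (h z' z * ennreal (accept_prob z' z)) \<partial>lborel) \<in> borel_measurable lborel"
      unfolding c_def normal_density_def by measurable
    show ?thesis
      unfolding 1 unfolding gauss_def
    proof (subst nn_integral_density[OF _ 2], simp, intro nn_integral_cong)
      fix z' :: real
      have "ennreal (normal_density (\<sigma>\<^sup>2/2) \<sigma> z') *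
          (\<integral>\<^sup>+z. ennreal (normal_density (c z') s z) * (h z' z * ennreal (accept_prob z' z)) \<partial>lborel) =
        (\<integral>\<^sup>+z. ennreal (normal_density (\<sigma>\<^sup>2/2) \<sigma> z') *
          (ennreal (normal_density (c z') s z) * (h z' z * ennreal (accept_prob z' z))) \<partial>lborel)"
        by (rule nn_integral_cmult[symmetric]) measurable
      also have "\<dots> = (\<integral>\<^sup>+z. h z' z * ennreal (w z' z) \<partial>lborel)"
        by (intro nn_integral_cong) (simp add: w_def ennreal_mult' a0 mult_ac)
      finally show "ennreal (normal_density (\<sigma>\<^sup>2/2) \<sigma> z') *
          (\<integral>\<^sup>+z. ennreal (normal_density (c z') s z) * (h z' z * ennreal (accept_prob z' z)) \<partial>lborel) =
        (\<integral>\<^sup>+z. h z' z * ennreal (w z' z) \<partial>lborel)" .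
    qed
  qed
  have "(\<integral>\<^sup>+z'. \<integral>\<^sup>+z. f z * ennreal (accept_prob z' z) \<partial>z_proposal G \<sigma> z' \<partial>gauss (\<sigma>\<^sup>2/2) \<sigma>) =
     (\<integral>\<^sup>+z'. \<integral>\<^sup>+z. f z * ennreal (w z' z) \<partial>lborel \<partial>lborel)"
    by (rule main) measurable
  also have "\<dots> = (\<integral>\<^sup>+z. \<integral>\<^sup>+z'. f z * ennreal (w z' z) \<partial>lborel \<partial>lborel)"
    by (rule lborel_pair.Fubini') measurable
  also have "\<dots> = (\<integral>\<^sup>+z'. \<integral>\<^sup>+z. f z' * ennreal (w z' z) \<partial>lborel \<partial>lborel)"
    by (subst sym) simp
  also have "\<dots> = (\<integral>\<^sup>+z'. \<integral>\<^sup>+z. f z' * ennreal (accept_prob z' z) \<partial>z_proposal G \<sigma> z' \<partial>gauss (\<sigma>\<^sup>2/2) \<sigma>)"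
    by (rule main[symmetric]) measurable
  finally show ?thesis .
qed

section \<open>The posterior, the target as a product measure, and the sampler as an independent
  Metropolis-Hastings chain\<close>

lemma Lbar_pos:
  assumes "block_model m"
  shows "0 < Lbar m"
proof -
  from assms interpret prior: prob_space "density (Theta m) (prior m)" by (simp add: block_model_def)
  note m = assms[unfolded block_model_def]
  have pm[measurable]: "prior m \<in> borel_measurable (Theta m)" using m by simp
  have p0: "0 \<le> prior m \<theta>" if "\<theta> \<in> space (Theta m)" for \<theta> using m that by simp
  have l0: "0 < likelihood m \<theta>" if "\<theta> \<in> space (Theta m)" for \<theta>
    unfolding likelihood_def using m that by (intro prod_pos) auto
  have int: "integrable (Theta m) (\<lambda>\<theta>. prior m \<theta> * likelihood m \<theta>)" using m by simp
  have pl0: "0 \<le> prior m \<theta> * likelihood m \<theta>" if "\<theta> \<in> space (Theta m)" for \<theta>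
    using p0[OF that] l0[OF that] by simp
  have ge: "0 \<le> Lbar m" unfolding Lbar_def
    by (rule integral_nonneg_AE) (use pl0 in \<open>auto intro!: AE_I2\<close>)
  \<comment> \<open>The likelihood is positive, so a vanishing integral would force the prior to
    vanish almost everywhere, against its total mass 1.\<close>
  moreover have "Lbar m \<noteq> 0"
  proof
    assume "Lbar m = 0"
    then have "AE \<theta> in Theta m. prior m \<theta> * likelihood m \<theta> = 0"
      unfolding Lbar_def
      by (subst (asm) integral_nonneg_eq_0_iff_AE[OF int])
        (use pl0 in \<open>auto intro!: AE_I2\<close>)
    then have "AE \<theta> in Theta m. prior m \<theta> = 0"
      using AE_space by eventually_elim (use l0 in force)
    then have "AE \<theta> in Theta m. ennreal (prior m \<theta>) = 0" by eventually_elim simp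
    then have "(\<integral>\<^sup>+\<theta>. ennreal (prior m \<theta>) \<partial>Theta m) = 0"
      by (subst nn_integral_0_iff_AE) auto
    moreover have "emeasure (density (Theta m) (prior m)) (space (Theta m)) = (\<integral>\<^sup>+\<theta>. ennreal (prior m \<theta>) \<partial>Theta m)"
      by (subst emeasure_density) (auto intro!: nn_integral_cong)
    ultimately show False using prior.emeasure_space_1 by simp
  qed
  ultimately show ?thesis by simp
qed

lemma
  assumes "block_model m"
  shows measurable_post: "post m \<in> borel_measurable (Theta m)"
    and post_nonneg: "\<theta> \<in> space (Theta m) \<Longrightarrow> 0 \<le> post m \<theta>"
    and prob_posterior: "prob_space (posterior m)"
proof -
  note m = assms[unfolded block_model_def]
  have int: "integrable (Theta m) (\<lambda>\<theta>. prior m \<theta> * likelihood m \<theta>)" using m by simp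
  have l0: "0 < likelihood m \<theta>" if "\<theta> \<in> space (Theta m)" for \<theta>
    unfolding likelihood_def using m that by (intro prod_pos) auto
  have int_post: "integrable (Theta m) (post m)"
    unfolding post_def[abs_def] using int by simp
  show pm: "post m \<in> borel_measurable (Theta m)" using int_post by auto
  show p0: "0 \<le> post m \<theta>" if "\<theta> \<in> space (Theta m)" for \<theta>
    using m that l0[OF that] Lbar_pos[OF assms] unfolding post_def by auto
  have "(\<integral>\<theta>. post m \<theta> \<partial>Theta m) = 1"
    unfolding post_def using Lbar_pos[OF assms] by (simp add: Lbar_def)
  then have "(\<integral>\<^sup>+\<theta>. ennreal (post m \<theta>) \<partial>Theta m) = 1"
    using nn_integral_eq_integral[OF int_post] p0 by (simp add: AE_I2)
  then show "prob_space (posterior m)"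
    unfolding posterior_def using pm
    by (intro prob_spaceI) (subst emeasure_density, auto intro!: nn_integral_cong simp: indicator_def cong: nn_integral_cong)
qed

text \<open>Tilting \<open>gZ\<close> by \<open>exp z\<close> only shifts its mean from
  \<open>-\<sigma>^2 / 2\<close> to \<open>\<sigma>^2 / 2\<close>; no factor mixing the two
  coordinates is left.\<close>

lemma pm_target_eq:
  assumes "block_model m" and \<sigma>: "0 < \<sigma>"
  shows "pm_target m \<sigma> = posterior m \<Otimes>\<^sub>M gauss (\<sigma>\<^sup>2/2) \<sigma>"
proof -
  have "posterior m \<Otimes>\<^sub>M gauss (\<sigma>\<^sup>2/2) \<sigma> =
      density (Theta m \<Otimes>\<^sub>M lborel) (\<lambda>(\<theta>, z). ennreal (post m \<theta>) * ennreal (normal_density (\<sigma>\<^sup>2/2) \<sigma> z))"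
    unfolding posterior_def gauss_def
  proof (rule pair_measure_density)
    show "(\<lambda>x. ennreal (post m x)) \<in> borel_measurable (Theta m)"
      using measurable_post[OF assms(1)] by simp
    have "prob_space (density lborel (normal_density (\<sigma>\<^sup>2/2) \<sigma>))" by (rule prob_space_normal_density[OF \<sigma>])
    then show "sigma_finite_measure (density lborel (\<lambda>x. ennreal (normal_density (\<sigma>\<^sup>2/2) \<sigma> x)))"
      by (rule prob_space_imp_sigma_finite)
    show "sigma_finite_measure (lborel :: real measure)" by (rule lborel.sigma_finite_measure_axioms)
  qed simp
  also have "\<dots> = pm_target m \<sigma>"
    unfolding pm_target_def state_space_def
  proof (rule density_cong)
    have tilt: "exp z * gZ \<sigma> z = normal_density (\<sigma>\<^sup>2/2) \<sigma> z" for z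
      unfolding gZ_def by (rule normal_density_exp_tilt[OF \<sigma>])
    have [measurable]: "post m \<in> borel_measurable (Theta m)" by (rule measurable_post[OF assms(1)])
    show "(\<lambda>(\<theta>, z). ennreal (post m \<theta>) * ennreal (normal_density (\<sigma>\<^sup>2/2) \<sigma> z)) \<in> borel_measurable (Theta m \<Otimes>\<^sub>M lborel)"
      by measurable
    show "(\<lambda>x. ennreal (case x of (\<theta>, z) \<Rightarrow> exp z * gZ \<sigma> z * post m \<theta>)) \<in> borel_measurable (Theta m \<Otimes>\<^sub>M lborel)"
      unfolding gZ_def by measurable
    show "AE x in Theta m \<Otimes>\<^sub>M lborel. (case x of (\<theta>, z) \<Rightarrow> ennreal (post m \<theta>) * ennreal (normal_density (\<sigma>\<^sup>2/2) \<sigma> z)) =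
        ennreal (case x of (\<theta>, z) \<Rightarrow> exp z * gZ \<sigma> z * post m \<theta>)"
      using post_nonneg[OF assms(1)]
      by (intro AE_I2) (auto simp: space_pair_measure tilt mult.commute simp flip: ennreal_mult)
  qed
  finally show ?thesis ..
qed

lemma independent_mh_sampler:
  assumes bm: "block_model m" and C: "assumption_C m" and G: "2 \<le> nblk m" and \<sigma>: "0 < \<sigma>"
  shows "independent_mh (posterior m) (gauss (\<sigma>\<^sup>2/2) \<sigma>) (z_proposal (nblk m) \<sigma>) accept_prob (state_space m) (pm_kernel m \<sigma>)"
proof (rule independent_mh.intro)
  have s: "0 < \<sigma> * sqrt (1 - (rho (nblk m))\<^sup>2)" using \<sigma> rho_sq[OF G] by simp
  show "prob_space (posterior m)" by (rule prob_posterior[OF bm])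
  show "prob_space (gauss (\<sigma>\<^sup>2/2) \<sigma>)" by (rule prob_gauss[OF \<sigma>])
  show "sets (gauss (\<sigma>\<^sup>2/2) \<sigma>) = sets borel" by simp
  show "z_proposal (nblk m) \<sigma> \<in> borel \<rightarrow>\<^sub>M prob_algebra borel"
    unfolding z_proposal_gauss[OF G, abs_def] by (rule gauss_kernel[OF _ s]) measurable
  show "(\<lambda>(z', z). accept_prob z' z) \<in> borel_measurable (borel \<Otimes>\<^sub>M borel)"
    unfolding accept_prob_def by measurable
  show "0 \<le> accept_prob z' z" "accept_prob z' z \<le> 1" for z' z
    by (simp_all add: accept_prob_def)
  show "(\<integral>\<^sup>+z'. \<integral>\<^sup>+z. f z * ennreal (accept_prob z' z) \<partial>z_proposal (nblk m) \<sigma> z' \<partial>gauss (\<sigma>\<^sup>2/2) \<sigma>) =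
    (\<integral>\<^sup>+z'. \<integral>\<^sup>+z. f z' * ennreal (accept_prob z' z) \<partial>z_proposal (nblk m) \<sigma> z' \<partial>gauss (\<sigma>\<^sup>2/2) \<sigma>)"
    if "f \<in> borel_measurable borel" for f
    by (rule proposal_reversible[OF G \<sigma> that])
  show "sets (state_space m) = sets (posterior m \<Otimes>\<^sub>M borel)"
    unfolding state_space_def posterior_def by (intro sets_pair_measure_cong) auto
  fix \<theta>' z' assume "\<theta>' \<in> space (posterior m)"
  then have t: "\<theta>' \<in> space (Theta m)" by (simp add: posterior_def)
  \<comment> \<open>The perfect proposal enters here. It fixes \<open>qprop\<close> only on the
    parameter space, so its measurability is inherited from \<open>post\<close>.\<close>
  have "density (Theta m) (qprop m \<theta>') = posterior m"
    unfolding posterior_def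
  proof (rule density_cong)
    show "(\<lambda>x. ennreal (post m x)) \<in> borel_measurable (Theta m)" using measurable_post[OF bm] by simp
    moreover have eq: "qprop m \<theta>' \<theta> = post m \<theta>" if "\<theta> \<in> space (Theta m)" for \<theta>
      using C t that by (simp add: assumption_C_def)
    ultimately show "(\<lambda>x. ennreal (qprop m \<theta>' x)) \<in> borel_measurable (Theta m)"
      by (subst measurable_cong) auto
    show "AE x in Theta m. ennreal (qprop m \<theta>' x) = ennreal (post m x)"
      by (intro AE_I2) (simp add: eq)
  qed
  then show "pm_kernel m \<sigma> (\<theta>', z') = (posterior m \<Otimes>\<^sub>M z_proposal (nblk m) \<sigma> z') \<bind> (\<lambda>(\<theta>, z).
       distr (measure_pmf (bernoulli_pmf (accept_prob z' z))) (state_space m) (\<lambda>b. if b then (\<theta>, z) else (\<theta>', z')))"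
    by (simp add: pm_kernel_def)
qed

text \<open>Every draw has the posterior as its parameter law, so the variance of the average is the
  second moment of the centred sum divided by \<open>n^2\<close>, and
  \<open>second_moment_rejection\<close> applies to the centred function.\<close>

theorem IF_seq_tendsto:
  assumes bm: "block_model m" and C: "assumption_C m" and \<phi>: "test_function m \<phi>"
    and G: "2 \<le> nblk m" and \<sigma>: "0 < \<sigma>"
    and pos: "\<And>z. 0 < accept_at (nblk m) \<sigma> z"
    and int: "integrable (gauss (\<sigma>\<^sup>2/2) \<sigma>) (\<lambda>z. 1 / accept_at (nblk m) \<sigma> z)"
  shows "IF_seq m \<phi> \<sigma> \<longlonglongrightarrow> inefficiency (nblk m) \<sigma>"
proof -
  interpret Q: prob_space "posterior m" by (rule prob_posterior[OF bm])
  interpret nu: prob_space "gauss (\<sigma>\<^sup>2/2) \<sigma>" by (rule prob_gauss[OF \<sigma>])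
  interpret independent_mh "posterior m" "gauss (\<sigma>\<^sup>2/2) \<sigma>" "z_proposal (nblk m) \<sigma>" accept_prob "state_space m" "pm_kernel m \<sigma>"
    by (rule independent_mh_sampler[OF bm C G \<sigma>])
  have reject: "1 - reject z = accept_at (nblk m) \<sigma> z" for z
    by (simp add: reject_def accept_at_def)
  have "pm_step m \<sigma> = step"
    by (auto simp: pm_step_def step_def pm_target_eq[OF bm \<sigma>] fun_eq_iff split: nat.split)
  then have draws: "pm_draws m \<sigma> n = law n" for n
    by (simp add: pm_draws_def law_def)
  have \<phi>m[measurable]: "\<phi> \<in> borel_measurable (posterior m)"
    using \<phi> by (simp add: test_function_def posterior_def)
  have sq: "integrable (posterior m) (\<lambda>\<theta>. (\<phi> \<theta>)\<^sup>2)" and V: "0 < Q.variance \<phi>"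
    using \<phi> by (auto simp: test_function_def)
  have \<phi>1: "integrable (posterior m) \<phi>"
    by (rule Q.square_integrable_imp_integrable[OF \<phi>m sq])
  define \<mu> where "\<mu> = Q.expectation \<phi>"
  have lim: "(\<lambda>n. (\<integral>\<omega>. (\<Sum>j<n. \<phi> (fst (\<omega> j)) - \<mu>)\<^sup>2 \<partial>law n) / real n) \<longlonglongrightarrow>
      Q.variance \<phi> * (\<integral>z. 2 / (1 - reject z) - 1 \<partial>gauss (\<sigma>\<^sup>2/2) \<sigma>)"
    unfolding \<mu>_def[symmetric]
  proof (rule second_moment_rejection)
    have "(\<lambda>\<theta>. (\<phi> \<theta> - \<mu>)\<^sup>2) = (\<lambda>\<theta>. (\<phi> \<theta>)\<^sup>2 - 2 * \<mu> * \<phi> \<theta> + \<mu>\<^sup>2)"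
      by (auto simp: power2_eq_square algebra_simps)
    then show "integrable (posterior m) (\<lambda>\<theta>. (\<phi> \<theta> - \<mu>)\<^sup>2)" using sq \<phi>1 by simp
    show "Q.expectation (\<lambda>\<theta>. \<phi> \<theta> - \<mu>) = 0" using \<phi>1 by (simp add: \<mu>_def Q.prob_space)
    show "reject z < 1" for z using pos[of z] reject[of z] by simp
    show "integrable (gauss (\<sigma>\<^sup>2/2) \<sigma>) (\<lambda>z. 1 / (1 - reject z))" using int by (simp add: reject)
  qed measurable
  have "IF_seq m \<phi> \<sigma> n = (\<integral>\<omega>. (\<Sum>j<n. \<phi> (fst (\<omega> j)) - \<mu>)\<^sup>2 \<partial>law n) / real n / Q.variance \<phi>" for n
  \<comment> \<open>For \<open>n = 0\<close> both sides are 0 by the convention for division by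
    zero.\<close>
  proof (cases "n = 0")
    case False
    have comp: "integrable (posterior m \<Otimes>\<^sub>M gauss (\<sigma>\<^sup>2/2) \<sigma>) (\<lambda>x. \<phi> (fst x))"
      and comp_eq: "(\<integral>x. \<phi> (fst x) \<partial>(posterior m \<Otimes>\<^sub>M gauss (\<sigma>\<^sup>2/2) \<sigma>)) = \<mu>"
    proof -
      have d: "distr (posterior m \<Otimes>\<^sub>M gauss (\<sigma>\<^sup>2/2) \<sigma>) (posterior m) fst = posterior m"
        by (rule nu.distr_pair_fst)
      show "integrable (posterior m \<Otimes>\<^sub>M gauss (\<sigma>\<^sup>2/2) \<sigma>) (\<lambda>x. \<phi> (fst x))"
        using \<phi>1 integrable_distr_eq[of fst "posterior m \<Otimes>\<^sub>M gauss (\<sigma>\<^sup>2/2) \<sigma>" "posterior m" \<phi>] by (simp add: d)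
      show "(\<integral>x. \<phi> (fst x) \<partial>(posterior m \<Otimes>\<^sub>M gauss (\<sigma>\<^sup>2/2) \<sigma>)) = \<mu>"
        using integral_distr[of fst "posterior m \<Otimes>\<^sub>M gauss (\<sigma>\<^sup>2/2) \<sigma>" "posterior m" \<phi>] by (simp add: d \<mu>_def)
    qed
    have fm: "(\<lambda>x. \<phi> (fst x)) \<in> borel_measurable (state_space m)" by measurable
    have int_j: "integrable (law n) (\<lambda>\<omega>. \<phi> (fst (\<omega> j)))" if "j < n" for j
      using integrable_law_component[OF fm that] comp by simp
    have ex_j: "(\<integral>\<omega>. \<phi> (fst (\<omega> j)) \<partial>law n) = \<mu>" if "j < n" for j
      using integral_law_component[OF fm that] comp_eq by simp
    have "(\<integral>\<omega>. (\<Sum>j<n. \<phi> (fst (\<omega> j))) / real n \<partial>law n) = (\<Sum>j<n. \<mu>) / real n"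
      using int_j ex_j by (simp add: Bochner_Integration.integral_sum)
    then have mean: "(\<integral>\<omega>. (\<Sum>j<n. \<phi> (fst (\<omega> j))) / real n \<partial>law n) = \<mu>"
      using False by simp
    have "((\<Sum>j<n. \<phi> (fst (\<omega> j))) / real n - \<mu>)\<^sup>2 = (\<Sum>j<n. \<phi> (fst (\<omega> j)) - \<mu>)\<^sup>2 / (real n)\<^sup>2" for \<omega> :: "nat \<Rightarrow> 'a \<times> real"
    proof -
      have "(\<Sum>j<n. \<phi> (fst (\<omega> j))) / real n - \<mu> = (\<Sum>j<n. \<phi> (fst (\<omega> j)) - \<mu>) / real n"
        using False by (simp add: sum_subtractf diff_divide_distrib)
      then show ?thesis by (simp add: power_divide)
    qed
    then show ?thesis
      unfolding IF_seq_def draws mean using False by (simp add: power2_eq_square)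
  qed (simp add: IF_seq_def)
  then have "IF_seq m \<phi> \<sigma> = (\<lambda>n. (\<integral>\<omega>. (\<Sum>j<n. \<phi> (fst (\<omega> j)) - \<mu>)\<^sup>2 \<partial>law n) / real n / Q.variance \<phi>)" ..
  moreover have "Q.variance \<phi> * (\<integral>z. 2 / (1 - reject z) - 1 \<partial>gauss (\<sigma>\<^sup>2/2) \<sigma>) / Q.variance \<phi> = inefficiency (nblk m) \<sigma>"
    using V by (simp add: inefficiency_def reject)
  ultimately show ?thesis
    using tendsto_divide[OF lim tendsto_const[of "Q.variance \<phi>"]] V by simp
qed

section \<open>The acceptance probability\<close>

definition Phi :: "real \<Rightarrow> real" where
  "Phi x = measure (gauss 0 1) {..x}"

interpretation std: prob_space "gauss 0 1"
  by (rule prob_gauss) simp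

lemma gauss_null: "emeasure (gauss \<mu> s) {x} = 0"
  by (simp add: gauss_def emeasure_density nn_integral_indicator_singleton')

lemma std_null: "measure (gauss 0 1) {x} = 0"
  by (simp add: measure_def gauss_null)

lemma measure_std_lessThan: "measure (gauss 0 1) {..<x} = Phi x"
proof -
  have "measure (gauss 0 1) ({..<x} \<union> {x}) = measure (gauss 0 1) {..<x} + measure (gauss 0 1) {x}"
    by (rule std.finite_measure_Union) auto
  moreover have "{..<x} \<union> {x} = {..x}" by auto
  ultimately show ?thesis by (simp add: Phi_def std_null)
qed

lemma measure_std_atLeast: "measure (gauss 0 1) {x..} = Phi (- x)"
proof -
  have "gauss 0 1 = distr (gauss 0 1) borel (\<lambda>x. - x)"
    using gauss_affine[of 1 "-1" 0 0] by simp
  then have "measure (gauss 0 1) {..-x} = measure (distr (gauss 0 1) borel (\<lambda>x. - x)) {..-x}" by simp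
  also have "\<dots> = measure (gauss 0 1) ((\<lambda>x. - x) -` {..-x} \<inter> space (gauss 0 1))"
    by (rule measure_distr) auto
  also have "(\<lambda>x. - x) -` {..-x} \<inter> space (gauss 0 1) = {x..}" by auto
  finally show ?thesis by (simp add: Phi_def)
qed

lemma Phi_minus: "Phi (- x) = 1 - Phi x"
proof -
  have "measure (gauss 0 1) (UNIV - {..<x}) = 1 - measure (gauss 0 1) {..<x}"
    using std.prob_compl[of "{..<x}"] by simp
  moreover have "UNIV - {..<x} = {x..}" by auto
  ultimately show ?thesis by (simp add: measure_std_atLeast measure_std_lessThan)
qed

lemma Phi_0: "Phi 0 = 1/2"
  using Phi_minus[of 0] by simp

lemma Phi_diff:
  assumes "a \<le> b"
  shows "Phi b - Phi a = integral {a..b} std_normal_density"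
proof -
  have "{..b} = {..a} \<union> {a<..b}" using assms by auto
  moreover have "{..a} \<inter> {a<..b} = {}" by auto
  ultimately have "Phi b = Phi a + measure (gauss 0 1) {a<..b}"
    unfolding Phi_def by (simp add: std.finite_measure_Union)
  then have "Phi b - Phi a = measure (gauss 0 1) {a<..b}" by simp
  also have "measure (gauss 0 1) {a<..b} = (\<integral>x. indicator {a<..b} x \<partial>gauss 0 1)"
    by simp
  also have "\<dots> = (\<integral>x. std_normal_density x * indicator {a<..b} x \<partial>lborel)"
    unfolding gauss_def by (subst integral_density) auto
  also have "\<dots> = (\<integral>x. indicator {a..b} x *\<^sub>R std_normal_density x \<partial>lborel)"
    using AE_lborel_singleton[of a]
    by (intro integral_cong_AE) (auto simp: indicator_def elim: eventually_mono)
  also have "\<dots> = integral {a..b} std_normal_density"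
  proof -
    have "integrable lborel (\<lambda>x. indicator {a..b} x *\<^sub>R std_normal_density x)"
      by (rule integrable_mult_indicator[OF _ integrable_normal_density]) simp_all
    from set_borel_integral_eq_integral(2)[unfolded set_lebesgue_integral_def set_integrable_def, OF this]
    show ?thesis .
  qed
  finally show ?thesis .
qed

lemma continuous_std_density: "continuous_on A std_normal_density"
  unfolding normal_density_def by (intro continuous_intros) auto

text \<open>The finite base point \<open>x - 1\<close> replaces minus infinity: by
  \<open>Phi_diff\<close> the integral from there differs from \<open>Phi\<close> by a
  constant.\<close>

lemma Phi_deriv: "(Phi has_real_derivative std_normal_density x) (at x)"
proof -
  have "((\<lambda>u. integral {x - 1..u} std_normal_density) has_real_derivative std_normal_density x) (at x within {x - 1..x + 1})"
    by (rule integral_has_real_derivative[OF continuous_std_density]) simp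
  then have "((\<lambda>u. integral {x - 1..u} std_normal_density) has_real_derivative std_normal_density x) (at x)"
    by (simp only: at_within_Icc_at[of "x - 1" x "x + 1", simplified])
  from DERIV_add[OF DERIV_const[of "Phi (x - 1)"] this]
  have "((\<lambda>u. Phi (x - 1) + integral {x - 1..u} std_normal_density) has_real_derivative std_normal_density x) (at x)"
    by (simp only: add_0)
  then show ?thesis
  proof (rule has_field_derivative_transform_within_open[where S="{x - 1<..}"])
    show "Phi (x - 1) + integral {x - 1..u} std_normal_density = Phi u" if "u \<in> {x - 1<..}" for u
      using Phi_diff[of "x - 1" u] that by simp
  qed auto
qed

lemma Phi_strict_mono: "a < b \<Longrightarrow> Phi a < Phi b"
  by (rule DERIV_pos_imp_increasing[of a b Phi]) (use Phi_deriv normal_density_pos[of 1 0] in auto)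

lemma Phi_pos: "0 < Phi x"
proof -
  have "0 \<le> Phi (x - 1)" by (simp add: Phi_def)
  also have "Phi (x - 1) < Phi x" by (rule Phi_strict_mono) simp
  finally show ?thesis .
qed

lemma Phi_less_1: "Phi x < 1"
  using Phi_pos[of "-x"] by (simp add: Phi_minus)

text \<open>The mass of \<open>{y<..y + 1}\<close> alone, with the density smallest at the right
  end. The shift by 1 costs only a factor of order \<open>exp y\<close>, which the later domination
  can afford.\<close>

lemma Phi_lower:
  assumes "0 \<le> y"
  shows "std_normal_density (y + 1) \<le> Phi (- y)"
proof -
  obtain z where z: "z > y" "z < y + 1" "Phi (y + 1) - Phi y = (y + 1 - y) * std_normal_density z"
    using MVT2[of y "y + 1" Phi std_normal_density] Phi_deriv by auto
  have "z\<^sup>2 \<le> (y + 1)\<^sup>2" using z assms by (intro power_mono) auto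
  then have "std_normal_density (y + 1) \<le> std_normal_density z"
    by (simp add: std_normal_density_def divide_right_mono)
  also have "\<dots> = Phi (y + 1) - Phi y" using z by simp
  also have "\<dots> \<le> Phi (- y)" using Phi_less_1[of "y + 1"] by (simp add: Phi_minus)
  finally show ?thesis .
qed

section \<open>Expected acceptance when the log-ratio is normal with mean \<open>-d\<close> and
  standard deviation \<open>t\<close>\<close>

definition mean_accept :: "real \<Rightarrow> real \<Rightarrow> real" where
  "mean_accept d t = (\<integral>e. min 1 (exp (t * e - d)) \<partial>gauss 0 1)"

lemma mean_accept_integrable: "integrable (gauss 0 1) (\<lambda>e. min 1 (exp (t * e - d)))"
  by (rule std.integrable_const_bound[where B=1]) auto

lemma mean_accept_le_1: "mean_accept d t \<le> 1"
proof -
  have "mean_accept d t \<le> (\<integral>e. 1 \<partial>gauss 0 1)"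
    unfolding mean_accept_def by (intro integral_mono mean_accept_integrable) auto
  then show ?thesis using std.prob_space by simp
qed

text \<open>For \<open>e \<ge> d / t\<close> the log-ratio is nonnegative and the acceptance
  certain.\<close>

lemma mean_accept_lower: "0 < t \<Longrightarrow> Phi (- (d / t)) \<le> mean_accept d t"
proof -
  assume t: "0 < t"
  have "Phi (- (d / t)) = (\<integral>e. indicator {d / t..} e \<partial>gauss 0 1)"
    by (simp add: measure_std_atLeast)
  also have "\<dots> \<le> mean_accept d t"
    unfolding mean_accept_def
  proof (intro integral_mono mean_accept_integrable)
    show "integrable (gauss 0 1) (indicat_real {d / t..})" by (simp add: std.emeasure_eq_measure)
    show "indicat_real {d / t..} e \<le> min 1 (exp (t * e - d))" for e
      using t by (auto simp: indicator_def field_simps)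
  qed
  finally show ?thesis .
qed

lemma mean_accept_pos: "0 < t \<Longrightarrow> 0 < mean_accept d t"
  using mean_accept_lower[of t d] Phi_pos[of "-(d/t)"] by linarith

lemma mean_accept_tendsto:
  assumes "d \<longlonglongrightarrow> d0" "t \<longlonglongrightarrow> t0"
  shows "(\<lambda>n. mean_accept (d n) (t n)) \<longlonglongrightarrow> mean_accept d0 t0"
  unfolding mean_accept_def
proof (rule integral_dominated_convergence[where w="\<lambda>_. 1"])
  show "AE e in gauss 0 1. (\<lambda>n. min 1 (exp (t n * e - d n))) \<longlonglongrightarrow> min 1 (exp (t0 * e - d0))"
    by (intro AE_I2 tendsto_intros assms)
qed auto

lemma mean_accept_measurable[measurable]:
  assumes [measurable]: "f \<in> borel_measurable M"
  shows "(\<lambda>x. mean_accept (f x) t) \<in> borel_measurable M"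
proof -
  have "(\<lambda>d. mean_accept d t) \<in> borel_measurable borel"
    unfolding mean_accept_def by (rule std.borel_measurable_lebesgue_integral) measurable
  then show ?thesis by measurable
qed

text \<open>In the balanced case \<open>d = t^2 / 2\<close> the exponential of the log-ratio has
  mean 1. It tilts the standard normal law into the one with mean \<open>t\<close>, under which
  \<open>{..<t / 2}\<close> has the same mass as \<open>{t / 2..}\<close> under the original
  law.\<close>

lemma mean_accept_balanced: "mean_accept (t\<^sup>2 / 2) t = 2 * Phi (- t / 2)" if t: "0 < t"
proof -
  have "mean_accept (t\<^sup>2 / 2) t = (\<integral>e. indicator {t / 2..} e + indicator {..<t / 2} e * exp (t * e - t\<^sup>2 / 2) \<partial>gauss 0 1)"
    unfolding mean_accept_def
  proof (intro Bochner_Integration.integral_cong refl)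
    fix e
    have "t * e - t\<^sup>2 / 2 = t * (e - t / 2)" by (simp add: power2_eq_square algebra_simps)
    moreover have "0 \<le> t * (e - t / 2) \<longleftrightarrow> t / 2 \<le> e" using t by (simp add: zero_le_mult_iff)
    ultimately show "min 1 (exp (t * e - t\<^sup>2 / 2)) = indicator {t / 2..} e + indicator {..<t / 2} e * exp (t * e - t\<^sup>2 / 2)"
      by (auto simp: indicator_def min_def)
  qed
  also have "\<dots> = measure (gauss 0 1) {t / 2..} + (\<integral>e. indicator {..<t / 2} e * exp (t * e - t\<^sup>2 / 2) \<partial>gauss 0 1)"
  proof (subst Bochner_Integration.integral_add)
    show "integrable (gauss 0 1) (indicat_real {t / 2..})" by (simp add: std.emeasure_eq_measure)
    show "integrable (gauss 0 1) (\<lambda>e. indicator {..<t / 2} e * exp (t * e - t\<^sup>2 / 2))"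
    proof (rule std.integrable_const_bound[where B=1])
      show "AE e in gauss 0 1. norm (indicator {..<t / 2} e * exp (t * e - t\<^sup>2 / 2)) \<le> 1"
      proof (rule AE_I2)
        fix e
        have "t * e - t\<^sup>2 / 2 = t * (e - t / 2)" by (simp add: power2_eq_square algebra_simps)
        moreover have "t * (e - t / 2) \<le> 0 \<longleftrightarrow> e \<le> t / 2" using t by (simp add: mult_le_0_iff)
        ultimately show "norm (indicator {..<t / 2} e * exp (t * e - t\<^sup>2 / 2)) \<le> 1"
          by (auto simp: indicator_def)
      qed
    qed measurable
  qed simp
  also have "(\<integral>e. indicator {..<t / 2} e * exp (t * e - t\<^sup>2 / 2) \<partial>gauss 0 1) =
      (\<integral>e. std_normal_density e * (indicator {..<t / 2} e * exp (t * e - t\<^sup>2 / 2)) \<partial>lborel)"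
    unfolding gauss_def by (subst integral_density) auto
  also have "\<dots> = (\<integral>e. normal_density t 1 e * indicator {..<t / 2} e \<partial>lborel)"
  proof (intro Bochner_Integration.integral_cong refl)
    fix e
    have "std_normal_density e * exp (t * e - t\<^sup>2 / 2) = normal_density t 1 e"
      unfolding normal_density_def
      by (simp add: mult_exp_exp power2_eq_square field_simps)
    then show "std_normal_density e * (indicator {..<t / 2} e * exp (t * e - t\<^sup>2 / 2)) = normal_density t 1 e * indicator {..<t / 2} e"
      by (simp add: mult_ac)
  qed
  also have "\<dots> = (\<integral>e. indicator {..<t / 2} e \<partial>gauss t 1)"
    unfolding gauss_def by (subst integral_density) auto
  also have "\<dots> = measure (gauss t 1) {..<t / 2}" by simp
  also have "\<dots> = measure (gauss 0 1) ((\<lambda>x. t + x) -` {..<t / 2} \<inter> space (gauss 0 1))"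
    using gauss_std[of 1 t] by (simp add: measure_distr)
  also have "(\<lambda>x. t + x) -` {..<t / 2} \<inter> space (gauss 0 1) = {..< - t / 2}" by auto
  finally show ?thesis by (simp add: measure_std_atLeast measure_std_lessThan)
qed

text \<open>Independent normal variables add, in kernel form. Averaging over the current state
  thereby merges its fluctuation with the proposal noise into a single normal log-ratio.\<close>

lemma gauss_convolution:
  assumes f: "f \<in> borel_measurable borel" and \<alpha>: "0 < \<alpha>" and \<beta>: "0 < \<beta>"
  shows "(\<integral>\<^sup>+w. \<integral>\<^sup>+x. f x \<partial>gauss (\<mu> + w) \<beta> \<partial>gauss 0 \<alpha>) = (\<integral>\<^sup>+x. f x \<partial>gauss \<mu> (sqrt (\<alpha>\<^sup>2 + \<beta>\<^sup>2)))"
proof -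
  have [measurable]: "f \<in> borel_measurable borel" by fact
  have sh: "normal_density (\<mu> + w) s x = normal_density 0 s (x - \<mu> - w)" for w s x
    by (simp add: normal_density_def algebra_simps)
  have m: "(\<lambda>(w, x). normal_density 0 \<beta> (x - \<mu> - w)) \<in> borel_measurable (borel \<Otimes>\<^sub>M borel)"
    unfolding normal_density_def by measurable
  note m[measurable]
  have "(\<integral>\<^sup>+w. \<integral>\<^sup>+x. f x \<partial>gauss (\<mu> + w) \<beta> \<partial>gauss 0 \<alpha>) =
     (\<integral>\<^sup>+w. ennreal (normal_density 0 \<alpha> w) * (\<integral>\<^sup>+x. f x \<partial>gauss (\<mu> + w) \<beta>) \<partial>lborel)"
    unfolding gauss_def[of 0 \<alpha>]
    by (rule nn_integral_density)
      (use measurable_compose[OF measurable_prob_algebraD[OF gauss_kernel[of "\<lambda>w. \<mu> + w", OF _ \<beta>]] nn_integral_measurable_subprob_algebra[OF f]] in simp_all)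
  also have "\<dots> = (\<integral>\<^sup>+w. \<integral>\<^sup>+x. ennreal (normal_density 0 \<alpha> w) * (ennreal (normal_density 0 \<beta> (x - \<mu> - w)) * f x) \<partial>lborel \<partial>lborel)"
    unfolding gauss_def
    by (intro nn_integral_cong, subst nn_integral_density) (auto simp: sh nn_integral_cmult)
  also have "\<dots> = (\<integral>\<^sup>+x. \<integral>\<^sup>+w. ennreal (normal_density 0 \<alpha> w) * (ennreal (normal_density 0 \<beta> (x - \<mu> - w)) * f x) \<partial>lborel \<partial>lborel)"
    by (rule lborel_pair.Fubini') measurable
  also have "\<dots> = (\<integral>\<^sup>+x. (\<integral>\<^sup>+w. ennreal (normal_density 0 \<beta> (x - \<mu> - w) * normal_density 0 \<alpha> w) \<partial>lborel) * f x \<partial>lborel)"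
    by (intro nn_integral_cong, subst nn_integral_multc[symmetric]) (auto simp: ennreal_mult' mult_ac)
  also have "\<dots> = (\<integral>\<^sup>+x. ennreal (normal_density 0 (sqrt (\<beta>\<^sup>2 + \<alpha>\<^sup>2)) (x - \<mu>)) * f x \<partial>lborel)"
    using fun_cong[OF conv_normal_density_zero_mean[OF \<beta> \<alpha>]] by simp
  also have "\<dots> = (\<integral>\<^sup>+x. f x \<partial>gauss \<mu> (sqrt (\<alpha>\<^sup>2 + \<beta>\<^sup>2)))"
    unfolding gauss_def using sh[of 0]
    by (subst nn_integral_density) (auto simp: add.commute)
  finally show ?thesis .
qed

section \<open>An integrable majorant for the inverse acceptance probability, and limits under the
  integral\<close>

definition dominating :: "real \<Rightarrow> real \<Rightarrow> real" where
  "dominating c w = sqrt (2 * pi) * exp ((c + 1)\<^sup>2) * exp (w\<^sup>2 / 4)"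

lemma dominating_integrable: "integrable (gauss 0 1) (dominating c)"
proof -
  have eq: "std_normal_density w * dominating c w = (sqrt (2 * pi) * exp ((c + 1)\<^sup>2) * sqrt 2) * normal_density 0 (sqrt 2) w" for w
  proof -
    have "std_normal_density w * dominating c w = exp ((c + 1)\<^sup>2) * (exp (- w\<^sup>2 / 2) * exp (w\<^sup>2 / 4))"
      by (simp add: std_normal_density_def dominating_def)
    \<comment> \<open>Half of the Gaussian exponent survives: up to a constant, the density of
      variance 2.\<close>
    also have "exp (- w\<^sup>2 / 2) * exp (w\<^sup>2 / 4) = exp (- w\<^sup>2 / 4)"
      by (simp add: mult_exp_exp)
    also have "exp (- w\<^sup>2 / 4) = sqrt (2 * pi) * sqrt 2 * normal_density 0 (sqrt 2) w"
      by (simp add: normal_density_def real_sqrt_mult)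
    finally show ?thesis by simp
  qed
  have "integrable lborel (\<lambda>w. std_normal_density w * dominating c w)"
    unfolding eq by simp
  then show ?thesis
    unfolding gauss_def
    by (subst integrable_density) (auto simp: dominating_def[abs_def])
qed

text \<open>\<open>Phi_lower\<close> at \<open>y = c + \<bar>w\<bar> / 2\<close> bounds the inverse
  by \<open>sqrt (2 * pi) * exp ((y + 1)^2 / 2)\<close>, and
  \<open>(p + q)^2 \<le> 2 * p^2 + 2 * q^2\<close> with \<open>p = c + 1\<close>,
  \<open>q = \<bar>w\<bar> / 2\<close> separates the variables. The slope 1/2 in
  \<open>\<bar>w\<bar>\<close> keeps the coefficient of \<open>w^2\<close> at 1/4, below the 1/2 of
  the Gaussian weight.\<close>

lemma mean_accept_inverse_bound:
  assumes t: "0 < t" and c: "0 \<le> c" and d: "d \<le> t * (c + \<bar>w\<bar> / 2)"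
  shows "1 / mean_accept d t \<le> dominating c w"
proof -
  define y where "y = c + \<bar>w\<bar> / 2"
  have y: "0 \<le> y" using c by (simp add: y_def)
  have "d / t \<le> y" using d t by (simp add: y_def field_simps)
  then have "Phi (- y) \<le> Phi (- (d / t))" using Phi_strict_mono[of "-y" "-(d/t)"] by (cases "d / t = y") auto
  then have "std_normal_density (y + 1) \<le> mean_accept d t"
    using Phi_lower[OF y] mean_accept_lower[OF t, of d] by linarith
  then have "1 / mean_accept d t \<le> 1 / std_normal_density (y + 1)"
    using normal_density_pos[of 1 0 "y + 1"] by (intro divide_left_mono) (auto intro: mult_pos_pos mean_accept_pos t)
  also have "\<dots> = sqrt (2 * pi) * exp ((y + 1)\<^sup>2 / 2)"
    by (simp add: std_normal_density_def exp_minus field_simps)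
  also have "\<dots> \<le> sqrt (2 * pi) * exp ((c + 1)\<^sup>2 + w\<^sup>2 / 4)"
  proof -
    have "0 \<le> (c + 1 - \<bar>w\<bar> / 2)\<^sup>2" by simp
    then have "(y + 1)\<^sup>2 / 2 \<le> (c + 1)\<^sup>2 + w\<^sup>2 / 4"
      unfolding y_def by (simp add: power2_eq_square field_simps)
    then show ?thesis by simp
  qed
  finally show ?thesis by (simp add: dominating_def exp_add mult.assoc)
qed

text \<open>The inefficiency in standardised form: \<open>w\<close> is the current state,
  \<open>a + b * w\<close> the mean decrease of the log-likelihood error, \<open>t\<close> the
  proposal noise.\<close>

definition mean_inefficiency :: "real \<Rightarrow> real \<Rightarrow> real \<Rightarrow> real" where
  "mean_inefficiency a b t = (\<integral>w. 2 / mean_accept (a + b * w) t - 1 \<partial>gauss 0 1)"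

lemma affine_bound:
  fixes a b c t w :: real
  assumes "0 < t" "a \<le> c * t" "\<bar>b\<bar> \<le> t / 2"
  shows "a + b * w \<le> t * (c + \<bar>w\<bar> / 2)"
proof -
  have "b * w \<le> \<bar>b\<bar> * \<bar>w\<bar>" by (metis abs_ge_self abs_mult)
  also have "\<dots> \<le> t / 2 * \<bar>w\<bar>" by (rule mult_right_mono) (use assms in auto)
  finally show ?thesis using assms by (simp add: algebra_simps)
qed

lemma integrable_inverse_mean_accept:
  assumes "0 < t" "0 \<le> c" "a \<le> c * t" "\<bar>b\<bar> \<le> t / 2"
  shows "integrable (gauss 0 1) (\<lambda>w. 1 / mean_accept (a + b * w) t)"
proof (rule Bochner_Integration.integrable_bound[OF dominating_integrable[of c]])
  show "AE w in gauss 0 1. norm (1 / mean_accept (a + b * w) t) \<le> norm (dominating c w)"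
  proof (rule AE_I2)
    fix w
    have "1 / mean_accept (a + b * w) t \<le> dominating c w"
      by (rule mean_accept_inverse_bound[OF assms(1,2) affine_bound[OF assms(1,3,4)]])
    then show "norm (1 / mean_accept (a + b * w) t) \<le> norm (dominating c w)"
      using mean_accept_pos[OF assms(1), of "a + b * w"] by (simp add: less_imp_le)
  qed
qed measurable

text \<open>A common \<open>c\<close> gives one majorant for the whole sequence. Serves both for
  continuity in \<open>\<sigma>\<close> and for the limit of large \<open>G\<close>.\<close>

lemma mean_inefficiency_tendsto:
  assumes t: "\<And>n. 0 < t n" "0 < t0" and c: "0 \<le> c"
    and a: "\<And>n. a n \<le> c * t n" and b: "\<And>n. \<bar>b n\<bar> \<le> t n / 2"
    and lim: "a \<longlonglongrightarrow> a0" "b \<longlonglongrightarrow> b0" "t \<longlonglongrightarrow> t0"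
  shows "(\<lambda>n. mean_inefficiency (a n) (b n) (t n)) \<longlonglongrightarrow> mean_inefficiency a0 b0 t0"
  unfolding mean_inefficiency_def
proof (rule integral_dominated_convergence[where w="\<lambda>w. 2 * dominating c w"])
  show "integrable (gauss 0 1) (\<lambda>w. 2 * dominating c w)"
    using dominating_integrable by simp
  show "AE w in gauss 0 1. (\<lambda>n. 2 / mean_accept (a n + b n * w) (t n) - 1) \<longlonglongrightarrow> 2 / mean_accept (a0 + b0 * w) t0 - 1"
    using mean_accept_pos[OF t(2)] by (intro AE_I2 tendsto_intros mean_accept_tendsto lim) (simp add: less_imp_neq[symmetric])
  show "AE w in gauss 0 1. norm (2 / mean_accept (a n + b n * w) (t n) - 1) \<le> 2 * dominating c w" for n
  proof (rule AE_I2)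
    fix w
    have p: "0 < mean_accept (a n + b n * w) (t n)" "mean_accept (a n + b n * w) (t n) \<le> 1"
      using mean_accept_pos[OF t(1)] mean_accept_le_1 by auto
    have "1 / mean_accept (a n + b n * w) (t n) \<le> dominating c w"
      by (rule mean_accept_inverse_bound[OF t(1) c affine_bound[OF t(1) a b]])
    moreover have "1 \<le> 1 / mean_accept (a n + b n * w) (t n)" using p by simp
    ultimately show "norm (2 / mean_accept (a n + b n * w) (t n) - 1) \<le> 2 * dominating c w" by simp
  qed
qed measurable

lemma mean_inefficiency_balanced:
  assumes "0 < t"
  shows "mean_inefficiency (t\<^sup>2 / 2) 0 t = 1 / Phi (- t / 2) - 1"
  unfolding mean_inefficiency_def using assms std.prob_space by (simp add: mean_accept_balanced)

lemma mean_inefficiency_Jensen: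
  assumes t: "0 < t" and c: "0 \<le> c" "a \<le> c * t" "\<bar>b\<bar> \<le> t / 2"
  defines "m \<equiv> (\<integral>w. mean_accept (a + b * w) t \<partial>gauss 0 1)"
  assumes m: "0 < m"
  shows "2 / m - 1 \<le> mean_inefficiency a b t"
proof -
  let ?p = "\<lambda>w. mean_accept (a + b * w) t"
  have p: "0 < ?p w" for w by (rule mean_accept_pos[OF t])
  have ip: "integrable (gauss 0 1) ?p"
    by (rule std.integrable_const_bound[where B=1]) (use p mean_accept_le_1 in \<open>auto simp: less_imp_le\<close>)
  have ii: "integrable (gauss 0 1) (\<lambda>w. 1 / ?p w)"
    by (rule integrable_inverse_mean_accept[OF t c])
  have "(\<integral>w. 2 * (2 / m - ?p w / m\<^sup>2) - 1 \<partial>gauss 0 1) \<le> (\<integral>w. 2 / ?p w - 1 \<partial>gauss 0 1)"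
  proof (rule integral_mono)
    show "integrable (gauss 0 1) (\<lambda>w. 2 * (2 / m - ?p w / m\<^sup>2) - 1)" using ip by simp
    show "integrable (gauss 0 1) (\<lambda>w. 2 / ?p w - 1)" using integrable_mult_right[OF ii, of 2] by simp
    fix w
    \<comment> \<open>Jensen's inequality by hand: the convex function \<open>1 / p\<close> lies
      above its tangent \<open>2 / m - p / m^2\<close> at the mean \<open>m\<close>.\<close>
    have "0 \<le> (m - ?p w)\<^sup>2 / (m\<^sup>2 * ?p w)" using p[of w] m by simp
    also have "\<dots> = 1 / ?p w - (2 / m - ?p w / m\<^sup>2)"
      using p[of w] m by (simp add: power2_eq_square field_simps)
    finally show "2 * (2 / m - ?p w / m\<^sup>2) - 1 \<le> 2 / ?p w - 1" by simp
  qed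
  also have "(\<integral>w. 2 * (2 / m - ?p w / m\<^sup>2) - 1 \<partial>gauss 0 1) = 2 * (2 / m - m / m\<^sup>2) - 1"
    using ip std.prob_space by (simp add: m_def)
  also have "\<dots> = 2 / m - 1" using m by (simp add: power2_eq_square)
  finally show ?thesis by (simp add: mean_inefficiency_def)
qed

section \<open>The sampler in standardised coordinates: acceptance rate, lower bound, continuity and
  limit of the inefficiency\<close>

lemma accept_at_eq:
  assumes G: "2 \<le> G" and \<sigma>: "0 < \<sigma>"
  shows "accept_at G \<sigma> (\<sigma>\<^sup>2 / 2 + \<sigma> * w) =
    mean_accept ((1 - rho G) * \<sigma>\<^sup>2 + (1 - rho G) * \<sigma> * w) (\<sigma> * sqrt (1 - (rho G)\<^sup>2))"
proof -
  define s where "s = \<sigma> * sqrt (1 - (rho G)\<^sup>2)"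
  have s: "0 < s" using \<sigma> rho_sq[OF G] by (simp add: s_def)
  define z' where "z' = \<sigma>\<^sup>2 / 2 + \<sigma> * w"
  have "accept_at G \<sigma> z' = (\<integral>e. accept_prob z' ((-\<sigma>\<^sup>2/2) * (1 - rho G) + rho G * z' + s * e) \<partial>gauss 0 1)"
    unfolding accept_at_def z_proposal_gauss[OF G] s_def[symmetric] gauss_std[OF s, of "(-\<sigma>\<^sup>2/2) * (1 - rho G) + rho G * z'"]
    by (rule integral_distr) (auto simp: accept_prob_def[abs_def])
  \<comment> \<open>The difference of proposed and current value is
    \<open>s * e - (1 - rho G) * (\<sigma>^2 / 2 + z')\<close>, and \<open>z'\<close> is
    \<open>\<sigma>^2 / 2 + \<sigma> * w\<close>.\<close>
  also have "\<dots> = mean_accept ((1 - rho G) * \<sigma>\<^sup>2 + (1 - rho G) * \<sigma> * w) s"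
    unfolding mean_accept_def accept_prob_def
    by (intro Bochner_Integration.integral_cong refl arg_cong2[where f=min] arg_cong[where f=exp])
      (simp add: z'_def power2_eq_square field_simps)
  finally show ?thesis by (simp add: s_def z'_def)
qed

lemma accept_at_eq':
  assumes G: "2 \<le> G" and \<sigma>: "0 < \<sigma>"
  shows "accept_at G \<sigma> z =
    mean_accept ((1 - rho G) * \<sigma>\<^sup>2 + (1 - rho G) * \<sigma> * ((z - \<sigma>\<^sup>2 / 2) / \<sigma>)) (\<sigma> * sqrt (1 - (rho G)\<^sup>2))"
  using accept_at_eq[OF assms, of "(z - \<sigma>\<^sup>2 / 2) / \<sigma>"] \<sigma> by simp

lemma accept_at_pos: "2 \<le> G \<Longrightarrow> 0 < \<sigma> \<Longrightarrow> 0 < accept_at G \<sigma> z"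
  unfolding accept_at_eq' by (rule mean_accept_pos) (use rho_sq[of G] in simp)

lemma accept_at_measurable[measurable]: "2 \<le> G \<Longrightarrow> 0 < \<sigma> \<Longrightarrow> accept_at G \<sigma> \<in> borel_measurable borel"
  by (subst accept_at_eq'[THEN ext]) auto

lemma inefficiency_eq:
  assumes G: "2 \<le> G" and \<sigma>: "0 < \<sigma>"
  shows "inefficiency G \<sigma> = mean_inefficiency ((1 - rho G) * \<sigma>\<^sup>2) ((1 - rho G) * \<sigma>) (\<sigma> * sqrt (1 - (rho G)\<^sup>2))"
  unfolding inefficiency_def gauss_std[OF \<sigma>, of "\<sigma>\<^sup>2/2"] mean_inefficiency_def accept_at_eq[OF assms, symmetric]
  by (rule integral_distr) (use accept_at_measurable[OF assms] in measurable)

text \<open>After squaring and cancelling \<open>1 - rho G\<close> this reads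
  \<open>4 * (1 - rho G) \<le> 1 + rho G\<close>, that is \<open>rho G \<ge> 3/5\<close>, which
  holds from \<open>G = 3\<close> on. It is the slope condition of the majorant.\<close>

lemma rho_slope: "3 \<le> G \<Longrightarrow> 1 - rho G \<le> sqrt (1 - (rho G)\<^sup>2) / 2"
proof -
  assume G: "3 \<le> G"
  then have r: "2/3 \<le> rho G" "rho G < 1" by (auto simp: rho_def field_simps)
  have "(1 - rho G)\<^sup>2 * 4 \<le> 1 - (rho G)\<^sup>2"
  proof -
    have "(1 - rho G) * ((1 - rho G) * 4) \<le> (1 - rho G) * (1 + rho G)"
      by (rule mult_left_mono) (use r in auto)
    then show ?thesis by (simp add: power2_eq_square algebra_simps)
  qed
  then have "sqrt ((1 - rho G)\<^sup>2 * 4) \<le> sqrt (1 - (rho G)\<^sup>2)" by (rule real_sqrt_le_mono)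
  then show ?thesis using r by (simp add: real_sqrt_mult)
qed

lemma mean_inefficiency_conditions:
  assumes G: "3 \<le> G" and \<sigma>: "0 < \<sigma>"
  shows "0 < \<sigma> * sqrt (1 - (rho G)\<^sup>2)"
    "(1 - rho G) * \<sigma>\<^sup>2 \<le> \<sigma> * (\<sigma> * sqrt (1 - (rho G)\<^sup>2))"
    "\<bar>(1 - rho G) * \<sigma>\<bar> \<le> \<sigma> * sqrt (1 - (rho G)\<^sup>2) / 2"
proof -
  have r: "rho G < 1" "(rho G)\<^sup>2 < 1" using rho_bounds[of G] rho_sq[of G] G by auto
  show "0 < \<sigma> * sqrt (1 - (rho G)\<^sup>2)" using \<sigma> r by simp
  show 3: "\<bar>(1 - rho G) * \<sigma>\<bar> \<le> \<sigma> * sqrt (1 - (rho G)\<^sup>2) / 2"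
    using mult_left_mono[OF rho_slope[OF G], of \<sigma>] \<sigma> r by (simp add: abs_mult mult.commute)
  have "(1 - rho G) * \<sigma> \<le> \<sigma> * sqrt (1 - (rho G)\<^sup>2)" using 3 \<sigma> r
    by (smt (verit) divide_nonneg_pos field_sum_of_halves mult_nonneg_nonneg real_sqrt_ge_zero)
  from mult_left_mono[OF this, of \<sigma>]
  show "(1 - rho G) * \<sigma>\<^sup>2 \<le> \<sigma> * (\<sigma> * sqrt (1 - (rho G)\<^sup>2))"
    using \<sigma> by (simp add: power2_eq_square mult_ac)
qed

lemma integrable_inverse_accept_at:
  assumes G: "3 \<le> G" and \<sigma>: "0 < \<sigma>"
  shows "integrable (gauss (\<sigma>\<^sup>2/2) \<sigma>) (\<lambda>z. 1 / accept_at G \<sigma> z)"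
proof -
  have G2: "2 \<le> G" using G by simp
  have m: "(\<lambda>z. 1 / accept_at G \<sigma> z) \<in> borel_measurable borel"
    using accept_at_measurable[OF G2 \<sigma>] by measurable
  show ?thesis
    unfolding gauss_std[OF \<sigma>, of "\<sigma>\<^sup>2/2"]
    by (subst integrable_distr_eq[OF _ m])
      (use integrable_inverse_mean_accept[OF mean_inefficiency_conditions(1)[OF assms] _ mean_inefficiency_conditions(2,3)[OF assms]] \<sigma>
       in \<open>auto simp: accept_at_eq[OF G2 \<sigma>]\<close>)
qed

lemma accept_rate_mean_accept:
  assumes G: "2 \<le> G" and \<sigma>: "0 < \<sigma>"
  shows "accept_rate G \<sigma> =
    (\<integral>w. mean_accept ((1 - rho G) * \<sigma>\<^sup>2 + (1 - rho G) * \<sigma> * w) (\<sigma> * sqrt (1 - (rho G)\<^sup>2)) \<partial>gauss 0 1)"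
proof -
  have "accept_rate G \<sigma> = (\<integral>z. accept_at G \<sigma> z \<partial>gauss (\<sigma>\<^sup>2/2) \<sigma>)"
    by (simp add: accept_rate_def accept_at_def gauss_def)
  also have "\<dots> = (\<integral>w. accept_at G \<sigma> (\<sigma>\<^sup>2/2 + \<sigma> * w) \<partial>gauss 0 1)"
    unfolding gauss_std[OF \<sigma>, of "\<sigma>\<^sup>2/2"]
    by (rule integral_distr) (use accept_at_measurable[OF assms] in measurable)
  finally show ?thesis by (simp add: accept_at_eq[OF assms])
qed

lemma gauss_mean_accept: "0 < t \<Longrightarrow> (\<integral>\<^sup>+x. ennreal (min 1 (exp x)) \<partial>gauss (- d) t) = ennreal (mean_accept d t)"
  unfolding gauss_std[of t "-d"] mean_accept_def
  by (subst nn_integral_distr) (auto simp: nn_integral_eq_integral[OF mean_accept_integrable] add.commute[of "-d"])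

text \<open>In stationarity the log-ratio is normal with mean
  \<open>-(1 - rho G) * \<sigma>^2\<close> and variance
  \<open>v^2 = b^2 + s^2 = 2 * (1 - rho G) * \<sigma>^2\<close>. The mean is minus half the
  variance, so this is the balanced case.\<close>

lemma accept_rate_eq:
  assumes G: "2 \<le> G" and \<sigma>: "0 < \<sigma>"
  shows "accept_rate G \<sigma> = 2 * Phi (- \<sigma> * sqrt (1 - rho G) / sqrt 2)"
proof -
  define s where "s = \<sigma> * sqrt (1 - (rho G)\<^sup>2)"
  define b where "b = (1 - rho G) * \<sigma>"
  define v where "v = \<sigma> * sqrt (1 - rho G) * sqrt 2"
  have r: "rho G < 1" "(rho G)\<^sup>2 < 1" "0 \<le> rho G" using rho_bounds[of G] rho_sq[of G] G by auto
  have s: "0 < s" and b: "0 < b" and v: "0 < v" using \<sigma> r by (auto simp: s_def b_def v_def)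
  have v2: "v\<^sup>2 = 2 * (1 - rho G) * \<sigma>\<^sup>2" using r by (simp add: v_def power_mult_distrib)
  then have v2': "v\<^sup>2 / 2 = (1 - rho G) * \<sigma>\<^sup>2" by simp
  have "b\<^sup>2 + s\<^sup>2 = v\<^sup>2"
    unfolding v2 using r by (simp add: b_def s_def power_mult_distrib) (simp add: power2_eq_square algebra_simps)
  then have vs: "sqrt (b\<^sup>2 + s\<^sup>2) = v" using v by simp
  have nn: "0 \<le> mean_accept d s" for d using mean_accept_pos[OF s, of d] by simp
  have ia: "integrable (gauss 0 1) (\<lambda>w. mean_accept (v\<^sup>2 / 2 + b * w) s)"
    by (rule std.integrable_const_bound[where B=1]) (use nn mean_accept_le_1 in auto)
  have "ennreal (\<integral>w. mean_accept (v\<^sup>2 / 2 + b * w) s \<partial>gauss 0 1) = (\<integral>\<^sup>+w. ennreal (mean_accept (v\<^sup>2 / 2 + b * w) s) \<partial>gauss 0 1)"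
    by (rule nn_integral_eq_integral[OF ia, symmetric]) (simp add: nn)
  also have "\<dots> = (\<integral>\<^sup>+w. \<integral>\<^sup>+x. ennreal (min 1 (exp x)) \<partial>gauss (- (v\<^sup>2 / 2) + - b * w) s \<partial>gauss 0 1)"
    using gauss_mean_accept[OF s, of "v\<^sup>2/2 + b * w" for w] by simp
  also have "\<dots> = (\<integral>\<^sup>+w. \<integral>\<^sup>+x. ennreal (min 1 (exp x)) \<partial>gauss (- (v\<^sup>2 / 2) + w) s \<partial>gauss 0 b)"
  proof -
    \<comment> \<open>The image under \<open>- b * x\<close> rather than \<open>b * x\<close>,
      because a higher current state lowers the log-ratio.\<close>
    have e: "gauss 0 b = distr (gauss 0 1) borel (\<lambda>x. - b * x)"
      using gauss_affine[of 1 "-b" 0 0] b by simp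
    have m: "(\<lambda>w. \<integral>\<^sup>+x. ennreal (min 1 (exp x)) \<partial>gauss (- (v\<^sup>2 / 2) + w) s) \<in> borel_measurable borel"
      by (rule measurable_compose[OF measurable_prob_algebraD[OF gauss_kernel[OF _ s]] nn_integral_measurable_subprob_algebra]) auto
    show ?thesis unfolding e by (subst nn_integral_distr) (use m in simp_all)
  qed
  also have "\<dots> = (\<integral>\<^sup>+x. ennreal (min 1 (exp x)) \<partial>gauss (- (v\<^sup>2 / 2)) v)"
    using gauss_convolution[OF _ b s, of "\<lambda>x. ennreal (min 1 (exp x))" "- (v\<^sup>2/2)"] vs by simp
  also have "\<dots> = ennreal (mean_accept (v\<^sup>2 / 2) v)" by (rule gauss_mean_accept[OF v])
  finally have "(\<integral>w. mean_accept (v\<^sup>2 / 2 + b * w) s \<partial>gauss 0 1) = mean_accept (v\<^sup>2 / 2) v"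
    using nn mean_accept_pos[OF v, of "v\<^sup>2 / 2"] by (subst (asm) ennreal_inj) (auto intro!: integral_nonneg_AE)
  then have "accept_rate G \<sigma> = mean_accept (v\<^sup>2 / 2) v"
    unfolding accept_rate_mean_accept[OF assms] v2'[symmetric] b_def[symmetric] s_def[symmetric] .
  also have "\<dots> = 2 * Phi (- v / 2)" by (rule mean_accept_balanced[OF v])
  also have "- v / 2 = - \<sigma> * sqrt (1 - rho G) / sqrt 2"
    by (simp add: v_def real_div_sqrt field_simps)
  finally show ?thesis .
qed

lemma inefficiency_lower:
  assumes G: "3 \<le> G" and \<sigma>: "0 < \<sigma>"
  shows "1 / Phi (- \<sigma> * sqrt (1 - rho G) / sqrt 2) - 1 \<le> inefficiency G \<sigma>"
proof -
  have G2: "2 \<le> G" using G by simp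
  have A: "accept_rate G \<sigma> = 2 * Phi (- \<sigma> * sqrt (1 - rho G) / sqrt 2)"
    by (rule accept_rate_eq[OF G2 \<sigma>])
  have "2 / accept_rate G \<sigma> - 1 \<le> inefficiency G \<sigma>"
    unfolding inefficiency_eq[OF G2 \<sigma>] accept_rate_mean_accept[OF G2 \<sigma>]
    by (rule mean_inefficiency_Jensen[OF mean_inefficiency_conditions(1)[OF assms] _ mean_inefficiency_conditions(2,3)[OF assms]])
      (use \<sigma> A Phi_pos accept_rate_mean_accept[OF G2 \<sigma>] in auto)
  then show ?thesis unfolding A by simp
qed

text \<open>Gives the existence of a minimiser on a compact window. A convergent sequence of
  \<open>\<sigma>\<close> is bounded, and its bound serves as the common constant of the
  majorant.\<close>

lemma inefficiency_continuous:
  assumes G: "3 \<le> G" shows "continuous_on {0<..} (inefficiency G)"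
proof (rule continuous_on_sequentiallyI)
  fix u :: "nat \<Rightarrow> real" and a assume u: "\<forall>n. u n \<in> {0<..}" and a: "a \<in> {0<..}" and lim: "u \<longlonglongrightarrow> a"
  have G2: "2 \<le> G" using G by simp
  have "Bseq u" using lim by (intro convergent_imp_Bseq convergentI)
  then obtain c where c: "\<And>n. \<bar>u n\<bar> \<le> c" and c0: "0 < c" by (auto simp: Bseq_def)
  have u0: "0 < u n" for n using u by simp
  have "(\<lambda>n. mean_inefficiency ((1 - rho G) * (u n)\<^sup>2) ((1 - rho G) * u n) (u n * sqrt (1 - (rho G)\<^sup>2))) \<longlonglongrightarrow>
     mean_inefficiency ((1 - rho G) * a\<^sup>2) ((1 - rho G) * a) (a * sqrt (1 - (rho G)\<^sup>2))"
  proof (rule mean_inefficiency_tendsto[where c=c])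
    show "(1 - rho G) * (u n)\<^sup>2 \<le> c * (u n * sqrt (1 - (rho G)\<^sup>2))" for n
    proof -
      have "u n \<le> c" using c[of n] by simp
      then have "u n * (u n * sqrt (1 - (rho G)\<^sup>2)) \<le> c * (u n * sqrt (1 - (rho G)\<^sup>2))"
        by (rule mult_right_mono) (rule less_imp_le[OF mean_inefficiency_conditions(1)[OF G u0]])
      with mean_inefficiency_conditions(2)[OF G u0[of n]] show ?thesis by linarith
    qed
  qed (use mean_inefficiency_conditions[OF G] u0 a c0 in \<open>auto intro!: tendsto_intros lim\<close>)
  then show "(\<lambda>n. inefficiency G (u n)) \<longlonglongrightarrow> inefficiency G a"
    using u0 a by (simp add: inefficiency_eq[OF G2])
qed

text \<open>For fixed \<open>x\<close> the drift is constantly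
  \<open>2 * x^2 = (2 * x)^2 / 2\<close>, the noise tends to \<open>2 * x\<close> and the slope to
  0, so the limit is the balanced case with \<open>t = 2 * x\<close>.\<close>

lemma inefficiency_limit:
  assumes x: "0 < x"
  shows "(\<lambda>G. inefficiency G (x * sqrt 2 / sqrt (1 - rho G))) \<longlonglongrightarrow> 1 / Phi (- x) - 1"
proof -
  \<comment> \<open>The shift by 3 makes the bounds for \<open>G \<ge> 3\<close> available for every
    index; \<open>LIMSEQ_offset\<close> undoes it.\<close>
  define \<sigma> where "\<sigma> n = x * sqrt 2 / sqrt (1 - rho (n + 3))" for n :: nat
  have r: "rho (n + 3) < 1" "0 \<le> rho (n + 3)" "2 \<le> n + 3" "3 \<le> n + 3" for n
    using rho_bounds[of "n + 3"] by auto
  have \<sigma>: "0 < \<sigma> n" for n using r[of n] x by (simp add: \<sigma>_def)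
  have rt: "0 < sqrt (1 - rho (n + 3))" for n using r[of n] by simp
  have sq: "sqrt (1 - rho (n + 3)) * sqrt (1 - rho (n + 3)) = 1 - rho (n + 3)" for n
    using r[of n] by simp
  have a: "(1 - rho (n + 3)) * (\<sigma> n)\<^sup>2 = 2 * x\<^sup>2" for n
    using r[of n] by (simp add: \<sigma>_def power_mult_distrib power_divide)
  have b: "(1 - rho (n + 3)) * \<sigma> n = x * sqrt 2 * sqrt (1 - rho (n + 3))" for n
  proof -
    have "(1 - rho (n + 3)) * \<sigma> n = (sqrt (1 - rho (n + 3)) * sqrt (1 - rho (n + 3))) * (x * sqrt 2 / sqrt (1 - rho (n + 3)))"
      by (simp only: \<sigma>_def sq)
    also have "\<dots> = x * sqrt 2 * sqrt (1 - rho (n + 3))" using rt[of n] by (simp del: real_sqrt_mult_self)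
    finally show ?thesis .
  qed
  have t: "\<sigma> n * sqrt (1 - (rho (n + 3))\<^sup>2) = x * sqrt 2 * sqrt (1 + rho (n + 3))" for n
  proof -
    have "1 - (rho (n + 3))\<^sup>2 = (1 - rho (n + 3)) * (1 + rho (n + 3))"
      by (simp add: power2_eq_square algebra_simps)
    then show ?thesis using rt[of n] by (simp add: \<sigma>_def real_sqrt_mult)
  qed
  have rho_lim: "(\<lambda>n. rho (n + 3)) \<longlonglongrightarrow> 1"
  proof -
    have "rho \<longlonglongrightarrow> 1 - 0" unfolding rho_def[abs_def]
      by (intro tendsto_intros lim_1_over_n)
    then show ?thesis by (intro LIMSEQ_ignore_initial_segment) simp
  qed
  have "(\<lambda>n. mean_inefficiency ((1 - rho (n + 3)) * (\<sigma> n)\<^sup>2) ((1 - rho (n + 3)) * \<sigma> n) (\<sigma> n * sqrt (1 - (rho (n + 3))\<^sup>2)))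
      \<longlonglongrightarrow> mean_inefficiency ((2 * x)\<^sup>2 / 2) 0 (2 * x)"
  \<comment> \<open>With this \<open>c\<close>,
    \<open>c * t = 2 * x^2 * sqrt (1 + rho (n + 3))\<close>, at least the drift since the root is at
    least 1.\<close>
  proof (rule mean_inefficiency_tendsto[where c="x * sqrt 2"])
    show "0 < \<sigma> n * sqrt (1 - (rho (n + 3))\<^sup>2)" "\<bar>(1 - rho (n + 3)) * \<sigma> n\<bar> \<le> \<sigma> n * sqrt (1 - (rho (n + 3))\<^sup>2) / 2" for n
      using mean_inefficiency_conditions[OF r(4) \<sigma>] by auto
    show "(1 - rho (n + 3)) * (\<sigma> n)\<^sup>2 \<le> x * sqrt 2 * (\<sigma> n * sqrt (1 - (rho (n + 3))\<^sup>2))" for n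
    proof -
      have "x * sqrt 2 * (x * sqrt 2) * 1 \<le> x * sqrt 2 * (x * sqrt 2) * sqrt (1 + rho (n + 3))"
        using x r[of n] by (intro mult_left_mono) auto
      moreover have "x * sqrt 2 * (x * sqrt 2) = 2 * x\<^sup>2" by (simp add: power2_eq_square)
      ultimately show ?thesis unfolding a t by (simp add: mult.assoc)
    qed
    show "(\<lambda>n. (1 - rho (n + 3)) * (\<sigma> n)\<^sup>2) \<longlonglongrightarrow> (2 * x)\<^sup>2 / 2"
      unfolding a by (simp add: power_mult_distrib)
    have "(\<lambda>n. x * sqrt 2 * sqrt (1 - rho (n + 3))) \<longlonglongrightarrow> x * sqrt 2 * sqrt (1 - 1)"
      by (intro tendsto_intros rho_lim)
    then show "(\<lambda>n. (1 - rho (n + 3)) * \<sigma> n) \<longlonglongrightarrow> 0" unfolding b by simp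
    have "(\<lambda>n. x * sqrt 2 * sqrt (1 + rho (n + 3))) \<longlonglongrightarrow> x * sqrt 2 * sqrt (1 + 1)"
      by (intro tendsto_intros rho_lim)
    then show "(\<lambda>n. \<sigma> n * sqrt (1 - (rho (n + 3))\<^sup>2)) \<longlonglongrightarrow> 2 * x" unfolding t by (simp add: mult.assoc mult.commute[of x 2] mult.left_commute[of _ x])
  qed (use x in auto)
  then have "(\<lambda>n. inefficiency (n + 3) (\<sigma> n)) \<longlonglongrightarrow> 1 / Phi (- x) - 1"
    unfolding inefficiency_eq[OF r(3) \<sigma>, symmetric] using mean_inefficiency_balanced[of "2 * x"] x by simp
  then show ?thesis
    unfolding \<sigma>_def by (rule LIMSEQ_offset[where k=3])
qed

section \<open>The limiting cost function\<close>

lemma Phi_tendsto_1: "(Phi \<longlongrightarrow> 1) at_top"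
proof -
  interpret real_distribution "gauss 0 1" by unfold_locales simp
  have "Phi = cdf (gauss 0 1)" by (simp add: fun_eq_iff Phi_def cdf_def)
  then show ?thesis using cdf_lim_at_top_prob by simp
qed

lemma std_density_deriv: "(std_normal_density has_real_derivative - x * std_normal_density x) (at x)"
proof -
  have "((\<lambda>x. exp (- x\<^sup>2 / 2)) has_real_derivative - x * exp (- x\<^sup>2 / 2)) (at x)"
    by (auto intro!: derivative_eq_intros)
  from DERIV_cmult[OF this, of "1 / sqrt (2 * pi)"] show ?thesis
    by (simp add: std_normal_density_def[abs_def] mult_ac)
qed

text \<open>Mills' ratio: \<open>t \<mapsto> \<phi> t + x \<Phi> t\<close> decreases on \<open>{x..}\<close> and tends to a limit \<open>\<ge> x\<close>.\<close>

lemma Mills_ratio: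
  assumes "0 < x"
  shows "x * Phi (- x) < std_normal_density x"
proof -
  let ?k = "\<lambda>t. std_normal_density t + x * Phi t"
  have k: "?k b < ?k a" if "x \<le> a" "a < b" for a b
  proof (rule DERIV_neg_imp_decreasing_open[OF that(2)])
    show "\<exists>y. (?k has_real_derivative y) (at t) \<and> y < 0" if "a < t" "t < b" for t
    proof (intro exI conjI)
      show "(?k has_real_derivative (- t * std_normal_density t + x * std_normal_density t)) (at t)"
        by (intro DERIV_add DERIV_cmult Phi_deriv std_density_deriv)
      have "(x - t) * std_normal_density t < 0"
        using that \<open>x \<le> a\<close> by (intro mult_neg_pos normal_density_pos) auto
      then show "- t * std_normal_density t + x * std_normal_density t < 0" by (simp add: algebra_simps)
    qed
    show "continuous_on {a..b} ?k"
      by (intro continuous_intros continuous_std_density DERIV_continuous_on[OF has_field_derivative_at_within[OF Phi_deriv]])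
  qed
  \<comment> \<open>The passage to the limit loses strictness. It is therefore done at
    \<open>x + 1\<close>, and the strict decrease from \<open>x\<close> to \<open>x + 1\<close>
    restores it.\<close>
  have "x * 1 \<le> ?k (x + 1)"
  proof (rule tendsto_upperbound[OF tendsto_mult[OF tendsto_const Phi_tendsto_1]])
    show "\<forall>\<^sub>F t in at_top. x * Phi t \<le> ?k (x + 1)"
      using eventually_gt_at_top[of "x + 1"]
    proof eventually_elim
      case (elim t)
      have "?k t < ?k (x + 1)" by (rule k) (use elim in auto)
      then show ?case using normal_density_nonneg[of 0 1 t] by linarith
    qed
  qed simp
  also have "?k (x + 1) < ?k x" by (rule k) auto
  finally show ?thesis by (simp add: Phi_minus algebra_simps)
qed

definition limit_inefficiency :: "real \<Rightarrow> real" where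
  "limit_inefficiency x = 1 / Phi (- x) - 1"

text \<open>The derivative of \<open>ln (limit_inefficiency x)\<close> with respect to
  \<open>ln x\<close>: with \<open>limit_inefficiency x = Phi x / Phi (- x)\<close>, the two terms
  combine because \<open>Phi x + Phi (- x) = 1\<close>.\<close>

definition elasticity :: "real \<Rightarrow> real" where
  "elasticity x = x * std_normal_density x / (Phi x * Phi (- x))"

lemma limit_inefficiency_eq: "limit_inefficiency x = Phi x / Phi (- x)"
  using Phi_pos[of "-x"] by (simp add: limit_inefficiency_def Phi_minus[of x] field_simps)

lemma limit_inefficiency_pos: "0 < limit_inefficiency x"
  unfolding limit_inefficiency_eq by (simp add: Phi_pos)

lemma Phi_neg_deriv: "((\<lambda>x. Phi (- x)) has_real_derivative - std_normal_density x) (at x)"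
  unfolding Phi_minus using DERIV_diff[OF DERIV_const Phi_deriv] by simp

lemma elasticity_ln_deriv:
  assumes "0 < x"
  shows "((\<lambda>x. ln x + ln (std_normal_density x) - ln (Phi x) - ln (Phi (- x))) has_real_derivative
    (1 / x - x - std_normal_density x / Phi x + std_normal_density x / Phi (- x))) (at x)"
  using assms Phi_pos[of x] Phi_pos[of "-x"] normal_density_pos[of 1 0 x]
  by (auto intro!: derivative_eq_intros Phi_deriv Phi_neg_deriv std_density_deriv)

text \<open>From \<open>x \<le> 1 + x^2 / 2 \<le> exp (x^2 / 2)\<close> and
  \<open>2 < sqrt (2 * pi)\<close>.\<close>

lemma x_density_le: "0 < x \<Longrightarrow> x * std_normal_density x < 1/2"
proof -
  assume x: "0 < x"
  have "x \<le> 1 + x\<^sup>2 / 2" using zero_le_power2[of "x - 1"] by (simp add: power2_eq_square algebra_simps)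
  also have "\<dots> \<le> exp (x\<^sup>2 / 2)" by (rule exp_ge_add_one_self)
  finally have 1: "x * exp (- x\<^sup>2 / 2) \<le> 1" by (simp add: exp_minus field_simps)
  have "2 < sqrt (2 * pi)" using pi_gt3 by (intro real_less_rsqrt) auto
  then have "1 / sqrt (2 * pi) < 1/2" by (simp add: field_simps)
  then show ?thesis
    using 1 x mult_le_less_imp_less[of "x * exp (- x\<^sup>2 / 2)" 1 "1 / sqrt (2 * pi)" "1/2"]
    by (simp add: std_normal_density_def mult_ac)
qed

text \<open>The logarithmic derivative is \<open>1/x - x - f/Phi x + f/Phi (- x)\<close> with
  \<open>f\<close> the density. Mills' ratio beats \<open>x\<close> by the last term;
  \<open>x_density_le\<close> and \<open>Phi x > 1/2\<close> make the third smaller than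
  \<open>1/x\<close>.\<close>

lemma elasticity_strict_mono:
  assumes "0 < x" "x < y"
  shows "elasticity x < elasticity y"
proof -
  let ?l = "\<lambda>x. ln x + ln (std_normal_density x) - ln (Phi x) - ln (Phi (- x))"
  have e: "elasticity t = exp (?l t)" if "0 < t" for t
    using that Phi_pos[of t] Phi_pos[of "-t"] normal_density_pos[of 1 0 t]
    by (simp add: elasticity_def exp_add exp_diff)
  have "?l x < ?l y"
  proof (rule DERIV_pos_imp_increasing[OF assms(2)])
    fix t assume t: "x \<le> t" "t \<le> y"
    then have t0: "0 < t" using assms by simp
    have "t < std_normal_density t / Phi (- t)" using Mills_ratio[OF t0] Phi_pos[of "-t"] by (simp add: field_simps)
    moreover have "std_normal_density t / Phi t < 1 / t"
    proof -
      have "1/2 < Phi t" using Phi_strict_mono[OF t0] Phi_0 by simp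
      then show ?thesis using x_density_le[OF t0] t0 by (simp add: field_simps)
    qed
    ultimately show "\<exists>d. (?l has_real_derivative d) (at t) \<and> 0 < d"
      using elasticity_ln_deriv[OF t0] by (intro exI conjI) auto
  qed
  then show ?thesis using e assms by simp
qed

definition log_cost :: "real \<Rightarrow> real \<Rightarrow> real" where
  "log_cost \<alpha> x = ln (limit_inefficiency x) - \<alpha> * ln x"

lemma log_cost_deriv:
  assumes "0 < x"
  shows "(log_cost \<alpha> has_real_derivative (elasticity x - \<alpha>) / x) (at x)"
proof -
  have e: "log_cost \<alpha> = (\<lambda>x. ln (Phi x) - ln (Phi (- x)) - \<alpha> * ln x)"
    by (simp add: fun_eq_iff log_cost_def limit_inefficiency_eq ln_div Phi_pos less_imp_neq[OF Phi_pos, symmetric])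
  have "((\<lambda>x. ln (Phi x) - ln (Phi (- x)) - \<alpha> * ln x) has_real_derivative
      std_normal_density x / Phi x + std_normal_density x / Phi (- x) - \<alpha> / x) (at x)"
    using assms Phi_pos[of x] Phi_pos[of "-x"]
    by (auto intro!: derivative_eq_intros Phi_deriv Phi_neg_deriv)
  moreover have "std_normal_density x / Phi x + std_normal_density x / Phi (- x) - \<alpha> / x = (elasticity x - \<alpha>) / x"
  proof -
    have "std_normal_density x / Phi x + std_normal_density x / Phi (- x) =
        std_normal_density x * (Phi x + Phi (- x)) / (Phi x * Phi (- x))"
      using Phi_pos[of x] Phi_pos[of "-x"] by (simp add: field_simps)
    also have "Phi x + Phi (- x) = 1" by (simp add: Phi_minus)
    finally show ?thesis using assms by (simp add: elasticity_def diff_divide_distrib)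
  qed
  ultimately show ?thesis by (simp add: e)
qed

lemma log_cost_decreasing:
  assumes "0 < x" "x < y" "elasticity y \<le> \<alpha>"
  shows "log_cost \<alpha> y < log_cost \<alpha> x"
proof (rule DERIV_neg_imp_decreasing_open[OF assms(2)])
  show "\<exists>d. (log_cost \<alpha> has_real_derivative d) (at t) \<and> d < 0" if "x < t" "t < y" for t
  proof (intro exI conjI)
    show "(log_cost \<alpha> has_real_derivative (elasticity t - \<alpha>) / t) (at t)"
      by (rule log_cost_deriv) (use assms that in simp)
    have "elasticity t < \<alpha>" using elasticity_strict_mono[of t y] assms that by simp
    then show "(elasticity t - \<alpha>) / t < 0" using assms that by (simp add: divide_neg_pos)
  qed
  show "continuous_on {x..y} (log_cost \<alpha>)"
    by (rule DERIV_continuous_on) (use assms in \<open>auto intro!: has_field_derivative_at_within[OF log_cost_deriv]\<close>)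
qed

lemma log_cost_increasing:
  assumes "0 < x" "x < y" "\<alpha> \<le> elasticity x"
  shows "log_cost \<alpha> x < log_cost \<alpha> y"
proof (rule DERIV_pos_imp_increasing_open[OF assms(2)])
  show "\<exists>d. (log_cost \<alpha> has_real_derivative d) (at t) \<and> 0 < d" if "x < t" "t < y" for t
  proof (intro exI conjI)
    show "(log_cost \<alpha> has_real_derivative (elasticity t - \<alpha>) / t) (at t)"
      by (rule log_cost_deriv) (use assms that in simp)
    have "\<alpha> < elasticity t" using elasticity_strict_mono[of x t] assms that by simp
    then show "0 < (elasticity t - \<alpha>) / t" using assms that by simp
  qed
  show "continuous_on {x..y} (log_cost \<alpha>)"
    by (rule DERIV_continuous_on) (use assms in \<open>auto intro!: has_field_derivative_at_within[OF log_cost_deriv]\<close>)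
qed

lemma elasticity_continuous: "continuous_on A elasticity"
  unfolding elasticity_def Phi_minus
  by (intro continuous_intros continuous_std_density DERIV_continuous_on[OF has_field_derivative_at_within[OF Phi_deriv]])
    (auto simp: less_imp_neq[OF Phi_pos, symmetric] less_imp_neq[OF Phi_less_1])

lemma elasticity_solution:
  assumes "0 < lo" "elasticity lo < \<alpha>" "\<alpha> < elasticity hi" "lo < hi"
  obtains x where "lo < x" "x < hi" "elasticity x = \<alpha>"
proof -
  obtain x where x: "lo \<le> x" "x \<le> hi" "elasticity x = \<alpha>"
    using IVT'[of elasticity lo \<alpha> hi] assms elasticity_continuous by auto
  then have "lo \<noteq> x" "x \<noteq> hi" using assms by auto
  then show ?thesis using x that by force
qed

section \<open>Numerical bounds\<close>

definition exp_sum :: "nat \<Rightarrow> real \<Rightarrow> real" where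
  "exp_sum n x = (\<Sum>j<n. (- (x\<^sup>2 / 2)) ^ j / fact j)"

text \<open>\<open>exp_sum\<close> integrated termwise from 0, an approximation of
  \<open>sqrt (2 * pi) * (Phi x - 1/2)\<close>.\<close>

definition erf_sum :: "nat \<Rightarrow> real \<Rightarrow> real" where
  "erf_sum n x = (\<Sum>j<n. (-1) ^ j / (2 ^ j * fact j * (2 * real j + 1)) * x ^ (2 * j + 1))"

text \<open>Lagrange remainder at a nonpositive argument: its sign is the parity of
  \<open>n\<close>. Unlike a comparison of alternating terms this holds for all
  \<open>x\<close>.\<close>

lemma exp_sum_bounds:
  shows "even n \<Longrightarrow> exp_sum n x \<le> exp (- x\<^sup>2 / 2)" and "odd n \<Longrightarrow> exp (- x\<^sup>2 / 2) \<le> exp_sum n x"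
proof -
  obtain t where t: "exp (- (x\<^sup>2 / 2)) = exp_sum n x + exp t / fact n * (- (x\<^sup>2 / 2)) ^ n"
    using Maclaurin_exp_le[of "- (x\<^sup>2 / 2)" n] unfolding exp_sum_def by auto
  show "even n \<Longrightarrow> exp_sum n x \<le> exp (- x\<^sup>2 / 2)"
    using t by (simp add: zero_le_even_power)
  show "odd n \<Longrightarrow> exp (- x\<^sup>2 / 2) \<le> exp_sum n x"
    using t by (simp add: mult_nonneg_nonpos)
qed

lemma erf_sum_deriv: "(erf_sum n has_real_derivative exp_sum n x) (at x)"
proof -
  have "((\<lambda>x. (-1) ^ j / (2 ^ j * fact j * (2 * real j + 1)) * x ^ (2 * j + 1)) has_real_derivative
      (- (x\<^sup>2 / 2)) ^ j / fact j) (at x)" for j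
  proof -
    have "((\<lambda>x::real. x ^ (2 * j + 1)) has_real_derivative (2 * real j + 1) * x ^ (2 * j)) (at x)"
      using DERIV_pow[of "2 * j + 1" x UNIV] by (simp add: add.commute)
    from DERIV_cmult[OF this, of "(-1) ^ j / (2 ^ j * fact j * (2 * real j + 1))"]
    have "((\<lambda>x. (-1) ^ j / (2 ^ j * fact j * (2 * real j + 1)) * x ^ (2 * j + 1)) has_real_derivative
      (-1) ^ j / (2 ^ j * fact j * (2 * real j + 1)) * ((2 * real j + 1) * x ^ (2 * j))) (at x)" .
    moreover have "(-1) ^ j / (2 ^ j * fact j * (2 * real j + 1)) * ((2 * real j + 1) * x ^ (2 * j)) =
        (- (x\<^sup>2 / 2)) ^ j / fact j"
    proof -
      have "(- (x\<^sup>2 / 2)) ^ j = (-1) ^ j * x ^ (2 * j) / 2 ^ j"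
        by (subst power_minus) (simp add: power_divide power_mult)
      moreover have "a / (p * f * d) * (d * y) = a * y / p / f" if "d \<noteq> 0" for a p f d y :: real
        using that by simp
      moreover have "2 * real j + 1 \<noteq> 0" by linarith
      ultimately show ?thesis by simp
    qed
    ultimately show ?thesis by simp
  qed
  then show ?thesis
    unfolding erf_sum_def[abs_def] exp_sum_def by (intro DERIV_sum)
qed

lemma Phi_sum_deriv:
  "((\<lambda>x. Phi x - 1 / sqrt (2 * pi) * erf_sum n x) has_real_derivative
    1 / sqrt (2 * pi) * (exp (- x\<^sup>2 / 2) - exp_sum n x)) (at x)"
  using DERIV_diff[OF Phi_deriv DERIV_cmult[OF erf_sum_deriv, of "1 / sqrt (2 * pi)"]]
  by (simp add: std_normal_density_def right_diff_distrib)

text \<open>The parity of \<open>n\<close> fixes the sign of the derivative of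
  \<open>Phi x - erf_sum n x / sqrt (2 * pi)\<close>, whose value at 0 is 1/2.\<close>

lemma
  assumes "0 \<le> x"
  shows Phi_lower_sum: "even n \<Longrightarrow> 1/2 + 1 / sqrt (2 * pi) * erf_sum n x \<le> Phi x"
    and Phi_upper_sum: "odd n \<Longrightarrow> Phi x \<le> 1/2 + 1 / sqrt (2 * pi) * erf_sum n x"
proof -
  let ?f = "\<lambda>x. Phi x - 1 / sqrt (2 * pi) * erf_sum n x"
  have f0: "?f 0 = 1/2" by (simp add: Phi_0 erf_sum_def)
  show "1/2 + 1 / sqrt (2 * pi) * erf_sum n x \<le> Phi x" if "even n"
  proof -
    have "?f 0 \<le> ?f x"
    proof (rule DERIV_nonneg_imp_nondecreasing[OF assms])
      show "\<exists>d. (?f has_real_derivative d) (at y) \<and> 0 \<le> d" for y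
        using Phi_sum_deriv[of n y] exp_sum_bounds(1)[OF that, of y] by (intro exI conjI) auto
    qed
    then show ?thesis using f0 by linarith
  qed
  show "Phi x \<le> 1/2 + 1 / sqrt (2 * pi) * erf_sum n x" if "odd n"
  proof -
    have "?f x \<le> ?f 0"
    proof (rule DERIV_nonpos_imp_nonincreasing[OF assms])
      show "\<exists>d. (?f has_real_derivative d) (at y) \<and> d \<le> 0" for y
        using Phi_sum_deriv[of n y] exp_sum_bounds(2)[OF that, of y]
        by (intro exI conjI) (auto intro: mult_nonneg_nonpos divide_nonpos_nonneg)
    qed
    then show ?thesis using f0 by linarith
  qed
qed

lemma inverse_sqrt_2pi: "0.39894228 \<le> 1 / sqrt (2 * pi)" "1 / sqrt (2 * pi) \<le> 0.39894229"
proof -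
  have p: "3.141592653588 \<le> pi" "pi \<le> 3.1415926535899" by (rule pi_approx)+
  have "sqrt (2 * pi) \<le> 1 / 0.39894228"
    by (rule real_le_lsqrt) (use p in \<open>simp_all add: power2_eq_square\<close>)
  then show "0.39894228 \<le> 1 / sqrt (2 * pi)" by (simp add: field_simps)
  have "1 / 0.39894229 \<le> sqrt (2 * pi)"
    by (rule real_le_rsqrt) (use p in \<open>simp add: power2_eq_square\<close>)
  then show "1 / sqrt (2 * pi) \<le> 0.39894229" by (simp add: field_simps)
qed

text \<open>With \<open>\<Phi> x = 1/2 + p\<close> the denominator of \<open>elasticity x\<close> is \<open>1/4 - p\<^sup>2\<close>.\<close>

lemma elasticity_less:
  assumes x: "0 < x" and e: "exp (- x\<^sup>2 / 2) \<le> e" and p: "Phi x \<le> 1/2 + p"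
    and ineq: "x * (0.39894229 * e) < \<alpha> * (1/4 - p\<^sup>2)" and \<alpha>: "0 < \<alpha>"
  shows "elasticity x < \<alpha>"
proof -
  have e0: "0 \<le> e" using e exp_ge_zero[of "- x\<^sup>2 / 2"] by linarith
  have "std_normal_density x \<le> 0.39894229 * e"
    unfolding std_normal_density_def by (intro mult_mono inverse_sqrt_2pi e) auto
  then have "x * std_normal_density x \<le> x * (0.39894229 * e)" using x by simp
  moreover have "1/4 - p\<^sup>2 \<le> Phi x * Phi (- x)"
  proof -
    have "1/2 \<le> Phi x" using Phi_strict_mono[OF x] Phi_0 by simp
    then have "(Phi x - 1/2)\<^sup>2 \<le> p\<^sup>2" using p by (intro power_mono) auto
    then show ?thesis by (simp add: Phi_minus power2_eq_square algebra_simps)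
  qed
  then have "\<alpha> * (1/4 - p\<^sup>2) \<le> \<alpha> * (Phi x * Phi (- x))" using \<alpha> by simp
  ultimately have "x * std_normal_density x < \<alpha> * (Phi x * Phi (- x))" using ineq by linarith
  then show ?thesis by (simp add: elasticity_def divide_less_eq Phi_pos)
qed

lemma elasticity_greater:
  assumes x: "0 < x" and e: "e \<le> exp (- x\<^sup>2 / 2)" "0 \<le> e" and p: "1/2 + p \<le> Phi x" "0 \<le> p"
    and ineq: "\<alpha> * (1/4 - p\<^sup>2) < x * (0.39894228 * e)" and \<alpha>: "0 < \<alpha>"
  shows "\<alpha> < elasticity x"
proof -
  have "0.39894228 * e \<le> std_normal_density x"
    unfolding std_normal_density_def by (intro mult_mono inverse_sqrt_2pi e) auto
  then have "x * (0.39894228 * e) \<le> x * std_normal_density x" using x by simp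
  moreover have "Phi x * Phi (- x) \<le> 1/4 - p\<^sup>2"
  proof -
    have "p\<^sup>2 \<le> (Phi x - 1/2)\<^sup>2" using p by (intro power_mono) auto
    then show ?thesis by (simp add: Phi_minus power2_eq_square algebra_simps)
  qed
  then have "\<alpha> * (Phi x * Phi (- x)) \<le> \<alpha> * (1/4 - p\<^sup>2)" using \<alpha> by simp
  ultimately have "\<alpha> * (Phi x * Phi (- x)) < x * std_normal_density x" using ineq by linarith
  then show ?thesis by (simp add: elasticity_def less_divide_eq Phi_pos)
qed

lemma Phi_erf_sum:
  assumes "0 \<le> x" "0 \<le> T"
  shows "even n \<Longrightarrow> T \<le> erf_sum n x \<Longrightarrow> 1/2 + 0.39894228 * T \<le> Phi x"
    and "odd n \<Longrightarrow> erf_sum n x \<le> T \<Longrightarrow> Phi x \<le> 1/2 + 0.39894229 * T"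
proof -
  show "1/2 + 0.39894228 * T \<le> Phi x" if "even n" "T \<le> erf_sum n x"
  proof -
    have "0.39894228 * T \<le> 1 / sqrt (2 * pi) * erf_sum n x"
      by (intro mult_mono inverse_sqrt_2pi that assms) auto
    then show ?thesis using Phi_lower_sum[OF assms(1) that(1)] by linarith
  qed
  show "Phi x \<le> 1/2 + 0.39894229 * T" if "odd n" "erf_sum n x \<le> T"
  proof -
    have "1 / sqrt (2 * pi) * erf_sum n x \<le> 1 / sqrt (2 * pi) * T" by (intro mult_left_mono that) auto
    also have "\<dots> \<le> 0.39894229 * T" by (intro mult_right_mono inverse_sqrt_2pi assms)
    finally show ?thesis using Phi_upper_sum[OF assms(1) that(1)] by linarith
  qed
qed

text \<open>Left end of the window for exponent 2, chosen with
  \<open>1.9996 * 1.078 \<ge> 2.155\<close>. The bound \<open>0.8575 = 1 - 0.285 / 2\<close> keeps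
  the acceptance rate below 0.285. At the right end 1.0823, \<open>2 * 1.0823 \<le> 2.165\<close>
  and \<open>0.8625 = 1 - 0.275 / 2\<close> play the same part.\<close>

lemma Phi_1_078: "0.8575 < Phi 1.078" and elasticity_1_078: "elasticity 1.078 < 2"
proof -
  have "0.9 \<le> erf_sum 4 1.078" "erf_sum 5 1.078 \<le> 0.9012" "exp_sum 5 1.078 \<le> 0.55982"
    by (simp_all add: erf_sum_def exp_sum_def eval_nat_numeral fact_numeral power_divide)
  note * = this(1) this(2) order.trans[OF exp_sum_bounds(2) this(3)]
  show "0.8575 < Phi 1.078"
    using Phi_erf_sum(1)[OF _ _ _ *(1)] by simp
  show "elasticity 1.078 < 2"
    by (rule elasticity_less[OF _ *(3) Phi_erf_sum(2)[OF _ _ _ *(2)]]) (simp_all add: power2_eq_square)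
qed

lemma Phi_1_0823: "Phi 1.0823 < 0.8625" and elasticity_1_0823: "2 < elasticity 1.0823"
proof -
  \<comment> \<open>An odd number of terms gives the upper bound, an even number the lower
    bounds.\<close>
  have "erf_sum 5 1.0823 \<le> 0.9036" "0.9034 \<le> erf_sum 6 1.0823" "0.5566 \<le> exp_sum 6 1.0823"
    by (simp_all add: erf_sum_def exp_sum_def eval_nat_numeral fact_numeral power_divide)
  note * = this(1) this(2) order.trans[OF this(3) exp_sum_bounds(1)]
  show "Phi 1.0823 < 0.8625"
    using Phi_erf_sum(2)[OF _ _ _ *(1)] by simp
  show "2 < elasticity 1.0823"
    by (rule elasticity_greater[OF _ *(3) _ Phi_erf_sum(1)[OF _ _ _ *(2)]]) (simp_all add: power2_eq_square)
qed

text \<open>Window for exponent 2/3: \<open>1.9996 * 0.4076 \<ge> 0.815\<close> and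
  \<open>2 * 0.412 \<le> 0.825\<close>, with \<open>0.6575 = 1 - 0.685 / 2\<close> and
  \<open>0.6625 = 1 - 0.675 / 2\<close> for the acceptance rate.\<close>

lemma Phi_0_4076: "0.6575 < Phi 0.4076" and elasticity_0_4076: "elasticity 0.4076 < 2/3"
proof -
  have "0.396 \<le> erf_sum 4 0.4076" "erf_sum 5 0.4076 \<le> 0.3966" "exp_sum 5 0.4076 \<le> 0.92029"
    by (simp_all add: erf_sum_def exp_sum_def eval_nat_numeral fact_numeral power_divide)
  note * = this(1) this(2) order.trans[OF exp_sum_bounds(2) this(3)]
  show "0.6575 < Phi 0.4076"
    using Phi_erf_sum(1)[OF _ _ _ *(1)] by simp
  show "elasticity 0.4076 < 2/3"
    by (rule elasticity_less[OF _ *(3) Phi_erf_sum(2)[OF _ _ _ *(2)]]) (simp_all add: power2_eq_square)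
qed

lemma Phi_0_412: "Phi 0.412 < 0.6625" and elasticity_0_412: "2/3 < elasticity 0.412"
proof -
  have "erf_sum 5 0.412 \<le> 0.4007" "0.4006 \<le> erf_sum 4 0.412" "0.9186 \<le> exp_sum 4 0.412"
    by (simp_all add: erf_sum_def exp_sum_def eval_nat_numeral fact_numeral power_divide)
  note * = this(1) this(2) order.trans[OF this(3) exp_sum_bounds(1)]
  show "Phi 0.412 < 0.6625"
    using Phi_erf_sum(2)[OF _ _ _ *(1)] by simp
  show "2/3 < elasticity 0.412"
    by (rule elasticity_greater[OF _ *(3) _ Phi_erf_sum(1)[OF _ _ _ *(2)]]) (simp_all add: power2_eq_square)
qed

section \<open>Minimisation of the computing time\<close>

definition sigma_of :: "nat \<Rightarrow> real \<Rightarrow> real" where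
  "sigma_of G x = x * sqrt 2 / sqrt (1 - rho G)"

lemma
  assumes "3 \<le> G"
  shows sigma_of_pos: "0 < x \<Longrightarrow> 0 < sigma_of G x"
    and sigma_of_inverse: "sigma_of G (\<sigma> * sqrt (1 - rho G) / sqrt 2) = \<sigma>"
  using rho_bounds[of G] assms by (simp_all add: sigma_of_def)

lemma sigma_of_powr:
  assumes "3 \<le> G" "0 < x"
  shows "sigma_of G x powr \<alpha> = x powr \<alpha> * (sqrt 2 / sqrt (1 - rho G)) powr \<alpha>"
proof -
  have "sigma_of G x = x * (sqrt 2 / sqrt (1 - rho G))" by (simp add: sigma_of_def)
  moreover have "0 \<le> sqrt 2 / sqrt (1 - rho G)" using rho_bounds[of G] assms by simp
  ultimately show ?thesis using assms by (simp only: powr_mult)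
qed

lemma inefficiency_ge_limit:
  assumes "3 \<le> G" "0 < x"
  shows "limit_inefficiency x \<le> inefficiency G (sigma_of G x)"
proof -
  have "- sigma_of G x * sqrt (1 - rho G) / sqrt 2 = - x"
    using rho_bounds[of G] assms by (simp add: sigma_of_def)
  then show ?thesis
    using inefficiency_lower[OF assms(1) sigma_of_pos[OF assms]] by (simp add: limit_inefficiency_def)
qed

lemma exp_log_cost: "0 < x \<Longrightarrow> exp (log_cost \<alpha> x) = limit_inefficiency x / x powr \<alpha>"
  by (simp add: log_cost_def exp_diff limit_inefficiency_pos powr_def)

text \<open>Outside the window the cost exceeds the limiting cost, which is at least its value at
  the nearer end, which exceeds the cost at \<open>x0\<close>. Inside, continuity on a compact
  interval yields a minimum, which is then global.\<close>

lemma minimizer_in_window: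
  fixes c :: "real \<Rightarrow> real"
  assumes G: "3 \<le> G" and lo: "0 < lo" "lo < x0" "x0 < hi"
    and elasticity: "elasticity lo \<le> \<alpha>" "\<alpha> \<le> elasticity hi"
    and small: "inefficiency G (sigma_of G x0) / x0 powr \<alpha> < limit_inefficiency lo / lo powr \<alpha>"
      "inefficiency G (sigma_of G x0) / x0 powr \<alpha> < limit_inefficiency hi / hi powr \<alpha>"
    and c: "\<And>\<sigma>. 0 < \<sigma> \<Longrightarrow> c \<sigma> = inefficiency G \<sigma> / \<sigma> powr \<alpha>"
  shows "\<exists>\<sigma>. is_arg_min c (\<lambda>s. 0 < s) \<sigma>"
    and "is_arg_min c (\<lambda>s. 0 < s) \<sigma> \<Longrightarrow> lo < \<sigma> * sqrt (1 - rho G) / sqrt 2 \<and> \<sigma> * sqrt (1 - rho G) / sqrt 2 < hi"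
proof -
  define h where "h x = inefficiency G (sigma_of G x) / x powr \<alpha>" for x
  define C where "C = (sqrt 2 / sqrt (1 - rho G)) powr \<alpha>"
  have C: "0 < C" unfolding C_def using rho_bounds[of G] G by simp
  have ch: "c (sigma_of G x) = h x / C" if "0 < x" for x
    using c[OF sigma_of_pos[OF G that]] by (simp add: h_def C_def sigma_of_powr[OF G that])
  have out: "h x0 < h x" if x: "0 < x" "x \<le> lo \<or> hi \<le> x" for x
  proof -
    have "h x0 < limit_inefficiency x / x powr \<alpha>"
      using x(2)
    proof
      assume "x \<le> lo"
      then have "log_cost \<alpha> lo \<le> log_cost \<alpha> x"
        using log_cost_decreasing[OF x(1) _ elasticity(1)] by (cases "x = lo") auto
      then have "limit_inefficiency lo / lo powr \<alpha> \<le> limit_inefficiency x / x powr \<alpha>"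
        using exp_log_cost[OF x(1)] exp_log_cost[OF lo(1)] by (metis exp_le_cancel_iff)
      then show ?thesis using small(1) by (simp add: h_def)
    next
      assume "hi \<le> x"
      have hi: "0 < hi" using lo by simp
      have "log_cost \<alpha> hi \<le> log_cost \<alpha> x"
        using log_cost_increasing[OF hi _ elasticity(2), of x] \<open>hi \<le> x\<close> by (cases "x = hi") auto
      then have "limit_inefficiency hi / hi powr \<alpha> \<le> limit_inefficiency x / x powr \<alpha>"
        using exp_log_cost[OF x(1)] exp_log_cost[OF hi] by (metis exp_le_cancel_iff)
      then show ?thesis using small(2) by (simp add: h_def)
    qed
    also have "\<dots> \<le> h x"
      unfolding h_def by (intro divide_right_mono inefficiency_ge_limit G x) simp
    finally show ?thesis .
  qed
  have cont: "continuous_on {lo..hi} h"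
  proof -
    have "continuous_on {lo..hi} (\<lambda>x. inefficiency G (sigma_of G x))"
    proof (rule continuous_on_compose2[OF inefficiency_continuous[OF G]])
      show "continuous_on {lo..hi} (sigma_of G)"
        unfolding sigma_of_def using rho_bounds[of G] G by (intro continuous_intros) auto
      show "sigma_of G ` {lo..hi} \<subseteq> {0<..}" using sigma_of_pos[OF G] lo by auto
    qed
    then show ?thesis unfolding h_def using lo by (intro continuous_intros) auto
  qed
  obtain x1 where x1: "x1 \<in> {lo..hi}" and min: "\<And>x. x \<in> {lo..hi} \<Longrightarrow> h x1 \<le> h x"
    using continuous_attains_inf[OF _ _ cont] lo by fastforce
  have x1_0: "0 < x1" using x1 lo by simp
  have glob: "h x1 \<le> h x" if "0 < x" for x
  proof (cases "x \<in> {lo..hi}")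
    case False
    then have "h x0 < h x" using out[OF that] by auto
    moreover have "h x1 \<le> h x0" using min[of x0] lo by simp
    ultimately show ?thesis by simp
  qed (rule min)
  have arg: "\<exists>x>0. s = sigma_of G x" if "0 < s" for s
    using sigma_of_inverse[OF G, of s] that rho_bounds[of G] G
    by (intro exI[of _ "s * sqrt (1 - rho G) / sqrt 2"]) auto
  have "is_arg_min c (\<lambda>s. 0 < s) (sigma_of G x1)"
    unfolding is_arg_min_linorder
  proof (intro conjI allI impI)
    show "0 < sigma_of G x1" by (rule sigma_of_pos[OF G x1_0])
    fix s :: real assume "0 < s"
    with arg obtain x where "0 < x" "s = sigma_of G x" by blast
    then show "c (sigma_of G x1) \<le> c s"
      using glob[of x] ch[of x] ch[OF x1_0] C by (simp add: divide_right_mono)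
  qed
  then show "\<exists>\<sigma>. is_arg_min c (\<lambda>s. 0 < s) \<sigma>" ..
  assume m: "is_arg_min c (\<lambda>s. 0 < s) \<sigma>"
  define x where "x = \<sigma> * sqrt (1 - rho G) / sqrt 2"
  have s0: "0 < \<sigma>" and le: "\<And>y. 0 < y \<Longrightarrow> c \<sigma> \<le> c y" using m by (auto simp: is_arg_min_linorder)
  have x: "0 < x" "\<sigma> = sigma_of G x"
    using s0 rho_bounds[of G] G sigma_of_inverse[OF G, of \<sigma>] by (auto simp: x_def)
  have "0 < x0" using lo by simp
  then have "h x / C \<le> h x0 / C" using le[OF sigma_of_pos[OF G, of x0]] ch x by simp
  then have "h x \<le> h x0" using C by (simp add: divide_le_cancel)
  then have "\<not> (x \<le> lo \<or> hi \<le> x)" using out[OF x(1)] by force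
  then show "lo < x \<and> x < hi" by auto
qed

text \<open>All conditions are strict inequalities at the exponent \<open>\<alpha>0\<close> in the
  limit of large \<open>G\<close>, and both sides converge jointly in \<open>G\<close> and the
  exponent; so they persist nearby. The comparison point stays fixed while the exponent
  moves.\<close>

lemma eventually_minimizer_in_window:
  assumes lo: "0 < lo" "lo < hi" and elasticity: "elasticity lo < \<alpha>0" "\<alpha>0 < elasticity hi"
  shows "\<forall>\<^sub>F (G, \<alpha>) in sequentially \<times>\<^sub>F nhds \<alpha>0. 3 \<le> G \<and> elasticity lo \<le> \<alpha> \<and> \<alpha> \<le> elasticity hi \<and>
    (\<exists>x0. lo < x0 \<and> x0 < hi \<and>
      inefficiency G (sigma_of G x0) / x0 powr \<alpha> < limit_inefficiency lo / lo powr \<alpha> \<and>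
      inefficiency G (sigma_of G x0) / x0 powr \<alpha> < limit_inefficiency hi / hi powr \<alpha>)"
proof -
  \<comment> \<open>The minimiser of the limiting cost, so that its cost is strictly below that at
    both ends.\<close>
  obtain x where x: "lo < x" "x < hi" "elasticity x = \<alpha>0"
    using elasticity_solution[OF lo(1) elasticity lo(2)] .
  have x0: "0 < x" "0 < hi" using x lo by auto
  let ?F = "sequentially \<times>\<^sub>F nhds \<alpha>0"
  have fst: "filterlim fst sequentially ?F" and snd: "(snd \<longlongrightarrow> \<alpha>0) ?F"
    by (rule filterlim_fst, rule filterlim_snd)
  have "(\<lambda>G. inefficiency G (sigma_of G x)) \<longlonglongrightarrow> limit_inefficiency x"
    unfolding sigma_of_def limit_inefficiency_def by (rule inefficiency_limit[OF x0(1)])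
  from filterlim_compose[OF this fst]
  have I: "((\<lambda>p. inefficiency (fst p) (sigma_of (fst p) x)) \<longlongrightarrow> limit_inefficiency x) ?F" .
  have P: "((\<lambda>p. y powr snd p) \<longlongrightarrow> y powr \<alpha>0) ?F" if "0 < y" for y
    using that by (intro tendsto_intros snd) auto
  have L: "((\<lambda>p. limit_inefficiency y / y powr snd p) \<longlongrightarrow> limit_inefficiency y / y powr \<alpha>0) ?F" if "0 < y" for y
    using that by (intro tendsto_divide tendsto_const P) auto
  have H: "((\<lambda>p. inefficiency (fst p) (sigma_of (fst p) x) / x powr snd p) \<longlongrightarrow> limit_inefficiency x / x powr \<alpha>0) ?F"
    using x0 by (intro tendsto_divide I P) auto
  have lt: "\<forall>\<^sub>F p in ?F. inefficiency (fst p) (sigma_of (fst p) x) / x powr snd p < limit_inefficiency y / y powr snd p"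
    if "0 < y" "log_cost \<alpha>0 x < log_cost \<alpha>0 y" for y
  proof -
    have "limit_inefficiency x / x powr \<alpha>0 < limit_inefficiency y / y powr \<alpha>0"
      using that exp_log_cost[OF x0(1), of \<alpha>0] exp_log_cost[OF that(1), of \<alpha>0] by (metis exp_less_cancel_iff)
    then have "0 < limit_inefficiency y / y powr \<alpha>0 - limit_inefficiency x / x powr \<alpha>0" by simp
    from order_tendstoD(1)[OF tendsto_diff[OF L[OF that(1)] H] this]
    show ?thesis by eventually_elim simp
  qed
  have 1: "\<forall>\<^sub>F p in ?F. inefficiency (fst p) (sigma_of (fst p) x) / x powr snd p < limit_inefficiency lo / lo powr snd p"
    by (rule lt[OF lo(1) log_cost_decreasing]) (use x lo in auto)
  have 2: "\<forall>\<^sub>F p in ?F. inefficiency (fst p) (sigma_of (fst p) x) / x powr snd p < limit_inefficiency hi / hi powr snd p"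
    by (rule lt[OF x0(2) log_cost_increasing]) (use x lo in auto)
  have 3: "\<forall>\<^sub>F p in ?F. 3 \<le> fst p"
    by (rule eventually_compose_filterlim[OF eventually_ge_at_top fst])
  have 4: "\<forall>\<^sub>F p in ?F. elasticity lo < snd p" and 5: "\<forall>\<^sub>F p in ?F. snd p < elasticity hi"
    using order_tendstoD[OF snd] elasticity by auto
  from 1 2 3 4 5 show ?thesis
    by eventually_elim (use x in \<open>auto simp: case_prod_beta\<close>)
qed

text \<open>\<open>IF\<close> is a \<open>lim\<close>, so the explicit formula for \<open>CT\<close>
  is available exactly where convergence has been shown, for positive \<open>\<sigma>\<close>. Hence
  \<open>minimizer_in_window\<close> admits any function that agrees with the cost there.\<close>

lemma CT_minimizer:
  fixes m :: "('t, 'u) block_model"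
  assumes m: "block_model m" "assumption_C m" "test_function m \<phi>" and G: "3 \<le> nblk m"
    and lo: "0 < lo" and elasticity: "elasticity lo \<le> 1 / \<omega>" "1 / \<omega> \<le> elasticity hi"
    and x0: "\<exists>x0. lo < x0 \<and> x0 < hi \<and>
      inefficiency (nblk m) (sigma_of (nblk m) x0) / x0 powr (1 / \<omega>) < limit_inefficiency lo / lo powr (1 / \<omega>) \<and>
      inefficiency (nblk m) (sigma_of (nblk m) x0) / x0 powr (1 / \<omega>) < limit_inefficiency hi / hi powr (1 / \<omega>)"
  shows "\<forall>\<sigma>>0. convergent (IF_seq m \<phi> \<sigma>)" and "\<exists>\<sigma>. sigma_opt m \<phi> \<omega> \<sigma>"
    and "sigma_opt m \<phi> \<omega> \<sigma> \<Longrightarrow> 0 < \<sigma> \<and> lo < \<sigma> * sqrt (1 - rho (nblk m)) / sqrt 2 \<and> \<sigma> * sqrt (1 - rho (nblk m)) / sqrt 2 < hi"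
proof -
  have G2: "2 \<le> nblk m" using G by simp
  have lim: "IF_seq m \<phi> \<sigma> \<longlonglongrightarrow> inefficiency (nblk m) \<sigma>" if "0 < \<sigma>" for \<sigma>
    by (rule IF_seq_tendsto[OF m(1,2,3) G2 that accept_at_pos[OF G2 that] integrable_inverse_accept_at[OF G that]])
  then show "\<forall>\<sigma>>0. convergent (IF_seq m \<phi> \<sigma>)" by (auto intro: convergentI)
  have c: "CT m \<phi> \<omega> \<sigma> = inefficiency (nblk m) \<sigma> / \<sigma> powr (1 / \<omega>)" if "0 < \<sigma>" for \<sigma>
    using limI[OF lim[OF that]] by (simp add: CT_def IF_def)
  obtain x0 where x: "lo < x0" "x0 < hi"
      "inefficiency (nblk m) (sigma_of (nblk m) x0) / x0 powr (1 / \<omega>) < limit_inefficiency lo / lo powr (1 / \<omega>)"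
      "inefficiency (nblk m) (sigma_of (nblk m) x0) / x0 powr (1 / \<omega>) < limit_inefficiency hi / hi powr (1 / \<omega>)"
    using x0 by blast
  note * = minimizer_in_window[OF G lo x(1,2) elasticity x(3,4), of "CT m \<phi> \<omega>", OF c]
  show "\<exists>\<sigma>. sigma_opt m \<phi> \<omega> \<sigma>" using *(1) by (simp add: sigma_opt_def)
  show "sigma_opt m \<phi> \<omega> \<sigma> \<Longrightarrow> 0 < \<sigma> \<and> lo < \<sigma> * sqrt (1 - rho (nblk m)) / sqrt 2 \<and> \<sigma> * sqrt (1 - rho (nblk m)) / sqrt 2 < hi"
    using *(2)[of \<sigma>] by (auto simp: sigma_opt_def is_arg_min_def)
qed

text \<open>Translates a window for \<open>x\<close> into bounds for
  \<open>\<sigma> * sqrt (1 - (rho G)^2)\<close>, which is \<open>x\<close> times a factor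
  increasing to 2. The number 1.9996 is close enough to 2 for the left ends of both windows; the
  tighter case is \<open>0.815 / 0.4076\<close>, about 1.9995.\<close>

lemma window_bounds:
  assumes G: "3 \<le> G" and near: "1.9996 < sqrt 2 * sqrt (1 + rho G)"
    and lo: "0 < lo" "t - 0.005 \<le> 1.9996 * lo" "2 * hi \<le> t + 0.005"
    and Phi: "2 * (1 - Phi lo) < a + 0.005" "a - 0.005 < 2 * (1 - Phi hi)"
    and \<sigma>: "0 < \<sigma>" "lo < \<sigma> * sqrt (1 - rho G) / sqrt 2" "\<sigma> * sqrt (1 - rho G) / sqrt 2 < hi"
  shows "\<bar>\<sigma> * sqrt (1 - (rho G)\<^sup>2) - t\<bar> < 0.005" and "\<bar>accept_rate G \<sigma> - a\<bar> < 0.005"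
proof -
  define s where "s = \<sigma> * sqrt (1 - rho G) / sqrt 2"
  have s: "lo < s" "s < hi" using \<sigma> by (simp_all add: s_def)
  have r: "rho G < 1" "0 \<le> rho G" using rho_bounds[of G] G by auto
  have "1 - (rho G)\<^sup>2 = (1 - rho G) * (1 + rho G)" by (simp add: power2_eq_square algebra_simps)
  then have \<tau>: "\<sigma> * sqrt (1 - (rho G)\<^sup>2) = s * (sqrt 2 * sqrt (1 + rho G))"
    by (simp add: s_def real_sqrt_mult)
  have "sqrt 2 * sqrt (1 + rho G) < 2"
    unfolding real_sqrt_mult[symmetric] by (rule real_less_lsqrt) (use r in auto)
  then have 1: "s * (sqrt 2 * sqrt (1 + rho G)) < s * 2"
    using s lo by (intro mult_strict_left_mono) auto
  have 2: "lo * 1.9996 < s * (sqrt 2 * sqrt (1 + rho G))"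
    by (rule mult_strict_mono) (use s lo near in auto)
  have "\<bar>T - t\<bar> < 0.005" if "T < s * 2" "lo * 1.9996 < T" for T
  proof -
    have "T < t + 0.005" using that s lo(3) by simp
    moreover have "t - 0.005 < T" using that s lo(2) by simp
    ultimately show ?thesis unfolding abs_diff_less_iff by blast
  qed
  from this[OF 1 2] show "\<bar>\<sigma> * sqrt (1 - (rho G)\<^sup>2) - t\<bar> < 0.005"
    unfolding \<tau> .
  have "accept_rate G \<sigma> = 2 * Phi (- s)"
    using accept_rate_eq[of G \<sigma>] G \<sigma> by (simp add: s_def)
  then have "accept_rate G \<sigma> = 2 * (1 - Phi s)" by (simp only: Phi_minus)
  moreover have "Phi lo < Phi s" "Phi s < Phi hi" using s by (auto intro: Phi_strict_mono)
  ultimately have "accept_rate G \<sigma> < a + 0.005" "a - 0.005 < accept_rate G \<sigma>"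
    using Phi by simp_all
  then show "\<bar>accept_rate G \<sigma> - a\<bar> < 0.005" unfolding abs_diff_less_iff by blast
qed

lemma eventually_optimum:
  assumes lo: "0 < lo" "lo < hi" "t - 0.005 \<le> 1.9996 * lo" "2 * hi \<le> t + 0.005"
    and elasticity: "elasticity lo < \<alpha>" "\<alpha> < elasticity hi"
    and Phi: "2 * (1 - Phi lo) < a + 0.005" "a - 0.005 < 2 * (1 - Phi hi)"
  shows "\<forall>\<^sub>F (G, \<beta>) in sequentially \<times>\<^sub>F nhds \<alpha>. \<forall>(m :: ('t, 'u) block_model) \<phi> \<omega>.
    nblk m = G \<and> 1 / \<omega> = \<beta> \<and> block_model m \<and> assumption_C m \<and> test_function m \<phi> \<longrightarrow>
      (\<forall>\<sigma>>0. convergent (IF_seq m \<phi> \<sigma>)) \<and> (\<exists>\<sigma>. sigma_opt m \<phi> \<omega> \<sigma>) \<and>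
      (\<forall>\<sigma>. sigma_opt m \<phi> \<omega> \<sigma> \<longrightarrow>
        \<bar>\<sigma> * sqrt (1 - (rho G)\<^sup>2) - t\<bar> < 0.005 \<and> \<bar>accept_rate G \<sigma> - a\<bar> < 0.005)"
proof -
  have "rho \<longlonglongrightarrow> 1 - 0" unfolding rho_def[abs_def] by (intro tendsto_intros lim_1_over_n)
  then have "(\<lambda>G. sqrt 2 * sqrt (1 + rho G)) \<longlonglongrightarrow> sqrt 2 * sqrt (1 + (1 - 0))"
    by (intro tendsto_intros)
  from order_tendstoD(1)[OF this, of "1.9996"]
  have "\<forall>\<^sub>F G in sequentially. 1.9996 < sqrt 2 * sqrt (1 + rho G)" by simp
  then have "\<forall>\<^sub>F p in sequentially \<times>\<^sub>F nhds \<alpha>. 1.9996 < sqrt 2 * sqrt (1 + rho (fst p))"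
    by (rule eventually_compose_filterlim[OF _ filterlim_fst])
  with eventually_minimizer_in_window[OF lo(1,2) elasticity]
  show ?thesis
  proof eventually_elim
    case (elim p)
    show ?case
      unfolding case_prod_beta
    proof (intro allI impI)
      fix m :: "('t, 'u) block_model" and \<phi> \<omega>
      assume "nblk m = fst p \<and> 1 / \<omega> = snd p \<and> block_model m \<and> assumption_C m \<and> test_function m \<phi>"
      then have m: "nblk m = fst p" "1 / \<omega> = snd p" "block_model m" "assumption_C m" "test_function m \<phi>" by auto
      note e = elim(1)[unfolded case_prod_beta m(1,2)[symmetric]]
      have G: "3 \<le> nblk m" and s: "elasticity lo \<le> 1 / \<omega>" "1 / \<omega> \<le> elasticity hi" using e by auto
      note M = CT_minimizer[OF m(3-5) G lo(1) s e[THEN conjunct2, THEN conjunct2, THEN conjunct2]]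
      show "(\<forall>\<sigma>>0. convergent (IF_seq m \<phi> \<sigma>)) \<and> (\<exists>\<sigma>. sigma_opt m \<phi> \<omega> \<sigma>) \<and>
        (\<forall>\<sigma>. sigma_opt m \<phi> \<omega> \<sigma> \<longrightarrow>
          \<bar>\<sigma> * sqrt (1 - (rho (fst p))\<^sup>2) - t\<bar> < 0.005 \<and> \<bar>accept_rate (fst p) \<sigma> - a\<bar> < 0.005)"
        using M window_bounds[OF G elim(2)[folded m(1)] lo(1,3,4) Phi] unfolding m(1)[symmetric] by blast
    qed
  qed
qed

theorem lemma3:
  shows
  "(\<forall>\<^sub>F G in sequentially. \<forall>(m :: ('t, 'u) block_model) \<phi>.
      nblk m = G \<and> block_model m \<and> assumption_A m (1/2) \<and> assumption_B m \<and> assumption_C m \<and>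
      test_function m \<phi> \<longrightarrow>
      (\<forall>\<sigma>>0. convergent (IF_seq m \<phi> \<sigma>)) \<and>
      (\<exists>\<sigma>. sigma_opt m \<phi> (1/2) \<sigma>) \<and>
      (\<forall>\<sigma>. sigma_opt m \<phi> (1/2) \<sigma> \<longrightarrow>
         \<bar>\<sigma> * sqrt (1 - (rho G)\<^sup>2) - 2.16\<bar> < 0.005 \<and>
         \<bar>accept_rate G \<sigma> - 0.28\<bar> < 0.005))
   \<and>
   (\<forall>\<^sub>F (G, \<epsilon>) in sequentially \<times>\<^sub>F at_right (0::real). \<forall>(m :: ('t, 'u) block_model) \<phi>.
      nblk m = G \<and> block_model m \<and> assumption_A m (3/2 - \<epsilon>) \<and> assumption_B m \<and> assumption_C m \<and>
      test_function m \<phi> \<longrightarrow>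
      (\<forall>\<sigma>>0. convergent (IF_seq m \<phi> \<sigma>)) \<and>
      (\<exists>\<sigma>. sigma_opt m \<phi> (3/2 - \<epsilon>) \<sigma>) \<and>
      (\<forall>\<sigma>. sigma_opt m \<phi> (3/2 - \<epsilon>) \<sigma> \<longrightarrow>
         \<bar>\<sigma> * sqrt (1 - (rho G)\<^sup>2) - 0.82\<bar> < 0.005 \<and>
         \<bar>accept_rate G \<sigma> - 0.68\<bar> < 0.005))"
proof
  have w: "\<forall>\<^sub>F (G, \<beta>) in sequentially \<times>\<^sub>F nhds 2. \<forall>(m :: ('t, 'u) block_model) \<phi> \<omega>.
    nblk m = G \<and> 1 / \<omega> = \<beta> \<and> block_model m \<and> assumption_C m \<and> test_function m \<phi> \<longrightarrow>
      (\<forall>\<sigma>>0. convergent (IF_seq m \<phi> \<sigma>)) \<and> (\<exists>\<sigma>. sigma_opt m \<phi> \<omega> \<sigma>) \<and>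
      (\<forall>\<sigma>. sigma_opt m \<phi> \<omega> \<sigma> \<longrightarrow>
        \<bar>\<sigma> * sqrt (1 - (rho G)\<^sup>2) - 2.16\<bar> < 0.005 \<and> \<bar>accept_rate G \<sigma> - 0.28\<bar> < 0.005)"
    by (rule eventually_optimum[where lo="1.078" and hi="1.0823"])
      (use elasticity_1_078 elasticity_1_0823 Phi_1_078 Phi_1_0823 in simp_all)
  \<comment> \<open>Here \<open>1 / \<omega>\<close> is constantly 2, so only \<open>G\<close>
    varies.\<close>
  have "filterlim (\<lambda>G. (G, 2::real)) (sequentially \<times>\<^sub>F nhds 2) sequentially"
    by (intro filterlim_Pair filterlim_ident tendsto_const)
  from eventually_compose_filterlim[OF w this]
  show "\<forall>\<^sub>F G in sequentially. \<forall>(m :: ('t, 'u) block_model) \<phi>.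
      nblk m = G \<and> block_model m \<and> assumption_A m (1/2) \<and> assumption_B m \<and> assumption_C m \<and>
      test_function m \<phi> \<longrightarrow>
      (\<forall>\<sigma>>0. convergent (IF_seq m \<phi> \<sigma>)) \<and>
      (\<exists>\<sigma>. sigma_opt m \<phi> (1/2) \<sigma>) \<and>
      (\<forall>\<sigma>. sigma_opt m \<phi> (1/2) \<sigma> \<longrightarrow>
         \<bar>\<sigma> * sqrt (1 - (rho G)\<^sup>2) - 2.16\<bar> < 0.005 \<and>
         \<bar>accept_rate G \<sigma> - 0.28\<bar> < 0.005)"
  proof eventually_elim
    case (elim G)
    show ?case
      by (intro allI impI, rule elim[unfolded prod.case, THEN spec, THEN spec, THEN spec, THEN mp]) simp
  qed
next
  have w: "\<forall>\<^sub>F (G, \<beta>) in sequentially \<times>\<^sub>F nhds (2/3). \<forall>(m :: ('t, 'u) block_model) \<phi> \<omega>.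
    nblk m = G \<and> 1 / \<omega> = \<beta> \<and> block_model m \<and> assumption_C m \<and> test_function m \<phi> \<longrightarrow>
      (\<forall>\<sigma>>0. convergent (IF_seq m \<phi> \<sigma>)) \<and> (\<exists>\<sigma>. sigma_opt m \<phi> \<omega> \<sigma>) \<and>
      (\<forall>\<sigma>. sigma_opt m \<phi> \<omega> \<sigma> \<longrightarrow>
        \<bar>\<sigma> * sqrt (1 - (rho G)\<^sup>2) - 0.82\<bar> < 0.005 \<and> \<bar>accept_rate G \<sigma> - 0.68\<bar> < 0.005)"
    by (rule eventually_optimum[where lo="0.4076" and hi="0.412"])
      (use elasticity_0_4076 elasticity_0_412 Phi_0_4076 Phi_0_412 in simp_all)
  have snd: "(snd \<longlongrightarrow> (0::real)) (sequentially \<times>\<^sub>F at_right 0)"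
    by (rule filterlim_mono[OF filterlim_snd at_within_le_nhds order_refl])
  \<comment> \<open>The exponent \<open>1 / (3/2 - \<epsilon>)\<close> tends to 2/3, so small
    \<open>\<epsilon>\<close> and large \<open>G\<close> land in the neighbourhood where the optimum
    is located.\<close>
  have "((\<lambda>p. 1 / (3/2 - snd p)) \<longlongrightarrow> 1 / (3/2 - (0::real))) (sequentially \<times>\<^sub>F at_right 0)"
    by (intro tendsto_intros snd) simp
  then have "filterlim (\<lambda>p. (fst p, 1 / (3/2 - snd p))) (sequentially \<times>\<^sub>F nhds (2/3)) (sequentially \<times>\<^sub>F at_right (0::real))"
    by (intro filterlim_Pair filterlim_fst) simp
  from eventually_compose_filterlim[OF w this]
  show "\<forall>\<^sub>F (G, \<epsilon>) in sequentially \<times>\<^sub>F at_right (0::real). \<forall>(m :: ('t, 'u) block_model) \<phi>.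
      nblk m = G \<and> block_model m \<and> assumption_A m (3/2 - \<epsilon>) \<and> assumption_B m \<and> assumption_C m \<and>
      test_function m \<phi> \<longrightarrow>
      (\<forall>\<sigma>>0. convergent (IF_seq m \<phi> \<sigma>)) \<and>
      (\<exists>\<sigma>. sigma_opt m \<phi> (3/2 - \<epsilon>) \<sigma>) \<and>
      (\<forall>\<sigma>. sigma_opt m \<phi> (3/2 - \<epsilon>) \<sigma> \<longrightarrow>
         \<bar>\<sigma> * sqrt (1 - (rho G)\<^sup>2) - 0.82\<bar> < 0.005 \<and>
         \<bar>accept_rate G \<sigma> - 0.68\<bar> < 0.005)"
  proof eventually_elim
    case (elim p)
    obtain G \<epsilon> where p: "p = (G, \<epsilon>)" by (cases p)
    show ?case
      unfolding p prod.case
      by (intro allI impI, rule elim[unfolded p prod.case fst_conv snd_conv, THEN spec, THEN spec, THEN spec, THEN mp]) simp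
  qed
qed

end
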